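(* Let $k\geq1$ and $n\geq1$ be integers. Within the symmetry class $X^s_{\mathrm{sym}}$, the restriction of $\mathscr{L}_k$ to the cosine chain of transverse frequency $n$ has exactly one positive eigenvalue $\lambda_{k,n}$ when $1\leq n<k$, and none when $n\geq k$. The positive eigenvalue is algebraically simple within its transverse frequency block (of the symmetry class). If, for $1\le n<k$, $K_{k,n}^{\mathrm{ev}}$ denotes the restriction of $K_{k,n}$ to the even-cosine space $\overline{\operatorname{span}}\{\cos(2jkx_1):j\geq0\}\subset L^2(\mathbb{T})$, and $$K_{k,n}^{\mathrm{ev}}g_{k,n}=-\nu_{k,n}g_{k,n},\qquad f_{k,n}=D_{k,n}^{1/2}g_{k,n},$$ where $-\nu_{k,n}$ is the negative eigenvalue of $K^{\mathrm{ev}}_{k,n}$ and $g_{k,n}$ is a (real, nonzero) eigenfunction, then a real eigenfunction of $\mathscr{L}_k$ for $\lambda_{k,n}$ is $$F_{k,n}=f_{k,n}(x_1)\cos(nx_2),\qquad \omega_{k,n}=\frac{nk}{\lambda_{k,n}}C_kA_{k,n}f_{k,n}(x_1)\sin(nx_2),\qquad \lambda_{k,n}=nk\sqrt{\nu_{k,n}}.$$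
   Context: On $\mathbb{T}^2=(\mathbb{R}/2\pi\mathbb{Z})^2$, for $s\geq0$ let $X^s=H^{s-1}_0(\mathbb{T}^2;\mathbb{C})\times H^s(\mathbb{T}^2;\mathbb{C})\ni(\omega,F)$ (subscript $0$: mean zero). Define $A_k=I-(1+k^2)(1-\Delta)^{-1}$, $B_k=-(1+k^2)\Delta^{-1}$ and the bounded operator $$\mathscr{L}_k=-k\cos(kx_1)\,\partial_{x_2}\begin{pmatrix}0 & A_k \\ B_k & 0\end{pmatrix}.$$ For an integer $n\neq0$, on functions of $x_1\in\mathbb{T}=\mathbb{R}/2\pi\mathbb{Z}$ put $$A_{k,n}e^{\mathrm{i}mx_1}=\frac{m^2+n^2-k^2}{m^2+n^2+1}e^{\mathrm{i}mx_1},\qquad B_{k,n}e^{\mathrm{i}mx_1}=\frac{1+k^2}{m^2+n^2}e^{\mathrm{i}mx_1},$$ let $C_k$ be multiplication by $\cos(kx_1)$, and on $L^2(\mathbb{T})$ set $D_{k,n}=C_kB_{k,n}C_k$ (positive, injective, compact, self-adjoint) and $K_{k,n}=D_{k,n}^{1/2}A_{k,n}D_{k,n}^{1/2}$ (compact, self-adjoint). Symmetry class: $X^s_{\mathrm{sym}}$ is the closed $\mathscr{L}_k$-invariant subspace of $(\omega,F)\in X^s$ that are $2\pi/k$-periodic in $x_1$ and satisfy $\omega(\pi/k-x_1,x_2)=-\omega(x_1,x_2)$, $F(\pi/k-x_1,x_2)=F(x_1,x_2)$, $\omega(x_1,-x_2)=-\omega(x_1,x_2)$, $F(x_1,-x_2)=F(x_1,x_2)$.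 Its transverse block of frequency $n\ge1$ consists of its elements of the form $\omega=h(x_1)\sin(nx_2)$, $F=f(x_1)\cos(nx_2)$. The cosine chain of frequency $n$ is the invariant subspace of that block with $f\in\overline{\operatorname{span}}\{\cos(2jkx_1):j\geq0\}$ and $h\in\overline{\operatorname{span}}\{\cos((2j+1)kx_1):j\geq0\}$. *)

theory Defs
  imports "HOL-Analysis.Analysis" "HOL-Library.Function_Algebras"
begin

section \<open>Complex vector spaces\<close>

class complex_vs = ab_group_add +
  fixes scaleC :: "complex \<Rightarrow> 'a \<Rightarrow> 'a"  (infixr "*\<^sub>C" 75)
  assumes scaleC_right_distrib: "a *\<^sub>C (x + y) = a *\<^sub>C x + a *\<^sub>C y"
    and scaleC_left_distrib: "(a + b) *\<^sub>C x = a *\<^sub>C x + b *\<^sub>C x"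
    and scaleC_scaleC: "a *\<^sub>C b *\<^sub>C x = (a * b) *\<^sub>C x"
    and scaleC_one: "1 *\<^sub>C x = x"

instantiation complex :: complex_vs
begin
definition "scaleC_complex (a::complex) (x::complex) = a * x"
instance by standard (simp_all add: scaleC_complex_def algebra_simps)
end

instantiation "fun" :: (type, complex_vs) complex_vs
begin
definition "scaleC_fun a (f :: 'a \<Rightarrow> 'b) = (\<lambda>x. a *\<^sub>C f x)"
instance
  by standard (simp_all add: scaleC_fun_def fun_eq_iff scaleC_right_distrib
      scaleC_left_distrib scaleC_scaleC scaleC_one)
end

instantiation prod :: (complex_vs, complex_vs) complex_vs
begin
definition "scaleC_prod a (x :: 'a \<times> 'b) = (a *\<^sub>C fst x, a *\<^sub>C snd x)"
instance
  by standard (simp_all add: scaleC_prod_def prod_eq_iff scaleC_right_distrib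
      scaleC_left_distrib scaleC_scaleC scaleC_one)
end

global_interpretation complex_vs: vector_space "scaleC :: complex \<Rightarrow> 'a \<Rightarrow> 'a::complex_vs"
  defines complex_span = complex_vs.span
    and complex_dim = complex_vs.dim
  by standard (rule scaleC_right_distrib scaleC_left_distrib scaleC_scaleC scaleC_one)+

text \<open>
  Eigenvectors, eigenvalues and generalized eigenspaces of the restriction of \<open>T\<close> to the
  linear subspace \<open>V\<close>. The algebraic multiplicity is the complex dimension of the
  generalized eigenspace.
\<close>

definition eigenvector :: "('a::complex_vs \<Rightarrow> 'a) \<Rightarrow> 'a set \<Rightarrow> complex \<Rightarrow> 'a \<Rightarrow> bool" where
  "eigenvector T V \<mu> v \<longleftrightarrow> v \<in> V \<and> v \<noteq> 0 \<and> T v = \<mu> *\<^sub>C v"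

definition eigenvalue :: "('a::complex_vs \<Rightarrow> 'a) \<Rightarrow> 'a set \<Rightarrow> complex \<Rightarrow> bool" where
  "eigenvalue T V \<mu> \<longleftrightarrow> (\<exists>v. eigenvector T V \<mu> v)"

definition gen_eigenspace :: "('a::complex_vs \<Rightarrow> 'a) \<Rightarrow> 'a set \<Rightarrow> complex \<Rightarrow> 'a set" where
  "gen_eigenspace T V \<mu> = {v \<in> V. \<exists>p::nat. ((\<lambda>w. T w - \<mu> *\<^sub>C w) ^^ p) v = 0}"

definition algebraically_simple :: "('a::complex_vs \<Rightarrow> 'a) \<Rightarrow> 'a set \<Rightarrow> complex \<Rightarrow> bool" where
  "algebraically_simple T V \<mu> \<longleftrightarrow> eigenvalue T V \<mu> \<and> complex_dim (gen_eigenspace T V \<mu>) = 1"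

section \<open>Functions and distributions on the torus\<close>

text \<open>
  A distribution \<open>u\<close> on \<open>\<real> / 2\<pi>\<int>\<close> (resp. its square) is represented by its
  Fourier coefficients, \<open>u = (\<Sum>m. u m * exp (\<i> m \<bullet> x))\<close>. Negative-order Sobolev spaces occur
  below, so genuine functions would not suffice. By Plancherel, \<open>L\<^sup>2\<close> is the space of square
  summable families. A genuine function enters through \<open>fourier\<close>.
\<close>

type_synonym dist1 = "int \<Rightarrow> complex"
type_synonym dist2 = "int \<times> int \<Rightarrow> complex"

definition fourier :: "(real \<Rightarrow> complex) \<Rightarrow> dist1" where
  "fourier \<phi> m = of_real (1 / (2 * pi)) *
     integral {0..2 * pi} (\<lambda>x. \<phi> x * exp (- (\<i> * of_int m * of_real x)))"

abbreviation fcos :: "int \<Rightarrow> dist1" where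
  "fcos j \<equiv> fourier (\<lambda>x. of_real (cos (of_int j * x)))"

abbreviation fsin :: "int \<Rightarrow> dist1" where
  "fsin j \<equiv> fourier (\<lambda>x. of_real (sin (of_int j * x)))"

lemma fourier_exp: "fourier (\<lambda>x. exp (\<i> * of_int j * of_real x)) m = (if m = j then 1 else 0)"
proof -
  have eq: "exp (\<i> * of_int j * of_real x) * exp (- (\<i> * of_int m * of_real x))
      = exp (\<i> * of_int (j - m) * complex_of_real x)" for x
    by (simp add: mult_exp_exp algebra_simps)
  show ?thesis
  proof (cases "m = j")
    case True
    then show ?thesis by (simp add: fourier_def mult_exp_exp scaleR_conv_of_real)
  next
    case False
    define c where "c = \<i> * complex_of_int (j - m)"
    have c: "c \<noteq> 0" using False by (simp add: c_def)
    have "((\<lambda>x. exp (c * complex_of_real x)) has_integral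
        exp (c * of_real (2 * pi)) / c - exp (c * of_real 0) / c) {0..2 * pi}"
    proof (rule fundamental_theorem_of_calculus)
      fix x assume "x \<in> {0..2 * pi}"
      have "((\<lambda>z. exp (c * z) / c) has_field_derivative exp (c * of_real x)) (at (of_real x))"
        using c by (auto intro!: derivative_eq_intros)
      then show "((\<lambda>x. exp (c * complex_of_real x) / c) has_vector_derivative
          exp (c * complex_of_real x)) (at x within {0..2 * pi})"
        by (rule has_vector_derivative_real_field)
    qed simp
    moreover have "exp (c * of_real (2 * pi)) = 1"
      unfolding exp_eq_1 by (auto simp: c_def intro!: exI[of _ "j - m"])
    ultimately have "integral {0..2 * pi} (\<lambda>x. exp (c * complex_of_real x)) = 0"
      by (auto simp: has_integral_iff)
    then show ?thesis using False by (simp add: fourier_def eq c_def)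
  qed
qed

lemma fourier_cos_mult:
  assumes "continuous_on {0..2 * pi} \<phi>"
  shows "fourier (\<lambda>x. of_real (cos (of_int j * x)) * \<phi> x) m =
    (fourier \<phi> (m - j) + fourier \<phi> (m + j)) / 2"
proof -
  have eq: "of_real (cos (of_int j * x)) * \<phi> x * exp (- (\<i> * of_int m * of_real x)) =
      (\<phi> x * exp (- (\<i> * of_int (m - j) * of_real x)) +
       \<phi> x * exp (- (\<i> * of_int (m + j) * of_real x))) / 2" for x
  proof -
    have "complex_of_real (cos (of_int j * x)) =
        (exp (\<i> * (of_int j * of_real x)) + exp (- (\<i> * (of_int j * of_real x)))) / 2"
      by (simp only: cos_of_real[symmetric] of_real_mult of_real_of_int_eq cos_exp_eq)
    then show ?thesis
      by (simp add: exp_diff exp_minus exp_add ring_distribs field_simps)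
  qed
  have int: "(\<lambda>x. \<phi> x * exp (- (\<i> * of_int i * of_real x))) integrable_on {0..2 * pi}" for i
    by (intro integrable_continuous_interval continuous_intros assms)
  show ?thesis
    unfolding fourier_def eq using int[of "m - j"] int[of "m + j"]
    by (simp add: integral_add add_divide_distrib ring_distribs)
qed

lemma fcos_eq: "fcos j m = ((if m = j then 1 else 0) + (if m = - j then 1 else 0)) / 2"
proof -
  have "fcos j m = (fourier (\<lambda>x. 1) (m - j) + fourier (\<lambda>x. 1) (m + j)) / 2"
    using fourier_cos_mult[of "\<lambda>x. 1" j m] by simp
  then show ?thesis
    using fourier_exp[of 0] by (simp add: eq_neg_iff_add_eq_0)
qed

text \<open>The distribution \<open>f(x\<^sub>1) g(x\<^sub>2)\<close>.\<close>

definition tensor :: "dist1 \<Rightarrow> dist1 \<Rightarrow> dist2" where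
  "tensor f g = (\<lambda>(m1, m2). f m1 * g m2)"

text \<open>
  The Fourier coefficients of a product are the convolution of those of the factors. Below,
  the first factor is always a trigonometric polynomial, so the sum is finite.
\<close>

definition mult :: "('i::ab_group_add \<Rightarrow> complex) \<Rightarrow> ('i \<Rightarrow> complex) \<Rightarrow> 'i \<Rightarrow> complex" where
  "mult a u m = (\<Sum>\<^sub>\<infinity>j. a j * u (m - j))"

lemma mult_fcos: "mult (fcos j) u m = (u (m - j) + u (m + j)) / 2"
proof -
  have "mult (fcos j) u m = (\<Sum>\<^sub>\<infinity>i\<in>{j, - j}. fcos j i * u (m - i))"
    unfolding mult_def by (rule infsum_cong_neutral) (auto simp: fcos_eq)
  also have "\<dots> = (u (m - j) + u (m + j)) / 2"
    using fourier_exp[of 0]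
    by (cases "j = 0") (auto simp: fcos_eq add_divide_distrib)
  finally show ?thesis .
qed

text \<open>Hence \<open>mult\<close> is consistent with pointwise multiplication.\<close>

lemma mult_fcos_fourier:
  assumes "continuous_on {0..2 * pi} \<phi>"
  shows "mult (fcos j) (fourier \<phi>) = fourier (\<lambda>x. of_real (cos (of_int j * x)) * \<phi> x)"
  using fourier_cos_mult[OF assms] by (simp add: fun_eq_iff mult_fcos)

definition real_valued :: "('i::ab_group_add \<Rightarrow> complex) \<Rightarrow> bool" where
  "real_valued u \<longleftrightarrow> (\<forall>m. u (- m) = cnj (u m))"

definition sobolev1 :: "real \<Rightarrow> dist1 set" where
  "sobolev1 r = {u. (\<lambda>m. (1 + (of_int m)\<^sup>2) powr r * (cmod (u m))\<^sup>2) summable_on UNIV}"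

definition sobolev_norm1 :: "real \<Rightarrow> dist1 \<Rightarrow> real" where
  "sobolev_norm1 r u = sqrt (\<Sum>\<^sub>\<infinity>m. (1 + (of_int m)\<^sup>2) powr r * (cmod (u m))\<^sup>2)"

definition sobolev2 :: "real \<Rightarrow> dist2 set" where
  "sobolev2 r = {u. (\<lambda>(m1, m2). (1 + (of_int m1)\<^sup>2 + (of_int m2)\<^sup>2) powr r *
     (cmod (u (m1, m2)))\<^sup>2) summable_on UNIV}"

text \<open>The closure in \<open>H\<^sup>r\<close> of the linear span of a set of trigonometric polynomials.\<close>

definition closed_span :: "real \<Rightarrow> dist1 set \<Rightarrow> dist1 set" where
  "closed_span r S = {u \<in> sobolev1 r. \<forall>\<epsilon>>0. \<exists>v \<in> complex_span S. sobolev_norm1 r (u - v) < \<epsilon>}"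

section \<open>The operator on the two-dimensional torus\<close>

definition dx2 :: "dist2 \<Rightarrow> dist2" where
  "dx2 u = (\<lambda>(m1, m2). \<i> * of_int m2 * u (m1, m2))"

definition resolvent_lap :: "dist2 \<Rightarrow> dist2" where  \<comment> \<open>\<open>(1 - \<Delta>)\<^sup>-\<^sup>1\<close>\<close>
  "resolvent_lap u = (\<lambda>(m1, m2). u (m1, m2) / of_int (1 + m1\<^sup>2 + m2\<^sup>2))"

definition inverse_lap :: "dist2 \<Rightarrow> dist2" where  \<comment> \<open>\<open>\<Delta>\<^sup>-\<^sup>1\<close>, for mean-zero \<open>u\<close>, with mean-zero values\<close>
  "inverse_lap u = (\<lambda>(m1, m2). if m1 = 0 \<and> m2 = 0 then 0 else - u (m1, m2) / of_int (m1\<^sup>2 + m2\<^sup>2))"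

definition A_op :: "int \<Rightarrow> dist2 \<Rightarrow> dist2" where
  "A_op k u = u - of_int (1 + k\<^sup>2) *\<^sub>C resolvent_lap u"

definition B_op :: "int \<Rightarrow> dist2 \<Rightarrow> dist2" where
  "B_op k u = - (of_int (1 + k\<^sup>2) *\<^sub>C inverse_lap u)"

definition L_op :: "int \<Rightarrow> dist2 \<times> dist2 \<Rightarrow> dist2 \<times> dist2" where
  "L_op k = (\<lambda>(\<omega>, F).
     (- of_int k *\<^sub>C mult (tensor (fcos k) (fourier (\<lambda>x. 1))) (dx2 (A_op k F)),
      - of_int k *\<^sub>C mult (tensor (fcos k) (fourier (\<lambda>x. 1))) (dx2 (B_op k \<omega>))))"

definition X_space :: "real \<Rightarrow> (dist2 \<times> dist2) set" where
  "X_space s = {(\<omega>, F). \<omega> \<in> sobolev2 (s - 1) \<and> \<omega> (0, 0) = 0 \<and> F \<in> sobolev2 s}"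

definition translate1 :: "real \<Rightarrow> dist2 \<Rightarrow> dist2" where  \<comment> \<open>\<open>u(x\<^sub>1 + a, x\<^sub>2)\<close>\<close>
  "translate1 a u = (\<lambda>(m1, m2). cis (of_int m1 * a) * u (m1, m2))"

definition reflect1 :: "dist2 \<Rightarrow> dist2" where  \<comment> \<open>\<open>u(-x\<^sub>1, x\<^sub>2)\<close>\<close>
  "reflect1 u = (\<lambda>(m1, m2). u (- m1, m2))"

definition reflect2 :: "dist2 \<Rightarrow> dist2" where  \<comment> \<open>\<open>u(x\<^sub>1, -x\<^sub>2)\<close>\<close>
  "reflect2 u = (\<lambda>(m1, m2). u (m1, - m2))"

text \<open>\<open>reflect1 (translate1 a u)\<close> is \<open>u(a - x\<^sub>1, x\<^sub>2)\<close>.\<close>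

definition X_sym :: "real \<Rightarrow> int \<Rightarrow> (dist2 \<times> dist2) set" where
  "X_sym s k = {(\<omega>, F) \<in> X_space s.
     translate1 (2 * pi / of_int k) \<omega> = \<omega> \<and> translate1 (2 * pi / of_int k) F = F \<and>
     reflect1 (translate1 (pi / of_int k) \<omega>) = - \<omega> \<and>
     reflect1 (translate1 (pi / of_int k) F) = F \<and>
     reflect2 \<omega> = - \<omega> \<and> reflect2 F = F}"

definition transverse_block :: "real \<Rightarrow> int \<Rightarrow> int \<Rightarrow> (dist2 \<times> dist2) set" where
  "transverse_block s k n = {(\<omega>, F) \<in> X_sym s k.
     \<exists>h f. \<omega> = tensor h (fsin n) \<and> F = tensor f (fcos n)}"

definition cosine_chain :: "real \<Rightarrow> int \<Rightarrow> int \<Rightarrow> (dist2 \<times> dist2) set" where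
  "cosine_chain s k n = {(\<omega>, F) \<in> transverse_block s k n.
     \<exists>h f. \<omega> = tensor h (fsin n) \<and> F = tensor f (fcos n) \<and>
       f \<in> closed_span s {fcos (2 * j * k) | j. j \<ge> 0} \<and>
       h \<in> closed_span (s - 1) {fcos ((2 * j + 1) * k) | j. j \<ge> 0}}"

section \<open>The operators on the one-dimensional torus\<close>

definition A1 :: "int \<Rightarrow> int \<Rightarrow> dist1 \<Rightarrow> dist1" where
  "A1 k n u = (\<lambda>m. of_int (m\<^sup>2 + n\<^sup>2 - k\<^sup>2) / of_int (m\<^sup>2 + n\<^sup>2 + 1) * u m)"

definition B1 :: "int \<Rightarrow> int \<Rightarrow> dist1 \<Rightarrow> dist1" where
  "B1 k n u = (\<lambda>m. of_int (1 + k\<^sup>2) / of_int (m\<^sup>2 + n\<^sup>2) * u m)"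

definition C1 :: "int \<Rightarrow> dist1 \<Rightarrow> dist1" where
  "C1 k = mult (fcos k)"

definition D1 :: "int \<Rightarrow> int \<Rightarrow> dist1 \<Rightarrow> dist1" where
  "D1 k n = C1 k \<circ> B1 k n \<circ> C1 k"

abbreviation L2 :: "dist1 set" where
  "L2 \<equiv> sobolev1 0"

text \<open>By Parseval, the \<open>L\<^sup>2\<close> inner product up to a factor \<open>2\<pi>\<close>.\<close>

definition inner_L2 :: "dist1 \<Rightarrow> dist1 \<Rightarrow> complex" where
  "inner_L2 u v = (\<Sum>\<^sub>\<infinity>m. u m * cnj (v m))"

definition bounded_op_L2 :: "(dist1 \<Rightarrow> dist1) \<Rightarrow> bool" where
  "bounded_op_L2 T \<longleftrightarrow>
     (\<forall>u\<in>L2. T u \<in> L2) \<and>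
     (\<forall>u\<in>L2. \<forall>v\<in>L2. \<forall>a b. T (a *\<^sub>C u + b *\<^sub>C v) = a *\<^sub>C T u + b *\<^sub>C T v) \<and>
     (\<exists>c. \<forall>u\<in>L2. sobolev_norm1 0 (T u) \<le> c * sobolev_norm1 0 u)"

definition positive_op_L2 :: "(dist1 \<Rightarrow> dist1) \<Rightarrow> bool" where
  "positive_op_L2 T \<longleftrightarrow> bounded_op_L2 T \<and>
     (\<forall>u\<in>L2. \<forall>v\<in>L2. inner_L2 (T u) v = inner_L2 u (T v)) \<and>
     (\<forall>u\<in>L2. 0 \<le> Re (inner_L2 (T u) u))"

text \<open>
  The positive square root of a positive operator on \<open>L\<^sup>2\<close>. It is unique on \<open>L\<^sup>2\<close>; the value
  0 off \<open>L\<^sup>2\<close> only makes it unique as a total function.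
\<close>

definition sqrt_op_L2 :: "(dist1 \<Rightarrow> dist1) \<Rightarrow> dist1 \<Rightarrow> dist1" where
  "sqrt_op_L2 T = (THE R. positive_op_L2 R \<and> (\<forall>u\<in>L2. R (R u) = T u) \<and> (\<forall>u. u \<notin> L2 \<longrightarrow> R u = 0))"

definition K1 :: "int \<Rightarrow> int \<Rightarrow> dist1 \<Rightarrow> dist1" where
  "K1 k n = sqrt_op_L2 (D1 k n) \<circ> A1 k n \<circ> sqrt_op_L2 (D1 k n)"

definition even_cosines :: "int \<Rightarrow> dist1 set" where
  "even_cosines k = closed_span 0 {fcos (2 * j * k) | j. j \<ge> 0}"

end

theory Submission
  imports Defs
begin

text \<open>
  On the block of frequency \<open>n\<close>, \<open>L (h, f) = nk (C A f, - C B h)\<close>. Eliminating \<open>h\<close> from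
  \<open>L (h, f) = \<lambda> (h, f)\<close> leaves \<open>D A f = - \<nu> f\<close> with \<open>\<lambda> = nk sqrt \<nu>\<close>, and \<open>f = D^(1/2) g\<close> turns this
  into \<open>K g = - \<nu> g\<close>.

  The form \<open>\<langle>A f, f\<rangle>\<close> is negative on every such eigenvector. Among the frequencies divisible by
  \<open>k\<close>, the only one at which \<open>A\<close> can be negative is 0, and it is so exactly for \<open>n < k\<close>. Hence the
  form is nonnegative on the \<open>f\<close> with vanishing mean, and on all \<open>f\<close> if \<open>n \<ge> k\<close>. As eigenvectors for
  different \<open>\<nu>\<close> are orthogonal for the form, this excludes eigenvalues for \<open>n \<ge> k\<close>, and
  second eigenvectors and Jordan chains for \<open>n < k\<close>.

  For existence, \<open>B^(1/2) C A C B^(1/2)\<close> is, on the odd cosines, a positive operator \<open>Q\<close> minus a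
  rank-one operator \<open>v \<otimes> v\<close>, and it takes a negative value because 1 is in the closure of the range of
  \<open>C\<close>. It has the eigenvalue \<open>- \<nu>\<close> once \<open>\<langle>(Q + \<nu>)^(-1) v, v\<rangle> = 1\<close>, which the intermediate value
  theorem provides.
\<close>

section \<open>Positive operators on a real Hilbert space\<close>

text \<open>D^(1/2) is not diagonal in the Fourier basis, whereas B^(1/2) is a multiplier. Existence
  is therefore proved for B^(1/2) C A C B^(1/2), whose eigenvectors C B^(1/2) carries to those of D
  A; only then are they transferred to \<open>K1\<close>. The constant 1 is not C u for a square
  summable u, since 1 / cos (k x_1) is not square integrable; this is why approximate preimages are
  averaged.

  \<open>sqrt_op_L2\<close> is a definite description, so a square root has to be constructed and
  shown unique. It is a series in D and hence commutes with whatever commutes with D; this passes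
  evenness, periodicity and reality through D^(1/2). The Hilbert space theory is over the real
  scalars, for which complex conjugation is a linear operator too.

  Two points concern the scale X^s. Eigenvectors for positive eigenvalues are smooth, as D gains two
  orders, so existence reduces to square summable families. For small s the family h itself need not
  be square summable, but B h is, and the exclusion of Jordan chains is arranged to use only B
  h.\<close>

definition psd_op :: "('a::real_inner \<Rightarrow> 'a) \<Rightarrow> bool" where
  "psd_op T \<longleftrightarrow> bounded_linear T \<and> (\<forall>x y. T x \<bullet> y = x \<bullet> T y) \<and> (\<forall>x. 0 \<le> T x \<bullet> x)"

lemma psd_opD:
  assumes "psd_op T"
  shows "bounded_linear T" "T x \<bullet> y = x \<bullet> T y" "0 \<le> T x \<bullet> x"
  using assms unfolding psd_op_def by blast+

text \<open>Expand \<open>\<langle>T z, z\<rangle> \<ge> 0\<close> at \<open>z = x - T x / c\<close>.\<close>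

lemma psd_op_norm_le:
  assumes T: "psd_op T" and c: "c > 0" "\<And>x. norm (T x) \<le> c * norm x"
  shows "(norm (T x))\<^sup>2 \<le> c * (T x \<bullet> x)"
proof -
  interpret bounded_linear T using psd_opD(1)[OF T] .
  have "0 \<le> T (x - (1 / c) *\<^sub>R T x) \<bullet> (x - (1 / c) *\<^sub>R T x)"
    using psd_opD(3)[OF T] by blast
  also have "\<dots> = T x \<bullet> x - 2 / c * (norm (T x))\<^sup>2 + (1 / c)\<^sup>2 * (T (T x) \<bullet> T x)"
    using psd_opD(2)[OF T, of "T x" x]
    by (simp add: diff scaleR inner_diff_left inner_diff_right dot_square_norm power2_eq_square
        inner_commute algebra_simps)
  also have "T (T x) \<bullet> T x \<le> c * (norm (T x))\<^sup>2"
  proof -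
    have "T (T x) \<bullet> T x \<le> norm (T (T x)) * norm (T x)" by (rule norm_cauchy_schwarz)
    also have "\<dots> \<le> c * norm (T x) * norm (T x)" by (intro mult_right_mono c) auto
    finally show ?thesis by (simp add: power2_eq_square mult.assoc)
  qed
  finally have "0 \<le> T x \<bullet> x - 2 / c * (norm (T x))\<^sup>2 + (1 / c)\<^sup>2 * (c * (norm (T x))\<^sup>2)"
    using c by (simp add: mult_left_mono)
  also have "\<dots> = T x \<bullet> x - (norm (T x))\<^sup>2 / c"
    using c by (simp add: power2_eq_square field_simps)
  finally show ?thesis using c by (simp add: field_simps)
qed

lemma psd_op_bound:
  assumes "psd_op T"
  obtains c where "c > 0" "\<And>x. norm (T x) \<le> c * norm x"
  using bounded_linear.pos_bounded[OF psd_opD(1)[OF assms]] by (metis mult.commute)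

lemma psd_op_eq_zero:
  assumes T: "psd_op T" and "T x \<bullet> x = 0"
  shows "T x = 0"
proof -
  obtain c where "c > 0" "\<And>x. norm (T x) \<le> c * norm x" using psd_op_bound[OF T] by blast
  from psd_op_norm_le[OF T this, of x] show ?thesis using assms(2) by simp
qed

text \<open>For \<open>y = R x - S x\<close>, commutation gives R y + S y = R (R x) - S (S x) = 0,
  so both nonnegative forms vanish at \<open>y\<close> and \<open>R y = S y = 0\<close>. By symmetry
  |y|^2 is the inner product of \<open>x\<close> with R y - S y, hence 0.\<close>

lemma psd_op_sqrt_unique:
  fixes R S T :: "'a::real_inner \<Rightarrow> 'a"
  assumes R: "psd_op R" and S: "psd_op S" and sq: "\<And>x. S (S x) = R (R x)"
    and comm: "\<And>x. S (R x) = R (S x)"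
  shows "S = R"
proof
  fix x
  interpret R: bounded_linear R using psd_opD(1)[OF R] .
  interpret S: bounded_linear S using psd_opD(1)[OF S] .
  define y where "y = R x - S x"
  have "R y + S y = 0" unfolding y_def by (simp add: R.diff S.diff comm sq)
  then have "R y \<bullet> y + S y \<bullet> y = 0"
    by (metis inner_add_left inner_zero_left)
  with psd_opD(3)[OF R, of y] psd_opD(3)[OF S, of y] have "R y \<bullet> y = 0" "S y \<bullet> y = 0" by auto
  then have "R y = 0" "S y = 0" using psd_op_eq_zero R S by blast+
  then have "(R y - S y) \<bullet> x = 0" by simp
  then have "y \<bullet> y = 0"
    using psd_opD(2)[OF R, of y x] psd_opD(2)[OF S, of y x]
    by (simp add: inner_diff_left inner_diff_right y_def[symmetric])
       (metis inner_diff_right y_def diff_self inner_eq_zero_iff)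
  then show "S x = R x" by (simp add: y_def)
qed

section \<open>Coefficients of the binomial series of (1 - X)^(1/2)\<close>

definition sqrt_coeff :: "nat \<Rightarrow> real" where
  "sqrt_coeff i = ((1/2) gchoose i) * (- 1) ^ i"

lemma sqrt_coeff_0 [simp]: "sqrt_coeff 0 = 1"
  by (simp add: sqrt_coeff_def)

text \<open>The partial sums are the coefficients of (1 - X)^(1/2) / (1 - X) = (1 - X)^(-1/2), which
  are positive.\<close>

lemma sum_sqrt_coeff: "0 \<le> (\<Sum>i\<le>m. sqrt_coeff i)"
proof -
  have "(\<Sum>i\<le>m. sqrt_coeff i) = (- 1) ^ m * ((1/2 - 1) gchoose m)"
    unfolding sqrt_coeff_def by (rule gbinomial_sum_lower_neg)
  also have "\<dots> = pochhammer (1/2) m / fact m"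
    by (simp add: gbinomial_pochhammer flip: mult.assoc power_mult_distrib)
  also have "\<dots> \<ge> 0" by (simp add: pochhammer_nonneg)
  finally show ?thesis .
qed

text \<open>The product (-1/2) (1/2) (3/2) ... has exactly one negative factor, its first.\<close>

lemma sqrt_coeff_Suc_nonpos: "sqrt_coeff (Suc i) \<le> 0"
proof -
  have "((1/2::real) gchoose Suc i) * (-1) ^ Suc i = pochhammer (-(1/2)) (Suc i) / fact (Suc i)"
    by (simp add: gbinomial_pochhammer flip: mult.assoc power_mult_distrib)
  also have "\<dots> \<le> 0"
    by (simp add: pochhammer_rec field_simps pochhammer_nonneg)
  finally show ?thesis by (simp add: sqrt_coeff_def)
qed

text \<open>The coefficient at 0 is 1 and the later ones are nonpositive, so the sum is 1 minus a
  partial sum. The exact bound 1 makes the operator root positive: the later terms cannot outweigh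
  the identity.\<close>

lemma sum_abs_sqrt_coeff_le: "(\<Sum>i<m. \<bar>sqrt_coeff (Suc i)\<bar>) \<le> 1"
proof -
  have "(\<Sum>i<m. \<bar>sqrt_coeff (Suc i)\<bar>) = - (\<Sum>i<m. sqrt_coeff (Suc i))"
    using sqrt_coeff_Suc_nonpos by (simp add: sum_negf[symmetric])
  also have "\<dots> = 1 - (\<Sum>i<Suc m. sqrt_coeff i)"
    by (simp only: sum.lessThan_Suc_shift) simp
  also have "\<dots> \<le> 1" using sum_sqrt_coeff[of m] by (simp add: lessThan_Suc_atMost)
  finally show ?thesis .
qed

lemma summable_sqrt_coeff_Suc: "summable (\<lambda>i. \<bar>sqrt_coeff (Suc i)\<bar>)"
  using sum_abs_sqrt_coeff_le by (intro summableI_nonneg_bounded) auto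

lemma summable_sqrt_coeff: "summable (\<lambda>i. \<bar>sqrt_coeff i\<bar>)"
  using summable_sqrt_coeff_Suc by (subst (asm) summable_Suc_iff)

lemma suminf_abs_sqrt_coeff_Suc: "(\<Sum>i. \<bar>sqrt_coeff (Suc i)\<bar>) \<le> 1"
  using summable_sqrt_coeff_Suc sum_abs_sqrt_coeff_le by (intro suminf_le_const) auto

text \<open>These are the coefficients of the square of the series, that is of 1 - X; the
  Vandermonde identity for 1/2 + 1/2 = 1 evaluates them.\<close>

lemma sqrt_coeff_convolution:
  "(\<Sum>i\<le>m. sqrt_coeff i * sqrt_coeff (m - i)) = (if m = 0 then 1 else if m = 1 then -1 else 0)"
proof -
  have "(\<Sum>i\<le>m. sqrt_coeff i * sqrt_coeff (m - i)) =
      (-1) ^ m * (\<Sum>i\<le>m. ((1/2) gchoose i) * ((1/2::real) gchoose (m - i)))"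
    unfolding sqrt_coeff_def sum_distrib_left
    by (intro sum.cong) (auto simp: power_add[symmetric] mult_ac)
  also have "\<dots> = (-1) ^ m * (1 gchoose m)"
    using gbinomial_Vandermonde[of "1/2::real" "1/2" m] by (simp add: atLeast0AtMost)
  also have "\<dots> = (if m = 0 then 1 else if m = 1 then -1 else 0)"
  proof -
    have "(1::real) gchoose m = of_nat (1 choose m)" by (simp add: binomial_gbinomial)
    then show ?thesis by (cases m) (auto simp: binomial_eq_0)
  qed
  finally show ?thesis .
qed

lemma contraction_power:
  fixes X :: "'a::real_normed_vector \<Rightarrow> 'a"
  assumes "\<And>x. norm (X x) \<le> norm x"
  shows "norm ((X ^^ i) x) \<le> norm x"
  by (induction i) (auto intro: order_trans[OF assms])

lemma bounded_linear_funpow: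
  fixes X :: "'a::real_normed_vector \<Rightarrow> 'a"
  assumes "bounded_linear X"
  shows "bounded_linear (X ^^ i)"
proof (induction i)
  case 0
  have "X ^^ 0 = (\<lambda>x. x)" by (simp add: fun_eq_iff)
  then show ?case by (simp only: bounded_linear_ident)
next
  case (Suc i)
  have "X ^^ Suc i = (\<lambda>x. X ((X ^^ i) x))" by (simp add: fun_eq_iff)
  then show ?case by (simp only: bounded_linear_compose[OF assms Suc])
qed

text \<open>The binomial series of \<open>sqrt (1 - X)\<close> converges absolutely for \<open>\<parallel>X\<parallel> \<le> 1\<close>; it is a
  positive operator since all its coefficients but the first are nonpositive and their sum
  is nonnegative.\<close>

lemma psd_op_sqrt_contraction:
  fixes X :: "'a::{real_inner,banach} \<Rightarrow> 'a"
  assumes X: "bounded_linear X" and sym: "\<And>x y. X x \<bullet> y = x \<bullet> X y"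
    and contr: "\<And>x. norm (X x) \<le> norm x"
  obtains R where "psd_op R" "\<And>x. R (R x) = x - X x"
    "\<And>S x. bounded_linear S \<Longrightarrow> (\<And>y. S (X y) = X (S y)) \<Longrightarrow> S (R x) = R (S x)"
proof
  define R where "R x = (\<Sum>i. sqrt_coeff i *\<^sub>R (X ^^ i) x)" for x
  note pow = bounded_linear_funpow[OF X]
  have abs: "summable (\<lambda>i. norm (sqrt_coeff i *\<^sub>R (X ^^ i) x))" for x
    by (rule summable_comparison_test_ev[OF _ summable_mult2[OF summable_sqrt_coeff, of "norm x"]])
      (auto intro!: always_eventually mult_left_mono contraction_power contr)
  have sm: "summable (\<lambda>i. sqrt_coeff i *\<^sub>R (X ^^ i) x)" for x
    using summable_norm_cancel[OF abs] .
  have Rle: "norm (R x) \<le> norm x * (\<Sum>i. \<bar>sqrt_coeff i\<bar>)" for x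
  proof -
    have "norm (R x) \<le> (\<Sum>i. norm (sqrt_coeff i *\<^sub>R (X ^^ i) x))"
      unfolding R_def by (rule summable_norm[OF abs])
    also have "\<dots> \<le> (\<Sum>i. \<bar>sqrt_coeff i\<bar> * norm x)"
      by (intro suminf_le abs summable_mult2 summable_sqrt_coeff)
        (auto intro!: mult_left_mono contraction_power contr)
    also have "\<dots> = norm x * (\<Sum>i. \<bar>sqrt_coeff i\<bar>)"
      using suminf_mult[OF summable_sqrt_coeff, of "norm x"] by (simp add: mult.commute)
    finally show ?thesis .
  qed
  have blR: "bounded_linear R"
  proof (rule bounded_linear_intro)
    fix x y :: 'a and r :: real
    show "R (x + y) = R x + R y"
      unfolding R_def
      by (simp add: suminf_add[OF sm sm] linear_add[OF bounded_linear.linear[OF pow]]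
          scaleR_add_right)
    show "R (r *\<^sub>R x) = r *\<^sub>R R x"
      unfolding R_def
      by (simp add: suminf_scaleR_right[OF sm] linear_scale[OF bounded_linear.linear[OF pow]]
          mult.commute)
    show "norm (R x) \<le> norm x * (\<Sum>i. \<bar>sqrt_coeff i\<bar>)" by (rule Rle)
  qed
  have sympow: "(X ^^ i) x \<bullet> y = x \<bullet> (X ^^ i) y" for i x y
    by (induction i arbitrary: x y) (simp_all add: sym funpow_swap1)
  have symR: "R x \<bullet> y = x \<bullet> R y" for x y
  proof -
    have "R x \<bullet> y = (\<Sum>i. (sqrt_coeff i *\<^sub>R (X ^^ i) x) \<bullet> y)"
      unfolding R_def by (rule bounded_linear.suminf[OF bounded_linear_inner_left sm])
    also have "\<dots> = (\<Sum>i. x \<bullet> (sqrt_coeff i *\<^sub>R (X ^^ i) y))"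
      by (simp add: sympow)
    also have "\<dots> = x \<bullet> R y"
      unfolding R_def by (rule bounded_linear.suminf[OF bounded_linear_inner_right sm, symmetric])
    finally show ?thesis .
  qed
  have posR: "0 \<le> R x \<bullet> x" for x
  proof -
    let ?d = "\<lambda>i. (sqrt_coeff i *\<^sub>R (X ^^ i) x) \<bullet> x"
    have sd: "summable ?d" by (rule bounded_linear.summable[OF bounded_linear_inner_left sm])
    have "R x \<bullet> x = (\<Sum>i. ?d i)"
      unfolding R_def by (rule bounded_linear.suminf[OF bounded_linear_inner_left sm])
    also have "\<dots> = (norm x)\<^sup>2 + (\<Sum>i. ?d (Suc i))"
      using suminf_split_head[OF sd] by (simp add: dot_square_norm)
    finally have "R x \<bullet> x = (norm x)\<^sup>2 + (\<Sum>i. ?d (Suc i))" .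
    moreover have "(\<Sum>i. - (\<bar>sqrt_coeff (Suc i)\<bar> * (norm x)\<^sup>2)) \<le> (\<Sum>i. ?d (Suc i))"
    proof (rule suminf_le)
      fix i
      have "\<bar>(X ^^ Suc i) x \<bullet> x\<bar> \<le> norm ((X ^^ Suc i) x) * norm x" by (rule Cauchy_Schwarz_ineq2)
      also have "\<dots> \<le> (norm x)\<^sup>2"
        using contraction_power[OF contr, of "Suc i" x]
        by (simp add: power2_eq_square mult_right_mono del: funpow.simps)
      finally have "\<bar>?d (Suc i)\<bar> \<le> \<bar>sqrt_coeff (Suc i)\<bar> * (norm x)\<^sup>2"
        by (simp add: abs_mult mult_left_mono del: funpow.simps)
      then show "- (\<bar>sqrt_coeff (Suc i)\<bar> * (norm x)\<^sup>2) \<le> ?d (Suc i)" by linarith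
    next
      show "summable (\<lambda>i. - (\<bar>sqrt_coeff (Suc i)\<bar> * (norm x)\<^sup>2))"
        by (intro summable_minus summable_mult2 summable_sqrt_coeff_Suc)
      show "summable (\<lambda>i. ?d (Suc i))" using sd by (subst summable_Suc_iff)
    qed
    moreover have "(\<Sum>i. - (\<bar>sqrt_coeff (Suc i)\<bar> * (norm x)\<^sup>2)) =
        - ((\<Sum>i. \<bar>sqrt_coeff (Suc i)\<bar>) * (norm x)\<^sup>2)"
      by (simp add: suminf_minus summable_mult2 summable_sqrt_coeff_Suc
          suminf_mult2[OF summable_sqrt_coeff_Suc, symmetric])
    moreover have "(\<Sum>i. \<bar>sqrt_coeff (Suc i)\<bar>) * (norm x)\<^sup>2 \<le> (norm x)\<^sup>2"
      using mult_right_mono[OF suminf_abs_sqrt_coeff_Suc, of "(norm x)\<^sup>2"] by simp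
    ultimately show ?thesis by linarith
  qed
  show "psd_op R" unfolding psd_op_def using blR symR posR by blast
  show "S (R x) = R (S x)" if S: "bounded_linear S" and c: "\<And>y. S (X y) = X (S y)" for S x
  proof -
    have cp: "S ((X ^^ i) y) = (X ^^ i) (S y)" for i y
      by (induction i) (simp_all add: c)
    have "S (R x) = (\<Sum>i. S (sqrt_coeff i *\<^sub>R (X ^^ i) x))"
      unfolding R_def by (rule bounded_linear.suminf[OF S sm])
    then show ?thesis unfolding R_def by (simp add: linear_scale[OF bounded_linear.linear[OF S]] cp)
  qed
  show "R (R x) = x - X x" for x
  proof -
    define g where "g = (\<lambda>(i, j). (sqrt_coeff i * sqrt_coeff j) *\<^sub>R (X ^^ (i + j)) x)"
    have hs: "((\<lambda>i. sqrt_coeff i *\<^sub>R (X ^^ i) y) has_sum R y) UNIV" for y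
      unfolding R_def by (rule norm_summable_imp_has_sum[OF abs summable_sums[OF sm]])
    have coeff: "(\<lambda>i. norm (sqrt_coeff i)) summable_on UNIV"
      using summable_sqrt_coeff by (intro norm_summable_imp_summable_on) auto
    \<comment> \<open>Absolute summability over pairs allows the double series to be regrouped along
      the diagonals \<open>i + j = m\<close>, where \<open>sqrt_coeff_convolution\<close> leaves
      only \<open>m = 0\<close> and \<open>m = 1\<close>.\<close>
    have absg: "(\<lambda>p. norm (g p)) summable_on UNIV \<times> UNIV"
    proof (rule Infinite_Sum.abs_summable_on_comparison_test')
      have "(\<lambda>p. norm ((\<lambda>(i, j). sqrt_coeff i * sqrt_coeff j) p)) summable_on UNIV \<times> UNIV"
        using coeff by (subst Infinite_Sum.abs_summable_on_Sigma_iff)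
          (auto simp: abs_mult infsum_cmult_right' intro: summable_on_cmult_right summable_on_cmult_left)
      then show "(\<lambda>p. \<bar>sqrt_coeff (fst p) * sqrt_coeff (snd p)\<bar> * norm x) summable_on UNIV \<times> UNIV"
        by (intro summable_on_cmult_left) (simp add: case_prod_beta)
    next
      fix p :: "nat \<times> nat"
      show "norm (g p) \<le> \<bar>sqrt_coeff (fst p) * sqrt_coeff (snd p)\<bar> * norm x"
        by (auto simp: g_def case_prod_beta intro!: mult_left_mono contraction_power contr)
    qed
    then have sg: "g summable_on UNIV \<times> UNIV" by (rule abs_summable_summable)
    have "R (R x) = (\<Sum>\<^sub>\<infinity>i. sqrt_coeff i *\<^sub>R (X ^^ i) (R x))"
      using hs[of "R x"] by (simp add: infsumI)
    also have "\<dots> = (\<Sum>\<^sub>\<infinity>i. \<Sum>\<^sub>\<infinity>j. g (i, j))"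
    proof (rule infsum_cong)
      fix i :: nat
      have "((\<lambda>j. (sqrt_coeff i *\<^sub>R (X ^^ i) (sqrt_coeff j *\<^sub>R (X ^^ j) x))) has_sum
          (sqrt_coeff i *\<^sub>R (X ^^ i) (R x))) UNIV"
        using has_sum_bounded_linear[OF bounded_linear_compose[OF bounded_linear_scaleR_right pow] hs]
        by (simp add: o_def)
      then have "((\<lambda>j. g (i, j)) has_sum (sqrt_coeff i *\<^sub>R (X ^^ i) (R x))) UNIV"
        by (simp add: g_def linear_scale[OF bounded_linear.linear[OF pow]] funpow_add)
      then show "sqrt_coeff i *\<^sub>R (X ^^ i) (R x) = (\<Sum>\<^sub>\<infinity>j. g (i, j))" by (simp add: infsumI)
    qed
    also have "\<dots> = infsum g (UNIV \<times> UNIV)" by (rule infsum_Sigma_banach[OF sg])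
    also have "\<dots> = infsum (\<lambda>(m, i). g (i, m - i)) (SIGMA m:UNIV. {..m})"
      by (rule infsum_reindex_bij_witness[of _ "\<lambda>(m, i). (i, m - i)" "\<lambda>(i, j). (i + j, i)"]) auto
    also have "\<dots> = (\<Sum>\<^sub>\<infinity>m. \<Sum>\<^sub>\<infinity>i\<in>{..m}. g (i, m - i))"
    proof (subst infsum_Sigma_banach[symmetric])
      show "(\<lambda>(m, i). g (i, m - i)) summable_on (SIGMA m:UNIV. {..m})"
        using sg by (subst summable_on_reindex_bij_witness
            [of _ "\<lambda>(i, j). (i + j, i)" "\<lambda>(m, i). (i, m - i)" "UNIV \<times> UNIV" g]) auto
    qed simp
    also have "\<dots> = (\<Sum>\<^sub>\<infinity>m. (\<Sum>i\<le>m. sqrt_coeff i * sqrt_coeff (m - i)) *\<^sub>R (X ^^ m) x)"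
      by (simp add: g_def scaleR_sum_left)
    also have "\<dots> = (\<Sum>\<^sub>\<infinity>m\<in>{0, 1::nat}. (if m = 0 then x else - X x))"
      unfolding sqrt_coeff_convolution by (rule infsum_cong_neutral) auto
    also have "\<dots> = x - X x" by simp
    finally show ?thesis .
  qed
qed

text \<open>Write T = c (1 - X). By \<open>psd_op_norm_le\<close>, |X x|^2 is at most |x|^2 - <T x,
  x> / c, so X is a contraction and the binomial series applies. The commutation clause holds
  because the root is a series in T; uniqueness of the root and its symmetries are derived from
  it.\<close>

theorem psd_op_sqrt:
  fixes T :: "'a::{real_inner,banach} \<Rightarrow> 'a"
  assumes T: "psd_op T"
  obtains R where "psd_op R" "\<And>x. R (R x) = T x"
    "\<And>S x. bounded_linear S \<Longrightarrow> (\<And>y. S (T y) = T (S y)) \<Longrightarrow> S (R x) = R (S x)"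
proof -
  obtain c where c: "c > 0" "\<And>x. norm (T x) \<le> c * norm x" using psd_op_bound[OF T] by blast
  interpret T: bounded_linear T using psd_opD(1)[OF T] .
  define X where "X x = x - (1 / c) *\<^sub>R T x" for x
  have X: "bounded_linear X"
    unfolding X_def
    by (intro bounded_linear_sub bounded_linear_ident bounded_linear_const_scaleR T.bounded_linear)
  have sym: "X x \<bullet> y = x \<bullet> X y" for x y
    by (simp add: X_def inner_diff_left inner_diff_right psd_opD(2)[OF T])
  have contr: "norm (X x) \<le> norm x" for x
  proof (rule power2_le_imp_le)
    have "(norm (X x))\<^sup>2 = (norm x)\<^sup>2 - 2 / c * (T x \<bullet> x) + (1 / c)\<^sup>2 * (norm (T x))\<^sup>2"
      unfolding X_def dot_square_norm[symmetric]
      by (simp add: inner_diff_left inner_diff_right inner_commute algebra_simps power2_eq_square)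
    also have "\<dots> \<le> (norm x)\<^sup>2 - 2 / c * (T x \<bullet> x) + (1 / c)\<^sup>2 * (c * (T x \<bullet> x))"
      using psd_op_norm_le[OF T c] by (intro add_left_mono mult_left_mono) auto
    also have "\<dots> = (norm x)\<^sup>2 - (T x \<bullet> x) / c"
      using c(1) by (simp add: power2_eq_square field_simps)
    also have "\<dots> \<le> (norm x)\<^sup>2" using psd_opD(3)[OF T] c(1) by simp
    finally show "(norm (X x))\<^sup>2 \<le> (norm x)\<^sup>2" .
  qed simp
  obtain Q where Q: "psd_op Q" "\<And>x. Q (Q x) = x - X x"
    and comm: "\<And>S x. bounded_linear S \<Longrightarrow> (\<And>y. S (X y) = X (S y)) \<Longrightarrow> S (Q x) = Q (S x)"
    using psd_op_sqrt_contraction[OF X sym contr] by metis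
  interpret Q: bounded_linear Q using psd_opD(1)[OF Q(1)] .
  show thesis
  proof (rule that[of "\<lambda>x. sqrt c *\<^sub>R Q x"])
    show "psd_op (\<lambda>x. sqrt c *\<^sub>R Q x)"
      using Q(1) c(1) by (auto simp: psd_op_def intro!: bounded_linear_const_scaleR)
    show "sqrt c *\<^sub>R Q (sqrt c *\<^sub>R Q x) = T x" for x
      using c(1) by (simp add: Q.scaleR Q(2) X_def)
    fix S :: "'a \<Rightarrow> 'a" and x
    assume S: "bounded_linear S" and ST: "\<And>y. S (T y) = T (S y)"
    interpret S: bounded_linear S by fact
    have "S (Q x) = Q (S x)"
      by (rule comm[OF S]) (simp add: X_def S.diff S.scaleR ST)
    then show "S (sqrt c *\<^sub>R Q x) = sqrt c *\<^sub>R Q (S x)" by (simp add: S.scaleR)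
  qed
qed

section \<open>Rank-one perturbations\<close>

text \<open>The equation \<open>Q w + \<nu> w = v\<close> is a fixed-point equation for the map
  \<open>w \<mapsto> w - t (Q w + \<nu> w - v)\<close>, which contracts for small \<open>t > 0\<close>.\<close>

lemma positive_resolvent_exists:
  fixes Q :: "'a::{real_inner,banach} \<Rightarrow> 'a"
  assumes Q: "bounded_linear Q" and V: "subspace V" "closed V"
    and QV: "\<And>x. x \<in> V \<Longrightarrow> Q x \<in> V" and pos: "\<And>x. x \<in> V \<Longrightarrow> 0 \<le> Q x \<bullet> x"
    and \<nu>: "\<nu> > 0" and v: "v \<in> V"
  obtains w where "w \<in> V" "Q w + \<nu> *\<^sub>R w = v"
proof -
  define P where "P x = Q x + \<nu> *\<^sub>R x" for x
  have P: "bounded_linear P"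
    unfolding P_def by (intro bounded_linear_add Q bounded_linear_scaleR_right)
  interpret P: bounded_linear P by fact
  obtain M0 where M0: "\<And>x. norm (P x) \<le> norm x * M0" using P.bounded by blast
  define M where "M = max (max M0 \<nu>) 1"
  have M: "norm (P x) \<le> M * norm x" for x
    using order_trans[OF M0 mult_left_mono[of M0 M "norm x"]] by (simp add: M_def mult.commute)
  have M1: "M \<ge> 1" "M \<ge> \<nu>" unfolding M_def by auto
  \<comment> \<open>This \<open>t\<close> minimises
    \<open>1 - 2 * t * \<nu> + t\<^sup>2 * M\<^sup>2\<close>. The minimum
    \<open>1 - (\<nu> / M)\<^sup>2\<close> is below 1, and it is nonnegative by
    \<open>M \<ge> \<nu>\<close>; its square root is the contraction constant
    \<open>c\<close>.\<close>
  define t where "t = \<nu> / M\<^sup>2"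
  have t: "t > 0" using \<nu> M1 by (simp add: t_def)
  have rle: "(\<nu> / M)\<^sup>2 \<le> 1" using M1 \<nu> by (simp add: power_le_one)
  have rpos: "(\<nu> / M)\<^sup>2 > 0" using M1 \<nu> by simp
  define c where "c = sqrt (1 - (\<nu> / M)\<^sup>2)"
  have c: "0 \<le> c" "c < 1" using rle rpos by (simp_all add: c_def)
  have PV: "P x \<in> V" if "x \<in> V" for x
    unfolding P_def using that QV V(1) by (simp add: subspace_add subspace_scale)
  have key: "norm (z - t *\<^sub>R P z) \<le> c * norm z" if "z \<in> V" for z
  proof (rule power2_le_imp_le)
    have "(norm (z - t *\<^sub>R P z))\<^sup>2 = (norm z)\<^sup>2 - 2 * t * (P z \<bullet> z) + t\<^sup>2 * (norm (P z))\<^sup>2"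
      unfolding dot_square_norm[symmetric]
      by (simp add: inner_diff_left inner_diff_right inner_commute algebra_simps power2_eq_square)
    also have "\<dots> \<le> (norm z)\<^sup>2 - 2 * t * (\<nu> * (norm z)\<^sup>2) + t\<^sup>2 * (M * norm z)\<^sup>2"
    proof (intro add_mono diff_mono mult_left_mono power_mono M)
      show "\<nu> * (norm z)\<^sup>2 \<le> P z \<bullet> z"
        using pos[OF that] by (simp add: P_def inner_add_left dot_square_norm)
    qed (use t in auto)
    also have "\<dots> = (c * norm z)\<^sup>2"
    proof -
      have c2: "c\<^sup>2 = 1 - (\<nu> / M)\<^sup>2" using rle by (simp add: c_def)
      have t1: "t * \<nu> = (\<nu> / M)\<^sup>2" by (simp add: t_def power2_eq_square)
      have t2: "t\<^sup>2 * M\<^sup>2 = (\<nu> / M)\<^sup>2" using M1 by (simp add: t_def power2_eq_square)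
      have "(norm z)\<^sup>2 - 2 * t * (\<nu> * (norm z)\<^sup>2) + t\<^sup>2 * (M * norm z)\<^sup>2 =
          (1 - 2 * (t * \<nu>) + t\<^sup>2 * M\<^sup>2) * (norm z)\<^sup>2"
        by (simp only: power_mult_distrib) algebra
      also have "\<dots> = (1 - (\<nu> / M)\<^sup>2) * (norm z)\<^sup>2" unfolding t1 t2 by simp
      also have "\<dots> = (c * norm z)\<^sup>2" by (simp add: c2 power_mult_distrib)
      finally show ?thesis .
    qed
    finally show "(norm (z - t *\<^sub>R P z))\<^sup>2 \<le> (c * norm z)\<^sup>2" .
  qed (use c in simp)
  have "\<exists>!x\<in>V. x - t *\<^sub>R (P x - v) = x"
  proof (rule Banach_fix)
    show "complete V" using V(2) by (simp add: complete_eq_closed)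
    show "V \<noteq> {}" using v by blast
    show "(\<lambda>x. x - t *\<^sub>R (P x - v)) ` V \<subseteq> V"
      using PV v V(1) by (auto intro!: subspace_diff subspace_scale)
    fix x y assume xy: "x \<in> V" "y \<in> V"
    have eq: "x - t *\<^sub>R (P x - v) - (y - t *\<^sub>R (P y - v)) = (x - y) - t *\<^sub>R P (x - y)"
      by (simp add: P.diff algebra_simps)
    show "dist (x - t *\<^sub>R (P x - v)) (y - t *\<^sub>R (P y - v)) \<le> c * dist x y"
      unfolding dist_norm eq using key[of "x - y"] xy V(1) by (simp add: subspace_diff)
  qed (use c in auto)
  then obtain w where "w \<in> V" "w - t *\<^sub>R (P w - v) = w" by blast
  then show thesis using t that[of w] by (simp add: P_def)
qed

text \<open>With \<open>w \<nu> = (Q + \<nu>)\<inverse> v\<close>, the number \<open>-\<nu>\<close> is an eigenvalue as soon as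
  \<open>\<langle>v, w \<nu>\<rangle> = 1\<close>; this scalar equation is solved by the intermediate value theorem.\<close>

theorem rank_one_negative_eigenvector:
  fixes Q :: "'a::{real_inner,banach} \<Rightarrow> 'a"
  assumes Q: "bounded_linear Q" and V: "subspace V" "closed V"
    and QV: "\<And>x. x \<in> V \<Longrightarrow> Q x \<in> V" and pos: "\<And>x. x \<in> V \<Longrightarrow> 0 \<le> Q x \<bullet> x"
    and sym: "\<And>x y. x \<in> V \<Longrightarrow> y \<in> V \<Longrightarrow> Q x \<bullet> y = x \<bullet> Q y"
    and v: "v \<in> V" and u: "u \<in> V" and neg: "Q u \<bullet> u < (v \<bullet> u)\<^sup>2"
  obtains \<nu> w where "\<nu> > 0" "w \<in> V" "w \<noteq> 0" "Q w - (v \<bullet> w) *\<^sub>R v = - (\<nu> *\<^sub>R w)"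
proof -
  interpret Q: bounded_linear Q by fact
  have "\<forall>\<nu>. \<exists>w. \<nu> > 0 \<longrightarrow> w \<in> V \<and> Q w + \<nu> *\<^sub>R w = v"
    using positive_resolvent_exists[OF Q V QV pos _ v] by metis
  then obtain w where w: "\<And>\<nu>. \<nu> > 0 \<Longrightarrow> w \<nu> \<in> V" "\<And>\<nu>. \<nu> > 0 \<Longrightarrow> Q (w \<nu>) + \<nu> *\<^sub>R w \<nu> = v"
    by metis
  have bound: "\<nu> * norm x \<le> norm (Q x + \<nu> *\<^sub>R x)" if "x \<in> V" for \<nu> x
  proof (cases "x = 0")
    case False
    have "\<nu> * norm x * norm x \<le> (Q x + \<nu> *\<^sub>R x) \<bullet> x"
      using pos[OF that] by (simp add: inner_add_left dot_square_norm power2_eq_square)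
    also have "\<dots> \<le> norm (Q x + \<nu> *\<^sub>R x) * norm x" by (rule norm_cauchy_schwarz)
    finally show ?thesis using False by simp
  qed (simp add: Q.zero)
  have wle: "norm (w \<nu>) \<le> norm v / \<nu>" if "\<nu> > 0" for \<nu>
    using bound[OF w(1)[OF that], of \<nu>] w(2)[OF that] that by (simp add: field_simps)
  \<comment> \<open>Resolvent identity: (Q + x) (w x - w y) = (y - x) w y, where inverting Q + x and
    Q + y on V costs at most a factor 1 / a each.\<close>
  have lip: "norm (w x - w y) \<le> norm v / a\<^sup>2 * \<bar>x - y\<bar>" if a: "a > 0" "x \<ge> a" "y \<ge> a" for a x y
  proof -
    have "Q (w x - w y) + x *\<^sub>R (w x - w y) = (y - x) *\<^sub>R w y"
      using w(2)[of x] w(2)[of y] a by (simp add: Q.diff algebra_simps)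
    then have "x * norm (w x - w y) \<le> \<bar>x - y\<bar> * norm (w y)"
      using bound[of "w x - w y" x] w(1)[of x] w(1)[of y] V(1) a
      by (simp add: subspace_diff abs_minus_commute)
    also have "norm (w y) \<le> norm v / a"
      using wle[of y] a by (meson divide_left_mono norm_ge_zero order.trans less_le_trans mult_pos_pos)
    finally have "x * norm (w x - w y) \<le> \<bar>x - y\<bar> * (norm v / a)" by (simp add: mult_left_mono)
    moreover have "a * norm (w x - w y) \<le> x * norm (w x - w y)"
      using a by (intro mult_right_mono) auto
    ultimately have "a * norm (w x - w y) \<le> \<bar>x - y\<bar> * (norm v / a)" by linarith
    then show ?thesis using a by (simp add: field_simps power2_eq_square)
  qed
  have vu: "v \<bullet> u \<noteq> 0"
    using neg pos[OF u] by auto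
  \<comment> \<open>The strict inequality \<open>neg\<close> survives a small shift of Q by
    \<open>a\<close>. The slack is divided by |u|^2 + 1 instead of |u|^2 so that the result is still
    strict.\<close>
  obtain a where a: "a > 0" "Q u \<bullet> u + a * (norm u)\<^sup>2 < (v \<bullet> u)\<^sup>2"
  proof
    define d where "d = (v \<bullet> u)\<^sup>2 - Q u \<bullet> u"
    have d: "d > 0" using neg by (simp add: d_def)
    have n: "(norm u)\<^sup>2 + 1 > 0" by (simp add: add_nonneg_pos)
    show "d / ((norm u)\<^sup>2 + 1) > 0" using d n by simp
    have "d / ((norm u)\<^sup>2 + 1) * (norm u)\<^sup>2 < d / ((norm u)\<^sup>2 + 1) * ((norm u)\<^sup>2 + 1)"
      using d n by (intro mult_strict_left_mono) auto
    also have "\<dots> = d" using n by simp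
    finally show "Q u \<bullet> u + d / ((norm u)\<^sup>2 + 1) * (norm u)\<^sup>2 < (v \<bullet> u)\<^sup>2"
      by (simp add: d_def)
  qed
  define b where "b = max a ((norm v)\<^sup>2)"
  \<comment> \<open>Cauchy-Schwarz for the form of Q + a, with v = (Q + a) (w a): (v . u)^2 is at
    most (v . w a) <(Q + a) u, u>, and the second factor is below (v . u)^2. It is carried out by
    expanding the form at w a - u / (v . u).\<close>
  have low: "1 \<le> v \<bullet> w a"
  proof -
    define r where "r = 1 / (v \<bullet> u)"
    let ?z = "w a - r *\<^sub>R u"
    have zV: "?z \<in> V" using w(1)[OF a(1)] u V(1) by (simp add: subspace_diff subspace_scale)
    have "0 \<le> (Q ?z + a *\<^sub>R ?z) \<bullet> ?z"
      using pos[OF zV] a(1) by (simp add: inner_add_left)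
    also have "\<dots> = ((Q (w a) + a *\<^sub>R w a) - r *\<^sub>R (Q u + a *\<^sub>R u)) \<bullet> (w a - r *\<^sub>R u)"
      by (simp add: Q.diff Q.scaleR algebra_simps)
    also have "\<dots> = v \<bullet> w a - r * (v \<bullet> u) - r * ((Q u + a *\<^sub>R u) \<bullet> w a)
        + r\<^sup>2 * ((Q u + a *\<^sub>R u) \<bullet> u)"
      unfolding w(2)[OF a(1)]
      by (simp add: inner_diff_left inner_diff_right power2_eq_square algebra_simps)
    also have "(Q u + a *\<^sub>R u) \<bullet> w a = v \<bullet> u"
      using sym[OF u w(1)[OF a(1)]]
      by (subst w(2)[OF a(1), symmetric]) (simp add: inner_add_left inner_add_right inner_commute)
    also have "(Q u + a *\<^sub>R u) \<bullet> u = Q u \<bullet> u + a * (norm u)\<^sup>2"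
      by (simp add: inner_add_left dot_square_norm)
    finally have "0 \<le> v \<bullet> w a - 2 + r\<^sup>2 * (Q u \<bullet> u + a * (norm u)\<^sup>2)"
      using vu by (simp add: r_def)
    also have "r\<^sup>2 * (Q u \<bullet> u + a * (norm u)\<^sup>2) \<le> r\<^sup>2 * (v \<bullet> u)\<^sup>2"
      using a by (intro mult_left_mono) auto
    also have "\<dots> = 1" using vu by (simp add: r_def power_divide)
    finally show ?thesis by simp
  qed
  \<comment> \<open>As |w b| is at most |v| / b, any b at or above |v|^2 works; the maximum with
    \<open>a\<close> in \<open>b\<close> keeps the interval nonempty.\<close>
  have high: "v \<bullet> w b \<le> 1"
  proof -
    have b: "b > 0" "(norm v)\<^sup>2 \<le> b" using a by (auto simp: b_def)
    have "v \<bullet> w b \<le> norm v * norm (w b)" by (rule norm_cauchy_schwarz)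
    also have "\<dots> \<le> norm v * (norm v / b)" by (intro mult_left_mono wle b) auto
    also have "\<dots> \<le> 1" using b by (simp add: power2_eq_square)
    finally show ?thesis .
  qed
  have "continuous_on {a..b} w"
    using a lip[OF a(1)]
    by (intro lipschitz_on_continuous_on[of "norm v / a\<^sup>2"] lipschitz_onI) (auto simp: dist_norm dist_real_def)
  then have "continuous_on {a..b} (\<lambda>\<nu>. v \<bullet> w \<nu>)" by (intro continuous_intros)
  then obtain \<nu> where \<nu>: "a \<le> \<nu>" "\<nu> \<le> b" "v \<bullet> w \<nu> = 1"
    using IVT2'[of "\<lambda>\<nu>. v \<bullet> w \<nu>" b 1 a] low high by (auto simp: b_def)
  show thesis
  proof
    show "\<nu> > 0" using a \<nu> by simp
    then show "w \<nu> \<in> V" "Q (w \<nu>) - (v \<bullet> w \<nu>) *\<^sub>R v = - (\<nu> *\<^sub>R w \<nu>)"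
      using w \<nu>(3) by (auto simp: algebra_simps)
    show "w \<nu> \<noteq> 0" using \<nu>(3) by auto
  qed
qed

section \<open>The Hilbert space of square summable families\<close>

lemma weight_nonzero: "1 + (real_of_int m)\<^sup>2 \<noteq> 0"
  by (metis add_nonneg_eq_0_iff zero_le_one zero_le_power2 zero_neq_one)

lemma L2_iff: "u \<in> L2 \<longleftrightarrow> (\<lambda>m. (cmod (u m))\<^sup>2) summable_on UNIV"
  by (simp add: sobolev1_def weight_nonzero)

lemma sobolev_norm1_0: "sobolev_norm1 0 u = sqrt (\<Sum>\<^sub>\<infinity>m. (cmod (u m))\<^sup>2)"
  by (simp add: sobolev_norm1_def weight_nonzero)

lemma L2_comparison:
  assumes "u \<in> L2" "\<And>m. cmod (v m) \<le> c * cmod (u m)"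
  shows "v \<in> L2"
  unfolding L2_iff
proof (rule summable_on_comparison_test)
  show "(\<lambda>m. c\<^sup>2 * (cmod (u m))\<^sup>2) summable_on UNIV"
    using assms(1) by (intro summable_on_cmult_right) (simp add: L2_iff)
  show "(cmod (v m))\<^sup>2 \<le> c\<^sup>2 * (cmod (u m))\<^sup>2" for m
    using power_mono[OF assms(2)[of m], of 2] by (simp add: power_mult_distrib)
qed simp

lemma L2_zero: "0 \<in> L2"
  by (simp add: L2_iff)

lemma norm_add_square_le:
  fixes x y :: "'a::real_normed_vector"
  shows "(norm (x + y))\<^sup>2 \<le> 2 * (norm x)\<^sup>2 + 2 * (norm y)\<^sup>2"
proof -
  have "(norm (x + y))\<^sup>2 \<le> (norm x + norm y)\<^sup>2" by (intro power_mono norm_triangle_ineq) simp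
  also have "\<dots> \<le> 2 * (norm x)\<^sup>2 + 2 * (norm y)\<^sup>2"
    using sum_squares_bound[of "norm x" "norm y"] by (simp add: power2_sum)
  finally show ?thesis .
qed

lemma L2_add:
  assumes "u \<in> L2" "v \<in> L2"
  shows "u + v \<in> L2"
  unfolding L2_iff
proof (rule summable_on_comparison_test)
  show "(\<lambda>m. 2 * (cmod (u m))\<^sup>2 + 2 * (cmod (v m))\<^sup>2) summable_on UNIV"
    using assms by (intro summable_on_add summable_on_cmult_right) (simp_all add: L2_iff)
qed (simp_all add: norm_add_square_le)

lemma L2_scaleC: "u \<in> L2 \<Longrightarrow> a *\<^sub>C u \<in> L2"
  by (rule L2_comparison[of u _ "cmod a"]) (auto simp: scaleC_fun_def scaleC_complex_def norm_mult)

lemma L2_inner_summable: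
  assumes "u \<in> L2" "v \<in> L2"
  shows "(\<lambda>m. u m * cnj (v m)) summable_on UNIV"
proof (rule abs_summable_summable, rule Infinite_Sum.abs_summable_on_comparison_test')
  show "(\<lambda>m. (cmod (u m))\<^sup>2 + (cmod (v m))\<^sup>2) summable_on UNIV"
    using assms by (intro summable_on_add) (simp_all add: L2_iff)
  show "cmod (u m * cnj (v m)) \<le> (cmod (u m))\<^sup>2 + (cmod (v m))\<^sup>2" for m
  proof -
    have "2 * (cmod (u m) * cmod (v m)) \<le> (cmod (u m))\<^sup>2 + (cmod (v m))\<^sup>2"
      using sum_squares_bound[of "cmod (u m)" "cmod (v m)"] by simp
    moreover have "0 \<le> cmod (u m) * cmod (v m)" by simp
    ultimately show ?thesis unfolding norm_mult complex_mod_cnj by linarith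
  qed
qed

text \<open>The space is given real scalars and the real part of the complex inner product. The
  theorems above then apply to it, and complex conjugation counts as a bounded linear operator;
  complex linearity is recovered afterwards by commuting with scalars.\<close>

typedef ell2 = L2
  using L2_zero by blast

setup_lifting type_definition_ell2

lemma ell2_eqI: "(\<And>m. Rep_ell2 x m = Rep_ell2 y m) \<Longrightarrow> x = y"
  by (simp add: Rep_ell2_inject[symmetric] fun_eq_iff)

instantiation ell2 :: real_vector
begin

lift_definition zero_ell2 :: ell2 is "0" by (rule L2_zero)
lift_definition plus_ell2 :: "ell2 \<Rightarrow> ell2 \<Rightarrow> ell2" is "(+)" by (rule L2_add)
lift_definition scaleR_ell2 :: "real \<Rightarrow> ell2 \<Rightarrow> ell2" is "\<lambda>r u. of_real r *\<^sub>C u" by (rule L2_scaleC)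
lift_definition uminus_ell2 :: "ell2 \<Rightarrow> ell2" is "\<lambda>u. (- 1) *\<^sub>C u" by (rule L2_scaleC)
lift_definition minus_ell2 :: "ell2 \<Rightarrow> ell2 \<Rightarrow> ell2" is "\<lambda>u v. u + (- 1) *\<^sub>C v"
  by (intro L2_add L2_scaleC)

lemma Rep_zero:
  "Rep_ell2 0 m = 0"
  by (simp add: zero_ell2.rep_eq)

lemma Rep_add:
  "Rep_ell2 (x + y) m = Rep_ell2 x m + Rep_ell2 y m"
  by (simp add: plus_ell2.rep_eq)

lemma Rep_scaleR:
  "Rep_ell2 (r *\<^sub>R x) m = of_real r * Rep_ell2 x m"
  by (simp add: scaleR_ell2.rep_eq scaleC_fun_def scaleC_complex_def)

lemma Rep_uminus:
  "Rep_ell2 (- x) m = - Rep_ell2 x m"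
  by (simp add: uminus_ell2.rep_eq scaleC_fun_def scaleC_complex_def)

lemma Rep_diff:
  "Rep_ell2 (x - y) m = Rep_ell2 x m - Rep_ell2 y m"
  by (simp add: minus_ell2.rep_eq scaleC_fun_def scaleC_complex_def)

lemmas Rep_simps = Rep_zero Rep_add Rep_scaleR Rep_uminus Rep_diff

instance
proof
  fix x y z :: ell2 and a b :: real
  show "x + y + z = x + (y + z)" by (rule ell2_eqI) (simp add: Rep_simps)
  show "x + y = y + x" by (rule ell2_eqI) (simp add: Rep_simps)
  show "0 + x = x" by (rule ell2_eqI) (simp add: Rep_simps)
  show "- x + x = 0" by (rule ell2_eqI) (simp add: Rep_simps)
  show "x - y = x + - y" by (rule ell2_eqI) (simp add: Rep_simps)
  show "a *\<^sub>R (x + y) = a *\<^sub>R x + a *\<^sub>R y" by (rule ell2_eqI) (simp add: Rep_simps distrib_left)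
  show "(a + b) *\<^sub>R x = a *\<^sub>R x + b *\<^sub>R x" by (rule ell2_eqI) (simp add: Rep_simps distrib_right)
  show "a *\<^sub>R b *\<^sub>R x = (a * b) *\<^sub>R x" by (rule ell2_eqI) (simp add: Rep_simps)
  show "1 *\<^sub>R x = x" by (rule ell2_eqI) (simp add: Rep_simps)
qed

end

lemma ell2_inner_summable: "(\<lambda>m. Rep_ell2 x m * cnj (Rep_ell2 y m)) summable_on UNIV"
  by (rule L2_inner_summable) (rule Rep_ell2)+

lemma ell2_dot_summable: "(\<lambda>m. Rep_ell2 x m \<bullet> Rep_ell2 y m) summable_on UNIV"
proof -
  have "(\<lambda>m. Re (Rep_ell2 x m * cnj (Rep_ell2 y m))) summable_on UNIV"
    using summable_on_bounded_linear[OF bounded_linear_Re ell2_inner_summable] .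
  then show ?thesis by (simp add: inner_complex_def)
qed

lemma ell2_square_summable: "(\<lambda>m. (cmod (Rep_ell2 x m))\<^sup>2) summable_on UNIV"
  using Rep_ell2[of x] by (simp only: L2_iff)

instantiation ell2 :: real_inner
begin

definition inner_ell2 :: "ell2 \<Rightarrow> ell2 \<Rightarrow> real" where
  "inner_ell2 x y = (\<Sum>\<^sub>\<infinity>m. Rep_ell2 x m \<bullet> Rep_ell2 y m)"
definition norm_ell2 :: "ell2 \<Rightarrow> real" where "norm_ell2 x = sqrt (x \<bullet> x)"
definition dist_ell2 :: "ell2 \<Rightarrow> ell2 \<Rightarrow> real" where "dist_ell2 x y = norm (x - y)"
definition sgn_ell2 :: "ell2 \<Rightarrow> ell2" where "sgn_ell2 x = x /\<^sub>R norm x"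
definition uniformity_ell2 :: "(ell2 \<times> ell2) filter" where
  "uniformity_ell2 = (INF e\<in>{0 <..}. principal {(x, y). dist x y < e})"
definition open_ell2 :: "ell2 set \<Rightarrow> bool" where
  "open_ell2 U \<longleftrightarrow> (\<forall>x\<in>U. eventually (\<lambda>(x', y). x' = x \<longrightarrow> y \<in> U) uniformity)"

instance
proof
  fix x y z :: ell2 and r :: real
  show "dist x y = norm (x - y)" by (rule dist_ell2_def)
  show "sgn x = x /\<^sub>R norm x" by (rule sgn_ell2_def)
  show "uniformity = (INF e\<in>{0 <..}. principal {(x :: ell2, y). dist x y < e})"
    by (rule uniformity_ell2_def)
  show "open U \<longleftrightarrow> (\<forall>x\<in>U. eventually (\<lambda>(x', y). x' = x \<longrightarrow> y \<in> U) uniformity)" for U :: "ell2 set"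
    by (rule open_ell2_def)
  show "x \<bullet> y = y \<bullet> x" unfolding inner_ell2_def by (simp add: inner_commute)
  show "(x + y) \<bullet> z = x \<bullet> z + y \<bullet> z"
    unfolding inner_ell2_def Rep_add inner_add_left by (intro infsum_add ell2_dot_summable)
  show "(r *\<^sub>R x) \<bullet> y = r * (x \<bullet> y)"
    unfolding inner_ell2_def Rep_scaleR
    by (simp add: infsum_cmult_right' scaleR_conv_of_real[symmetric])
  show "0 \<le> x \<bullet> x" unfolding inner_ell2_def by (intro infsum_nonneg) simp
  show "x \<bullet> x = 0 \<longleftrightarrow> x = 0"
  proof
    assume "x \<bullet> x = 0"
    then have "Rep_ell2 x m \<bullet> Rep_ell2 x m = 0" for m
      unfolding inner_ell2_def by (intro nonneg_infsum_le_0D[OF _ ell2_dot_summable]) auto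
    then show "x = 0" by (intro ell2_eqI) (simp add: Rep_zero)
  qed (simp add: inner_ell2_def Rep_zero)
  show "norm x = sqrt (x \<bullet> x)" by (rule norm_ell2_def)
qed

end

lemma norm_ell2_eq: "norm x = sobolev_norm1 0 (Rep_ell2 x)"
  unfolding norm_ell2_def inner_ell2_def sobolev_norm1_0 by (simp add: dot_square_norm)

lemma norm_ell2_square: "(norm x)\<^sup>2 = (\<Sum>\<^sub>\<infinity>m. (cmod (Rep_ell2 x m))\<^sup>2)"
  unfolding power2_norm_eq_inner inner_ell2_def by (simp add: dot_square_norm)

lemma inner_ell2_eq: "x \<bullet> y = Re (inner_L2 (Rep_ell2 x) (Rep_ell2 y))"
proof -
  have "Re (inner_L2 (Rep_ell2 x) (Rep_ell2 y)) = (\<Sum>\<^sub>\<infinity>m. Re (Rep_ell2 x m * cnj (Rep_ell2 y m)))"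
    unfolding inner_L2_def
    using has_sum_bounded_linear[OF bounded_linear_Re has_sum_infsum[OF ell2_inner_summable[of x y]]]
    by (intro infsumI[symmetric])
  then show ?thesis by (simp add: inner_ell2_def inner_complex_def)
qed

lemma sum_square_le_norm_ell2:
  "finite A \<Longrightarrow> (\<Sum>m\<in>A. (cmod (Rep_ell2 x m))\<^sup>2) \<le> (norm x)\<^sup>2"
  unfolding norm_ell2_square by (intro finite_sum_le_infsum ell2_square_summable) auto

lemma cmod_Rep_le_norm: "cmod (Rep_ell2 x m) \<le> norm x"
proof (rule power2_le_imp_le)
  show "(cmod (Rep_ell2 x m))\<^sup>2 \<le> (norm x)\<^sup>2"
    using sum_square_le_norm_ell2[of "{m}" x] by simp
qed simp

lemma bounded_linear_Rep: "bounded_linear (\<lambda>x. Rep_ell2 x m)"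
  by (rule bounded_linear_intro[of _ 1])
    (auto simp: Rep_simps scaleR_conv_of_real cmod_Rep_le_norm)

lemma norm_ell2_leI:
  assumes "\<And>A. finite A \<Longrightarrow> (\<Sum>m\<in>A. (cmod (Rep_ell2 x m))\<^sup>2) \<le> c\<^sup>2" "c \<ge> 0"
  shows "norm x \<le> c"
proof (rule power2_le_imp_le)
  show "(norm x)\<^sup>2 \<le> c\<^sup>2"
    unfolding norm_ell2_square
    by (intro infsum_le_finite_sums ell2_square_summable assms)
qed fact

instance ell2 :: banach
proof
  fix X :: "nat \<Rightarrow> ell2"
  assume X: "Cauchy X"
  have "Cauchy (\<lambda>i. Rep_ell2 (X i) m)" for m
    using bounded_linear.Cauchy[OF bounded_linear_Rep X] .
  then have "\<exists>z. (\<lambda>i. Rep_ell2 (X i) m) \<longlonglongrightarrow> z" for m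
    by (simp add: Cauchy_convergent_iff convergent_def)
  then obtain u where u: "\<And>m. (\<lambda>i. Rep_ell2 (X i) m) \<longlonglongrightarrow> u m" by metis
  \<comment> \<open>Over a finite set of frequencies the Cauchy estimate passes to the
    coordinatewise limit. As the bound does not depend on the set, it yields both that
    \<open>u\<close> is square summable and that the convergence is in norm.\<close>
  have tail: "(\<Sum>m\<in>A. (cmod (Rep_ell2 (X i) m - u m))\<^sup>2) \<le> e\<^sup>2"
    if "finite A" "\<And>j. j \<ge> i \<Longrightarrow> dist (X i) (X j) \<le> e" for A i e
  proof (rule tendsto_upperbound)
    show "(\<lambda>j. \<Sum>m\<in>A. (cmod (Rep_ell2 (X i) m - Rep_ell2 (X j) m))\<^sup>2)
        \<longlonglongrightarrow> (\<Sum>m\<in>A. (cmod (Rep_ell2 (X i) m - u m))\<^sup>2)"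
      by (intro tendsto_intros u)
    have "(\<Sum>m\<in>A. (cmod (Rep_ell2 (X i) m - Rep_ell2 (X j) m))\<^sup>2) \<le> e\<^sup>2" if "j \<ge> i" for j
    proof -
      have "(\<Sum>m\<in>A. (cmod (Rep_ell2 (X i) m - Rep_ell2 (X j) m))\<^sup>2) \<le> (norm (X i - X j))\<^sup>2"
        using sum_square_le_norm_ell2[OF \<open>finite A\<close>, of "X i - X j"] by (simp add: Rep_diff)
      also have "\<dots> \<le> e\<^sup>2"
        using \<open>\<And>j. j \<ge> i \<Longrightarrow> dist (X i) (X j) \<le> e\<close>[OF that] by (intro power_mono) (auto simp: dist_norm)
      finally show ?thesis .
    qed
    then show "\<forall>\<^sub>F j in sequentially.
        (\<Sum>m\<in>A. (cmod (Rep_ell2 (X i) m - Rep_ell2 (X j) m))\<^sup>2) \<le> e\<^sup>2"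
      unfolding eventually_sequentially by blast
  qed simp
  have cauchy: "\<exists>i. \<forall>i'\<ge>i. \<forall>j\<ge>i'. dist (X i') (X j) \<le> e" if "e > 0" for e
    using metric_CauchyD[OF X that] by (meson less_imp_le order_trans)
  have "u \<in> L2"
  proof -
    obtain i where i: "\<And>j. j \<ge> i \<Longrightarrow> dist (X i) (X j) \<le> 1" using cauchy[of 1] by auto
    have "(\<lambda>m. (cmod (Rep_ell2 (X i) m - u m))\<^sup>2) summable_on UNIV"
      using tail[OF _ i] by (intro nonneg_bdd_above_summable_on bdd_aboveI[of _ "1\<^sup>2"]) auto
    then have "(\<lambda>m. Rep_ell2 (X i) m - u m) \<in> L2" by (simp add: L2_iff)
    from L2_add[OF Rep_ell2[of "X i"] L2_scaleC[OF this, of "-1"]] show ?thesis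
      by (simp add: scaleC_fun_def scaleC_complex_def plus_fun_def)
  qed
  then have Ru: "Rep_ell2 (Abs_ell2 u) = u" by (rule Abs_ell2_inverse)
  have "X \<longlonglongrightarrow> Abs_ell2 u"
  proof (rule metric_LIMSEQ_I)
    fix e :: real assume "e > 0"
    then obtain i where i: "\<And>i' j. i' \<ge> i \<Longrightarrow> j \<ge> i' \<Longrightarrow> dist (X i') (X j) \<le> e / 2"
      using cauchy[of "e / 2"] by auto
    have "dist (X i') (Abs_ell2 u) < e" if "i' \<ge> i" for i'
    proof -
      have "norm (X i' - Abs_ell2 u) \<le> e / 2"
        using tail[OF _ i[OF that]] \<open>e > 0\<close> by (intro norm_ell2_leI) (auto simp: Rep_diff Ru)
      then show ?thesis using \<open>e > 0\<close> by (simp add: dist_norm)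
    qed
    then show "\<exists>i. \<forall>i'\<ge>i. dist (X i') (Abs_ell2 u) < e" by blast
  qed
  then show "convergent X" by (auto simp: convergent_def)
qed

section \<open>Operators on square summable families\<close>

text \<open>\<open>Abs_ell2\<close> is specified on \<open>L2\<close> only, which is why invariance
  of \<open>L2\<close> under T accompanies every use.\<close>

definition ell2_op :: "(dist1 \<Rightarrow> dist1) \<Rightarrow> ell2 \<Rightarrow> ell2" where
  "ell2_op T x = Abs_ell2 (T (Rep_ell2 x))"

lemma Rep_ell2_op:
  assumes "\<And>u. u \<in> L2 \<Longrightarrow> T u \<in> L2"
  shows "Rep_ell2 (ell2_op T x) = T (Rep_ell2 x)"
  unfolding ell2_op_def using Abs_ell2_inverse[OF assms[OF Rep_ell2]] .

lemma L2_Rep: "u \<in> L2 \<Longrightarrow> \<exists>x. u = Rep_ell2 x"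
  using Abs_ell2_inverse[of u] by metis

lemma Rep_add_fun: "Rep_ell2 (x + y) = Rep_ell2 x + Rep_ell2 y"
  and Rep_scaleR_fun: "Rep_ell2 (r *\<^sub>R x) = of_real r *\<^sub>C Rep_ell2 x"
  by (simp_all add: fun_eq_iff Rep_simps scaleC_fun_def scaleC_complex_def)

lemma bounded_linear_ell2_op:
  assumes L2: "\<And>u. u \<in> L2 \<Longrightarrow> T u \<in> L2"
    and add: "\<And>u v. u \<in> L2 \<Longrightarrow> v \<in> L2 \<Longrightarrow> T (u + v) = T u + T v"
    and scale: "\<And>u r. u \<in> L2 \<Longrightarrow> T (of_real r *\<^sub>C u) = of_real r *\<^sub>C T u"
    and bound: "\<And>u. u \<in> L2 \<Longrightarrow> sobolev_norm1 0 (T u) \<le> c * sobolev_norm1 0 u"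
  shows "bounded_linear (ell2_op T)"
proof (rule bounded_linear_intro)
  note R = Rep_ell2_op[OF L2]
  show "ell2_op T (x + y) = ell2_op T x + ell2_op T y" for x y
    by (simp add: Rep_ell2_inject[symmetric] R Rep_add_fun add[OF Rep_ell2 Rep_ell2])
  show "ell2_op T (r *\<^sub>R x) = r *\<^sub>R ell2_op T x" for r x
    by (simp add: Rep_ell2_inject[symmetric] R Rep_scaleR_fun scale[OF Rep_ell2])
  show "norm (ell2_op T x) \<le> norm x * c" for x
    using bound[OF Rep_ell2] by (simp add: norm_ell2_eq R mult.commute)
qed

lemma bounded_op_L2D:
  assumes "bounded_op_L2 T"
  shows "u \<in> L2 \<Longrightarrow> T u \<in> L2"
    and "u \<in> L2 \<Longrightarrow> v \<in> L2 \<Longrightarrow> T (u + v) = T u + T v"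
    and "u \<in> L2 \<Longrightarrow> T (a *\<^sub>C u) = a *\<^sub>C T u"
    and "\<exists>c. \<forall>u\<in>L2. sobolev_norm1 0 (T u) \<le> c * sobolev_norm1 0 u"
proof -
  note T = assms[unfolded bounded_op_L2_def]
  show "u \<in> L2 \<Longrightarrow> T u \<in> L2" using T by blast
  show "\<exists>c. \<forall>u\<in>L2. sobolev_norm1 0 (T u) \<le> c * sobolev_norm1 0 u" using T by blast
  have lin: "T (a *\<^sub>C u + b *\<^sub>C v) = a *\<^sub>C T u + b *\<^sub>C T v" if "u \<in> L2" "v \<in> L2" for a b u v
    using T that by blast
  show "u \<in> L2 \<Longrightarrow> v \<in> L2 \<Longrightarrow> T (u + v) = T u + T v"
    using lin[of u v 1 1] by (simp add: scaleC_one)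
  show "u \<in> L2 \<Longrightarrow> T (a *\<^sub>C u) = a *\<^sub>C T u"
    using lin[of u u a 0] by simp
qed

lemma bounded_linear_bounded_op:
  assumes "bounded_op_L2 T"
  shows "bounded_linear (ell2_op T)"
proof -
  obtain c where "\<forall>u\<in>L2. sobolev_norm1 0 (T u) \<le> c * sobolev_norm1 0 u"
    using bounded_op_L2D(4)[OF assms] by blast
  then show ?thesis
    using bounded_op_L2D(1-3)[OF assms] by (intro bounded_linear_ell2_op[of T c]) auto
qed

lemma inner_ell2_op_commute:
  assumes "bounded_op_L2 T" "\<And>u v. u \<in> L2 \<Longrightarrow> v \<in> L2 \<Longrightarrow> inner_L2 (T u) v = inner_L2 u (T v)"
  shows "ell2_op T x \<bullet> y = x \<bullet> ell2_op T y"
  by (simp add: inner_ell2_eq Rep_ell2_op[OF bounded_op_L2D(1)[OF assms(1)]] assms(2)[OF Rep_ell2 Rep_ell2])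

lemma psd_ell2_op:
  assumes "positive_op_L2 T"
  shows "psd_op (ell2_op T)"
proof -
  note T = assms[unfolded positive_op_L2_def]
  have b: "bounded_op_L2 T" using T by blast
  show ?thesis
    unfolding psd_op_def
  proof (intro conjI allI)
    show "bounded_linear (ell2_op T)" by (rule bounded_linear_bounded_op[OF b])
    show "ell2_op T x \<bullet> y = x \<bullet> ell2_op T y" for x y
      using T by (intro inner_ell2_op_commute b) blast
    show "0 \<le> ell2_op T x \<bullet> x" for x
    proof -
      have "Rep_ell2 (ell2_op T x) = T (Rep_ell2 x)"
        by (rule Rep_ell2_op) (rule bounded_op_L2D(1)[OF b])
      then show ?thesis using bspec[OF conjunct2[OF conjunct2[OF T]] Rep_ell2[of x]]
        by (simp only: inner_ell2_eq)
    qed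
  qed
qed

text \<open>A complex scalar is a real-linear operator that commutes with T; feeding it to the
  commutation clause of \<open>psd_op_sqrt\<close> makes the root complex homogeneous.\<close>

lemma bounded_op_scaleC: "bounded_op_L2 (\<lambda>u. a *\<^sub>C u)"
  unfolding bounded_op_L2_def
proof (intro conjI ballI allI exI)
  fix u v :: dist1 and b c :: complex assume "u \<in> L2" "v \<in> L2"
  show "a *\<^sub>C u \<in> L2" using \<open>u \<in> L2\<close> by (rule L2_scaleC)
  show "a *\<^sub>C (b *\<^sub>C u + c *\<^sub>C v) = b *\<^sub>C a *\<^sub>C u + c *\<^sub>C a *\<^sub>C v"
    by (simp add: scaleC_fun_def scaleC_complex_def fun_eq_iff algebra_simps)
  show "sobolev_norm1 0 (a *\<^sub>C u) \<le> cmod a * sobolev_norm1 0 u"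
    by (simp add: sobolev_norm1_0 scaleC_fun_def scaleC_complex_def norm_mult power_mult_distrib
        infsum_cmult_right' real_sqrt_mult)
qed

lemma inner_L2_scaleC_right: "inner_L2 u (a *\<^sub>C v) = cnj a * inner_L2 u v"
  unfolding inner_L2_def scaleC_fun_def scaleC_complex_def
  by (simp add: infsum_cmult_right' algebra_simps flip: infsum_cmult_right')

text \<open>The root \<open>Q\<close> of the real operator, extended by 0 off \<open>L2\<close>, is
  shown to satisfy the definite description and to be its only solution. In the third claim S has to
  be linear over the reals only, so that it covers conjugation.\<close>

theorem sqrt_op_L2_spec:
  assumes T: "positive_op_L2 T"
  shows "positive_op_L2 (sqrt_op_L2 T)"
    and "u \<in> L2 \<Longrightarrow> sqrt_op_L2 T (sqrt_op_L2 T u) = T u"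
    and "(\<And>u. u \<in> L2 \<Longrightarrow> S u \<in> L2) \<Longrightarrow> bounded_linear (ell2_op S) \<Longrightarrow>
      (\<And>u. u \<in> L2 \<Longrightarrow> S (T u) = T (S u)) \<Longrightarrow> u \<in> L2 \<Longrightarrow>
      S (sqrt_op_L2 T u) = sqrt_op_L2 T (S u)"
proof -
  let ?T = "ell2_op T"
  have bT: "bounded_op_L2 T" using T by (simp add: positive_op_L2_def)
  note RT = Rep_ell2_op[OF bounded_op_L2D(1)[OF bT]]
  obtain Q where Q: "psd_op Q" "\<And>x. Q (Q x) = ?T x"
    and comm: "\<And>S x. bounded_linear S \<Longrightarrow> (\<And>y. S (?T y) = ?T (S y)) \<Longrightarrow> S (Q x) = Q (S x)"
    using psd_op_sqrt[OF psd_ell2_op[OF T]] by metis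
  interpret Q: bounded_linear Q using psd_opD(1)[OF Q(1)] .
  define R where "R u = (if u \<in> L2 then Rep_ell2 (Q (Abs_ell2 u)) else 0)" for u
  have RQ: "R (Rep_ell2 x) = Rep_ell2 (Q x)" for x
    using Rep_ell2[of x] by (simp add: R_def Rep_ell2_inverse)
  have R_L2: "u \<in> L2 \<Longrightarrow> R u \<in> L2" for u by (simp add: R_def Rep_ell2)
  have commL2: "S (R u) = R (S u)"
    if S: "\<And>u. u \<in> L2 \<Longrightarrow> S u \<in> L2" "bounded_linear (ell2_op S)"
      "\<And>u. u \<in> L2 \<Longrightarrow> S (T u) = T (S u)" and u: "u \<in> L2" for S u
  proof -
    note RS = Rep_ell2_op[OF S(1)]
    obtain x where x: "u = Rep_ell2 x" using L2_Rep[OF u] by blast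
    have "ell2_op S (Q x) = Q (ell2_op S x)"
      by (rule comm[OF S(2)]) (simp add: Rep_ell2_inject[symmetric] RS RT S(3)[OF Rep_ell2])
    then have "Rep_ell2 (ell2_op S (Q x)) = Rep_ell2 (Q (ell2_op S x))" by simp
    then show ?thesis by (simp only: RS x RQ[symmetric])
  qed
  have R_scale: "a *\<^sub>C R u = R (a *\<^sub>C u)" if "u \<in> L2" for a u
    by (rule commL2[of "\<lambda>u. a *\<^sub>C u"])
      (auto intro: that L2_scaleC bounded_linear_bounded_op bounded_op_scaleC simp: bounded_op_L2D(3)[OF bT])
  have R_add: "R (u + v) = R u + R v" if u: "u \<in> L2" and v: "v \<in> L2" for u v
  proof -
    obtain x where "u = Rep_ell2 x" using L2_Rep[OF u] by blast
    moreover obtain y where "v = Rep_ell2 y" using L2_Rep[OF v] by blast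
    ultimately show ?thesis by (simp add: RQ Q.add flip: Rep_add_fun)
  qed
  have Re_sym: "Re (inner_L2 (R u) v) = Re (inner_L2 u (R v))" if u: "u \<in> L2" and v: "v \<in> L2" for u v
  proof -
    obtain x where "u = Rep_ell2 x" using L2_Rep[OF u] by blast
    moreover obtain y where "v = Rep_ell2 y" using L2_Rep[OF v] by blast
    ultimately show ?thesis using psd_opD(2)[OF Q(1), of x y] by (simp add: RQ inner_ell2_eq)
  qed
  have sym: "inner_L2 (R u) v = inner_L2 u (R v)" if "u \<in> L2" "v \<in> L2" for u v
  proof (rule complex_eqI)
    show "Re (inner_L2 (R u) v) = Re (inner_L2 u (R v))" by (rule Re_sym[OF that])
    \<comment> \<open>The imaginary part of an inner product is the real part of the one with the
      second argument multiplied by \<open>\<i>\<close>.\<close>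
    have "Re (inner_L2 (R u) (\<i> *\<^sub>C v)) = Re (inner_L2 u (\<i> *\<^sub>C R v))"
      using Re_sym[OF that(1) L2_scaleC[OF that(2)], of \<i>] R_scale[OF that(2), of \<i>] by simp
    then show "Im (inner_L2 (R u) v) = Im (inner_L2 u (R v))"
      by (simp add: inner_L2_scaleC_right)
  qed
  have bR: "bounded_op_L2 R"
    unfolding bounded_op_L2_def
  proof (intro conjI ballI allI)
    show "u \<in> L2 \<Longrightarrow> R u \<in> L2" for u by (rule R_L2)
    show "R (a *\<^sub>C u + b *\<^sub>C v) = a *\<^sub>C R u + b *\<^sub>C R v" if "u \<in> L2" "v \<in> L2" for u v a b
      using that by (simp add: R_add R_scale L2_scaleC)
    obtain c where c: "\<And>x. norm (Q x) \<le> norm x * c" using Q.bounded by blast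
    have "sobolev_norm1 0 (R u) \<le> c * sobolev_norm1 0 u" if u: "u \<in> L2" for u
    proof -
      obtain x where "u = Rep_ell2 x" using L2_Rep[OF u] by blast
      then show ?thesis using c[of x] by (simp add: RQ norm_ell2_eq mult.commute)
    qed
    then show "\<exists>c. \<forall>u\<in>L2. sobolev_norm1 0 (R u) \<le> c * sobolev_norm1 0 u" by blast
  qed
  have "positive_op_L2 R"
    unfolding positive_op_L2_def
  proof (intro conjI ballI bR sym)
    show "0 \<le> Re (inner_L2 (R u) u)" if u: "u \<in> L2" for u
    proof -
      obtain x where "u = Rep_ell2 x" using L2_Rep[OF u] by blast
      then show ?thesis using psd_opD(3)[OF Q(1), of x] by (simp add: RQ inner_ell2_eq)
    qed
  qed
  moreover have RR: "R (R u) = T u" if u: "u \<in> L2" for u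
  proof -
    obtain x where "u = Rep_ell2 x" using L2_Rep[OF u] by blast
    then show ?thesis by (simp add: RQ Q(2) RT)
  qed
  moreover have "P = R"
    if P: "positive_op_L2 P \<and> (\<forall>u\<in>L2. P (P u) = T u) \<and> (\<forall>u. u \<notin> L2 \<longrightarrow> P u = 0)" for P
  proof
    fix u
    have pP: "positive_op_L2 P" and bP: "bounded_op_L2 P" using P by (auto simp: positive_op_L2_def)
    have RP: "Rep_ell2 (ell2_op P x) = P (Rep_ell2 x)" for x
      by (rule Rep_ell2_op) (rule bounded_op_L2D(1)[OF bP])
    have PP: "ell2_op P (ell2_op P x) = ?T x" for x
      using P Rep_ell2 by (simp add: Rep_ell2_inject[symmetric] RP RT)
    have "ell2_op P = Q"
    proof (rule psd_op_sqrt_unique[OF Q(1) psd_ell2_op[OF pP]])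
      show "ell2_op P (ell2_op P x) = Q (Q x)" for x by (simp add: PP Q(2))
      \<comment> \<open>P commutes with its own square T, hence with every operator that inherits
        the commutant of T, such as Q.\<close>
      show "ell2_op P (Q x) = Q (ell2_op P x)" for x
        by (rule comm[OF bounded_linear_bounded_op[OF bP]]) (simp flip: PP)
    qed
    then show "P u = R u"
    proof (cases "u \<in> L2")
      case True
      then obtain x where x: "u = Rep_ell2 x" using L2_Rep by blast
      have "Rep_ell2 (ell2_op P x) = P (Rep_ell2 x)" by (rule RP)
      then show ?thesis using \<open>ell2_op P = Q\<close> by (simp add: x RQ)
    qed (use P in \<open>simp add: R_def\<close>)
  qed
  ultimately have "sqrt_op_L2 T = R"
    unfolding sqrt_op_L2_def by (intro the_equality) (auto simp: R_def)
  with \<open>positive_op_L2 R\<close> RR commL2 show "positive_op_L2 (sqrt_op_L2 T)"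
    "u \<in> L2 \<Longrightarrow> sqrt_op_L2 T (sqrt_op_L2 T u) = T u"
    "(\<And>u. u \<in> L2 \<Longrightarrow> S u \<in> L2) \<Longrightarrow> bounded_linear (ell2_op S) \<Longrightarrow>
      (\<And>u. u \<in> L2 \<Longrightarrow> S (T u) = T (S u)) \<Longrightarrow> u \<in> L2 \<Longrightarrow>
      S (sqrt_op_L2 T u) = sqrt_op_L2 T (S u)"
    by auto
qed

lemma bounded_op_comp:
  assumes "bounded_op_L2 S" "bounded_op_L2 T"
  shows "bounded_op_L2 (S \<circ> T)"
proof -
  obtain c where c: "\<forall>u\<in>L2. sobolev_norm1 0 (S u) \<le> c * sobolev_norm1 0 u"
    using bounded_op_L2D(4)[OF assms(1)] by blast
  obtain d where d: "\<forall>u\<in>L2. sobolev_norm1 0 (T u) \<le> d * sobolev_norm1 0 u"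
    using bounded_op_L2D(4)[OF assms(2)] by blast
  have nn: "0 \<le> sobolev_norm1 0 u" for u by (simp add: sobolev_norm1_0 infsum_nonneg)
  have "sobolev_norm1 0 (S (T u)) \<le> (\<bar>c\<bar> * d) * sobolev_norm1 0 u" if u: "u \<in> L2" for u
  proof -
    have "sobolev_norm1 0 (S (T u)) \<le> \<bar>c\<bar> * sobolev_norm1 0 (T u)"
      using c bounded_op_L2D(1)[OF assms(2) u] mult_right_mono[OF abs_ge_self nn] order_trans by blast
    also have "\<dots> \<le> \<bar>c\<bar> * (d * sobolev_norm1 0 u)" using d u by (intro mult_left_mono) auto
    finally show ?thesis by (simp add: mult.assoc)
  qed
  then show ?thesis
    using bounded_op_L2D(1-3)[OF assms(1)] bounded_op_L2D(1-3)[OF assms(2)]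
    unfolding bounded_op_L2_def by (auto simp: L2_scaleC)
qed

section \<open>Fourier multipliers and multiplication by cos (k x)\<close>

definition diag :: "(int \<Rightarrow> real) \<Rightarrow> dist1 \<Rightarrow> dist1" where
  "diag a u = (\<lambda>m. of_real (a m) * u m)"

lemma bounded_op_diag:
  assumes "\<And>m. \<bar>a m\<bar> \<le> c"
  shows "bounded_op_L2 (diag a)"
  unfolding bounded_op_L2_def
proof (intro conjI ballI allI exI)
  have c: "c \<ge> 0" using order_trans[OF abs_ge_zero assms] .
  fix u v :: dist1 and p q :: complex assume u: "u \<in> L2" and "v \<in> L2"
  have le: "cmod (diag a u m) \<le> c * cmod (u m)" for m
    using assms[of m] by (simp add: diag_def norm_mult mult_right_mono)
  show L2: "diag a u \<in> L2" using L2_comparison[OF u le] .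
  show "diag a (p *\<^sub>C u + q *\<^sub>C v) = p *\<^sub>C diag a u + q *\<^sub>C diag a v"
    by (simp add: diag_def scaleC_fun_def scaleC_complex_def fun_eq_iff algebra_simps)
  have "(\<Sum>\<^sub>\<infinity>m. (cmod (diag a u m))\<^sup>2) \<le> (\<Sum>\<^sub>\<infinity>m. c\<^sup>2 * (cmod (u m))\<^sup>2)"
    using u L2 power_mono[OF le, of _ 2]
    by (intro infsum_mono summable_on_cmult_right) (auto simp: L2_iff power_mult_distrib)
  then have "sobolev_norm1 0 (diag a u) \<le> sqrt (c\<^sup>2 * (\<Sum>\<^sub>\<infinity>m. (cmod (u m))\<^sup>2))"
    unfolding sobolev_norm1_0 by (simp add: infsum_cmult_right')
  then show "sobolev_norm1 0 (diag a u) \<le> c * sobolev_norm1 0 u"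
    using c by (simp add: sobolev_norm1_0 real_sqrt_mult)
qed

lemma inner_diag_commute: "inner_L2 (diag a u) v = inner_L2 u (diag a v)"
  by (simp add: inner_L2_def diag_def algebra_simps)

lemma Rep_diag:
  assumes "\<And>m. \<bar>a m\<bar> \<le> c"
  shows "Rep_ell2 (ell2_op (diag a) x) m = of_real (a m) * Rep_ell2 x m"
proof -
  have "Rep_ell2 (ell2_op (diag a) x) = diag a (Rep_ell2 x)"
    by (rule Rep_ell2_op) (rule bounded_op_L2D(1)[OF bounded_op_diag[OF assms]])
  then show ?thesis by (simp add: diag_def)
qed

lemma diag_form_summable:
  assumes "\<And>m. \<bar>a m\<bar> \<le> c"
  shows "(\<lambda>m. a m * (cmod (Rep_ell2 x m))\<^sup>2) summable_on UNIV"
proof (rule abs_summable_summable, rule Infinite_Sum.abs_summable_on_comparison_test')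
  show "(\<lambda>m. c * (cmod (Rep_ell2 x m))\<^sup>2) summable_on UNIV"
    by (intro summable_on_cmult_right ell2_square_summable)
qed (simp add: abs_mult mult_right_mono assms)

lemma inner_diag_self:
  assumes "\<And>m. \<bar>a m\<bar> \<le> c"
  shows "ell2_op (diag a) x \<bullet> x = (\<Sum>\<^sub>\<infinity>m. a m * (cmod (Rep_ell2 x m))\<^sup>2)"
proof -
  have "(of_real r * z) \<bullet> z = r * (cmod z)\<^sup>2" for r z
    by (simp add: dot_square_norm flip: scaleR_conv_of_real)
  then show ?thesis by (simp add: inner_ell2_def Rep_diag[OF assms])
qed

lemma C1_apply: "C1 k u m = (u (m - k) + u (m + k)) / 2"
  by (simp add: C1_def mult_fcos)

lemma bij_add_int: "bij_betw (\<lambda>m. m + k) UNIV (UNIV :: int set)"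
  by (rule bij_betwI[of _ _ _ "\<lambda>m. m - k"]) auto

lemma infsum_shift: "(\<Sum>\<^sub>\<infinity>m. f (m + k :: int)) = infsum f UNIV"
  by (rule infsum_reindex_bij_betw[OF bij_add_int])

lemma summable_shift: "(\<lambda>m. f (m + k :: int)) summable_on UNIV \<longleftrightarrow> f summable_on UNIV"
  by (rule summable_on_reindex_bij_betw[OF bij_add_int])

lemma L2_shift: "u \<in> L2 \<Longrightarrow> (\<lambda>m. u (m + k)) \<in> L2"
  unfolding L2_iff using summable_shift[of "\<lambda>m. (cmod (u m))\<^sup>2" k] by simp

lemma bounded_op_C1: "bounded_op_L2 (C1 k)"
  unfolding bounded_op_L2_def
proof (intro conjI ballI allI exI)
  fix u v :: dist1 and p q :: complex assume u: "u \<in> L2" and "v \<in> L2"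
  let ?g = "\<lambda>j m. (cmod (u (m + j)))\<^sup>2"
  have sg: "?g j summable_on UNIV" for j using L2_shift[OF u, of j] by (simp add: L2_iff)
  have le: "(cmod (C1 k u m))\<^sup>2 \<le> 1 / 2 * (?g (- k) m + ?g k m)" for m
    using norm_add_square_le[of "u (m - k)" "u (m + k)"]
    by (simp add: C1_apply norm_divide power_divide)
  have ss: "(\<lambda>m. 1 / 2 * (?g (- k) m + ?g k m)) summable_on UNIV"
    using summable_on_cmult_right[OF summable_on_add[OF sg[of "- k"] sg[of k]], of "1 / 2"] .
  show L2: "C1 k u \<in> L2"
    unfolding L2_iff by (rule summable_on_comparison_test[OF ss]) (use le in auto)
  show "C1 k (p *\<^sub>C u + q *\<^sub>C v) = p *\<^sub>C C1 k u + q *\<^sub>C C1 k v"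
    by (simp add: fun_eq_iff C1_apply scaleC_fun_def scaleC_complex_def field_simps)
  have "(\<Sum>\<^sub>\<infinity>m. (cmod (C1 k u m))\<^sup>2) \<le> (\<Sum>\<^sub>\<infinity>m. 1 / 2 * (?g (- k) m + ?g k m))"
    using L2 le ss by (intro infsum_mono) (auto simp: L2_iff)
  also have "\<dots> = 1 / 2 * ((\<Sum>\<^sub>\<infinity>m. ?g (- k) m) + (\<Sum>\<^sub>\<infinity>m. ?g k m))"
    by (simp only: infsum_cmult_right' infsum_add[OF sg sg])
  also have "\<dots> = (\<Sum>\<^sub>\<infinity>m. (cmod (u m))\<^sup>2)"
    unfolding infsum_shift[of "\<lambda>m. (cmod (u m))\<^sup>2"] by simp
  finally show "sobolev_norm1 0 (C1 k u) \<le> 1 * sobolev_norm1 0 u"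
    by (simp add: sobolev_norm1_0)
qed

lemma Rep_C1: "Rep_ell2 (ell2_op (C1 k) x) m = (Rep_ell2 x (m - k) + Rep_ell2 x (m + k)) / 2"
proof -
  have "Rep_ell2 (ell2_op (C1 k) x) = C1 k (Rep_ell2 x)"
    by (rule Rep_ell2_op) (rule bounded_op_L2D(1)[OF bounded_op_C1])
  then show ?thesis by (simp add: C1_apply)
qed

lemma inner_C1_commute:
  assumes "u \<in> L2" "v \<in> L2"
  shows "inner_L2 (C1 k u) v = inner_L2 u (C1 k v)"
proof -
  have s1: "(\<lambda>m. u (m + j) * cnj (v m)) summable_on UNIV" for j
    using L2_inner_summable[OF L2_shift[OF assms(1)] assms(2)] .
  have s2: "(\<lambda>m. u m * cnj (v (m + j))) summable_on UNIV" for j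
    using L2_inner_summable[OF assms(1) L2_shift[OF assms(2)]] .
  have sh: "(\<Sum>\<^sub>\<infinity>m. u (m + j) * cnj (v m)) = (\<Sum>\<^sub>\<infinity>m. u m * cnj (v (m + - j)))" for j
    using infsum_shift[of "\<lambda>m. u m * cnj (v (m + - j))" j] by simp
  have "inner_L2 (C1 k u) v =
      (\<Sum>\<^sub>\<infinity>m. 1 / 2 * (u (m + - k) * cnj (v m) + u (m + k) * cnj (v m)))"
    unfolding inner_L2_def C1_apply by (intro infsum_cong) (simp add: field_simps)
  also have "\<dots> = 1 / 2 * ((\<Sum>\<^sub>\<infinity>m. u (m + - k) * cnj (v m)) + (\<Sum>\<^sub>\<infinity>m. u (m + k) * cnj (v m)))"
    by (simp only: infsum_cmult_right' infsum_add[OF s1 s1])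
  also have "\<dots> = 1 / 2 * ((\<Sum>\<^sub>\<infinity>m. u m * cnj (v (m + - k))) + (\<Sum>\<^sub>\<infinity>m. u m * cnj (v (m + k))))"
    unfolding sh by simp
  also have "\<dots> = (\<Sum>\<^sub>\<infinity>m. 1 / 2 * (u m * cnj (v (m + - k)) + u m * cnj (v (m + k))))"
    by (simp only: infsum_cmult_right' infsum_add[OF s2 s2])
  also have "\<dots> = inner_L2 u (C1 k v)"
    unfolding inner_L2_def C1_apply by (intro infsum_cong) (simp add: field_simps)
  finally show ?thesis .
qed

section \<open>The one-dimensional eigenvalue problem\<close>

definition a_coeff :: "int \<Rightarrow> int \<Rightarrow> int \<Rightarrow> real" where
  "a_coeff k n m = of_int (m\<^sup>2 + n\<^sup>2 - k\<^sup>2) / of_int (m\<^sup>2 + n\<^sup>2 + 1)"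

definition b_coeff :: "int \<Rightarrow> int \<Rightarrow> int \<Rightarrow> real" where
  "b_coeff k n m = of_int (1 + k\<^sup>2) / of_int (m\<^sup>2 + n\<^sup>2)"

lemma A1_eq_diag: "A1 k n = diag (a_coeff k n)"
  and B1_eq_diag: "B1 k n = diag (b_coeff k n)"
  by (simp_all add: fun_eq_iff A1_def B1_def diag_def a_coeff_def b_coeff_def)

lemma a_coeff_le_1: "a_coeff k n m \<le> 1"
proof -
  have "(0::real) < of_int (m\<^sup>2 + n\<^sup>2 + 1)"
    by (simp only: of_int_0_less_iff) (simp add: add_nonneg_pos)
  moreover have "real_of_int (m\<^sup>2 + n\<^sup>2 - k\<^sup>2) \<le> of_int (m\<^sup>2 + n\<^sup>2 + 1)"
    by (simp only: of_int_le_iff) (simp add: order_trans[of _ 0])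
  ultimately show ?thesis by (simp only: a_coeff_def divide_le_eq_1_pos)
qed

lemma abs_a_coeff_le: "\<bar>a_coeff k n m\<bar> \<le> 1 + (of_int k)\<^sup>2"
proof -
  have p: "(0::real) < of_int (m\<^sup>2 + n\<^sup>2 + 1)"
    by (simp only: of_int_0_less_iff) (simp add: add_nonneg_pos)
  have "0 \<le> k\<^sup>2 * m\<^sup>2 + k\<^sup>2 * n\<^sup>2 + m\<^sup>2 + n\<^sup>2" by simp
  then have "- (k\<^sup>2 * (m\<^sup>2 + n\<^sup>2 + 1)) \<le> m\<^sup>2 + n\<^sup>2 - k\<^sup>2"
    unfolding ring_distribs by linarith
  then have "real_of_int (- (k\<^sup>2 * (m\<^sup>2 + n\<^sup>2 + 1))) \<le> of_int (m\<^sup>2 + n\<^sup>2 - k\<^sup>2)"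
    by (simp only: of_int_le_iff)
  then have "- (of_int k)\<^sup>2 * of_int (m\<^sup>2 + n\<^sup>2 + 1) \<le> real_of_int (m\<^sup>2 + n\<^sup>2 - k\<^sup>2)"
    by simp
  then have "- (of_int k)\<^sup>2 \<le> a_coeff k n m"
    unfolding a_coeff_def using p by (simp only: pos_le_divide_eq)
  moreover have "0 \<le> (real_of_int k)\<^sup>2" by simp
  ultimately show ?thesis using a_coeff_le_1[of k n m] unfolding abs_le_iff by linarith
qed

lemma a_coeff_nonneg: "k\<^sup>2 \<le> m\<^sup>2 + n\<^sup>2 \<Longrightarrow> 0 \<le> a_coeff k n m"
  unfolding a_coeff_def by (intro divide_nonneg_nonneg) (simp_all only: of_int_0_le_iff, simp_all)

lemma a_coeff_minus: "a_coeff k n (- m) = a_coeff k n m"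
  and b_coeff_minus: "b_coeff k n (- m) = b_coeff k n m"
  by (simp_all add: a_coeff_def b_coeff_def)

lemma b_coeff_bounds:
  assumes "n \<ge> 1"
  shows "0 < b_coeff k n m" "b_coeff k n m \<le> 1 + (of_int k)\<^sup>2"
proof -
  have n: "1 \<le> n\<^sup>2" using assms by simp
  then have "1 \<le> m\<^sup>2 + n\<^sup>2" by (simp add: add_increasing)
  then have p: "(1::real) \<le> of_int (m\<^sup>2 + n\<^sup>2)" by (simp only: of_int_1_le_iff)
  have q: "(0::real) < of_int (1 + k\<^sup>2)" by (simp only: of_int_0_less_iff) (simp add: add_pos_nonneg)
  show "0 < b_coeff k n m" unfolding b_coeff_def using p q by simp
  have "b_coeff k n m \<le> of_int (1 + k\<^sup>2) / 1"
    unfolding b_coeff_def using p q by (intro divide_left_mono) auto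
  then show "b_coeff k n m \<le> 1 + (of_int k)\<^sup>2" by simp
qed

lemma bounded_op_A1: "bounded_op_L2 (A1 k n)"
  unfolding A1_eq_diag by (rule bounded_op_diag[OF abs_a_coeff_le])

lemma abs_b_coeff_le: "n \<ge> 1 \<Longrightarrow> \<bar>b_coeff k n m\<bar> \<le> 1 + (of_int k)\<^sup>2"
  using b_coeff_bounds[of n k m] by simp

lemma abs_sqrt_b_coeff_le:
  assumes "n \<ge> 1"
  shows "\<bar>sqrt (b_coeff k n m)\<bar> \<le> sqrt (1 + (of_int k)\<^sup>2)"
  using b_coeff_bounds[OF assms, of k m] by simp

lemma bounded_op_B1: "n \<ge> 1 \<Longrightarrow> bounded_op_L2 (B1 k n)"
  unfolding B1_eq_diag by (rule bounded_op_diag[OF abs_b_coeff_le])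

lemma bounded_op_D1: "n \<ge> 1 \<Longrightarrow> bounded_op_L2 (D1 k n)"
  unfolding D1_def by (intro bounded_op_comp bounded_op_C1 bounded_op_B1)

section \<open>The sign of the form of A on eigenvectors of D A\<close>

locale chain_problem =
  fixes k n :: int
  assumes k: "k \<ge> 1" and n: "n \<ge> 1"
begin

abbreviation "AT \<equiv> ell2_op (A1 k n)"
abbreviation "BT \<equiv> ell2_op (B1 k n)"
abbreviation "CT \<equiv> ell2_op (C1 k)"
abbreviation "DT \<equiv> ell2_op (D1 k n)"

lemma Rep_AT: "Rep_ell2 (AT x) = A1 k n (Rep_ell2 x)"
  by (rule Rep_ell2_op) (rule bounded_op_L2D(1)[OF bounded_op_A1])

lemma Rep_BT: "Rep_ell2 (BT x) = B1 k n (Rep_ell2 x)"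
  by (rule Rep_ell2_op) (rule bounded_op_L2D(1)[OF bounded_op_B1[OF n]])

lemma Rep_CT: "Rep_ell2 (CT x) = C1 k (Rep_ell2 x)"
  by (rule Rep_ell2_op) (rule bounded_op_L2D(1)[OF bounded_op_C1])

lemma Rep_DT: "Rep_ell2 (DT x) = D1 k n (Rep_ell2 x)"
  by (rule Rep_ell2_op) (rule bounded_op_L2D(1)[OF bounded_op_D1[OF n]])

lemmas bl_AT = bounded_linear_bounded_op[OF bounded_op_A1[of k n]]
  and bl_BT = bounded_linear_bounded_op[OF bounded_op_B1[OF n, of k]]
  and bl_CT = bounded_linear_bounded_op[OF bounded_op_C1[of k]]
  and bl_DT = bounded_linear_bounded_op[OF bounded_op_D1[OF n, of k]]

lemma DT_eq: "DT x = CT (BT (CT x))"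
  unfolding Rep_ell2_inject[symmetric] Rep_BT Rep_CT Rep_DT by (simp add: D1_def)

lemma AT_commute: "AT x \<bullet> y = x \<bullet> AT y"
  unfolding A1_eq_diag
  by (intro inner_ell2_op_commute bounded_op_diag[OF abs_a_coeff_le] inner_diag_commute)

lemma BT_commute: "BT x \<bullet> y = x \<bullet> BT y"
  unfolding B1_eq_diag
  by (intro inner_ell2_op_commute bounded_op_diag[OF abs_b_coeff_le[OF n]] inner_diag_commute)

lemma CT_commute: "CT x \<bullet> y = x \<bullet> CT y"
  by (intro inner_ell2_op_commute bounded_op_C1 inner_C1_commute)

lemma DT_commute: "DT x \<bullet> y = x \<bullet> DT y"
  by (simp add: DT_eq CT_commute BT_commute)

lemma BT_self: "BT x \<bullet> x = (\<Sum>\<^sub>\<infinity>m. b_coeff k n m * (cmod (Rep_ell2 x m))\<^sup>2)"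
  unfolding B1_eq_diag by (rule inner_diag_self[OF abs_b_coeff_le[OF n]])

lemma AT_self: "AT x \<bullet> x = (\<Sum>\<^sub>\<infinity>m. a_coeff k n m * (cmod (Rep_ell2 x m))\<^sup>2)"
  unfolding A1_eq_diag by (rule inner_diag_self[OF abs_a_coeff_le])

lemma BT_nonneg: "0 \<le> BT x \<bullet> x"
  unfolding BT_self using b_coeff_bounds(1)[OF n] by (intro infsum_nonneg mult_nonneg_nonneg) (auto simp: less_imp_le)

lemma BT_self_eq_0:
  assumes "BT x \<bullet> x = 0"
  shows "x = 0"
proof (rule ell2_eqI)
  fix m
  have "(\<lambda>m. b_coeff k n m * (cmod (Rep_ell2 x m))\<^sup>2) summable_on UNIV"
    by (rule diag_form_summable[OF abs_b_coeff_le[OF n]])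
  then have "b_coeff k n m * (cmod (Rep_ell2 x m))\<^sup>2 = 0"
    using assms b_coeff_bounds(1)[OF n]
    by (intro nonneg_infsum_le_0D[of "\<lambda>m. b_coeff k n m * (cmod (Rep_ell2 x m))\<^sup>2" UNIV])
      (auto simp: BT_self less_imp_le)
  then show "Rep_ell2 x m = Rep_ell2 0 m"
    using b_coeff_bounds(1)[OF n, of k m] by (simp add: Rep_zero)
qed

lemma psd_DT: "psd_op DT"
  unfolding psd_op_def
proof (intro conjI allI)
  show "0 \<le> DT x \<bullet> x" for x using BT_nonneg[of "CT x"] by (simp add: DT_eq CT_commute)
qed (use DT_commute bl_DT in auto)

lemma positive_D1: "positive_op_L2 (D1 k n)"
  unfolding positive_op_L2_def
proof (intro conjI ballI)
  show "bounded_op_L2 (D1 k n)" by (rule bounded_op_D1[OF n])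
next
  fix u v :: dist1 assume uv: "u \<in> L2" "v \<in> L2"
  have L: "C1 k w \<in> L2" "B1 k n w \<in> L2" if "w \<in> L2" for w
    using that bounded_op_L2D(1)[OF bounded_op_C1] bounded_op_L2D(1)[OF bounded_op_B1[OF n]] by blast+
  show "inner_L2 (D1 k n u) v = inner_L2 u (D1 k n v)"
    unfolding D1_def o_def
    using uv L by (simp add: inner_C1_commute B1_eq_diag inner_diag_commute)
next
  fix u :: dist1 assume "u \<in> L2"
  then obtain x where "u = Rep_ell2 x" using L2_Rep by blast
  then show "0 \<le> Re (inner_L2 (D1 k n u) u)"
    using psd_opD(3)[OF psd_DT, of x] by (simp add: inner_ell2_eq Rep_DT)
qed

text \<open>On an eigenvector of \<open>D A\<close> with negative eigenvalue the form of \<open>A\<close> is negative, since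
  \<open>-\<nu> \<langle>A x, x\<rangle> = \<langle>A x, D A x\<rangle> = \<langle>B C A x, C A x\<rangle> \<ge> 0\<close>.\<close>

lemma form_negative:
  assumes "DT (AT x) = - (\<nu> *\<^sub>R x)" "\<nu> > 0" "x \<noteq> 0"
  shows "AT x \<bullet> x < 0"
proof (rule ccontr)
  assume "\<not> AT x \<bullet> x < 0"
  then have "0 \<le> \<nu> * (AT x \<bullet> x)" using assms(2) by simp
  moreover have "\<nu> * (AT x \<bullet> x) = - (BT (CT (AT x)) \<bullet> CT (AT x))"
  proof -
    have "\<nu> * (AT x \<bullet> x) = - (AT x \<bullet> DT (AT x))" using assms(1) by simp
    also have "AT x \<bullet> DT (AT x) = BT (CT (AT x)) \<bullet> CT (AT x)"
      by (simp only: DT_eq CT_commute[symmetric] inner_commute[of "CT (AT x)"])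
    finally show ?thesis .
  qed
  ultimately have "BT (CT (AT x)) \<bullet> CT (AT x) = 0" using BT_nonneg[of "CT (AT x)"] by linarith
  then have "CT (AT x) = 0" by (rule BT_self_eq_0)
  then have "DT (AT x) = 0"
    by (simp add: DT_eq linear_0[OF bounded_linear.linear[OF bl_CT]] linear_0[OF bounded_linear.linear[OF bl_BT]])
  then show False using assms by simp
qed

lemma form_nonneg:
  assumes supp: "\<And>m. Rep_ell2 x m \<noteq> 0 \<Longrightarrow> k dvd m" and zero: "n < k \<Longrightarrow> Rep_ell2 x 0 = 0"
  shows "0 \<le> AT x \<bullet> x"
  unfolding AT_self
proof (rule infsum_nonneg)
  fix m
  show "0 \<le> a_coeff k n m * (cmod (Rep_ell2 x m))\<^sup>2"
  proof (cases "Rep_ell2 x m = 0")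
    case False
    have "k\<^sup>2 \<le> m\<^sup>2 + n\<^sup>2"
    proof (cases "m = 0")
      case True
      then have "k \<le> n" using False zero by force
      then show ?thesis using k True by (simp add: power_mono)
    next
      case m: False
      then have "\<bar>k\<bar> \<le> \<bar>m\<bar>" using supp[OF False] by (metis dvd_imp_le_int)
      then have "k\<^sup>2 \<le> m\<^sup>2" by (simp add: abs_le_square_iff)
      then show ?thesis by (simp add: add_increasing2)
    qed
    then show ?thesis by (simp add: a_coeff_nonneg)
  qed simp
qed

lemma no_eigenvector:
  assumes "DT (AT x) = - (\<nu> *\<^sub>R x)" "\<nu> > 0"
    "\<And>m. Rep_ell2 x m \<noteq> 0 \<Longrightarrow> k dvd m" "n < k \<Longrightarrow> Rep_ell2 x 0 = 0"
  shows "x = 0"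
  using form_negative[OF assms(1,2)] form_nonneg[OF assms(3,4)] by force

text \<open>Equal coefficients at 0 put \<open>x - y\<close> among the families of vanishing mean,
  where the form is nonnegative. If the eigenvalues differed, orthogonality would make the form at
  \<open>x - y\<close> the sum of two negative numbers. If they agree, \<open>x - y\<close>
  satisfies the same eigenvalue equation and \<open>no_eigenvector\<close> applies.\<close>

lemma eigenvector_unique:
  assumes x: "DT (AT x) = - (\<nu> *\<^sub>R x)" "\<nu> > 0" "\<And>m. Rep_ell2 x m \<noteq> 0 \<Longrightarrow> k dvd m"
    and y: "DT (AT y) = - (\<mu> *\<^sub>R y)" "\<mu> > 0" "\<And>m. Rep_ell2 y m \<noteq> 0 \<Longrightarrow> k dvd m"
    and eq0: "Rep_ell2 x 0 = Rep_ell2 y 0" and "x \<noteq> 0" "y \<noteq> 0"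
  shows "\<nu> = \<mu>" "x = y"
proof -
  interpret A: bounded_linear AT by (rule bl_AT)
  interpret D: bounded_linear DT by (rule bl_DT)
  have supp: "k dvd m" if "Rep_ell2 (x - y) m \<noteq> 0" for m
    using that x(3)[of m] y(3)[of m] by (cases "Rep_ell2 x m = 0") (auto simp: Rep_diff)
  have zero: "Rep_ell2 (x - y) 0 = 0" using eq0 by (simp add: Rep_diff)
  show "\<nu> = \<mu>"
  proof (rule ccontr)
    assume ne: "\<nu> \<noteq> \<mu>"
    have "\<nu> * (x \<bullet> AT y) = - (DT (AT x) \<bullet> AT y)" using x(1) by simp
    also have "\<dots> = - (AT x \<bullet> DT (AT y))" by (simp only: DT_commute)
    also have "\<dots> = \<mu> * (x \<bullet> AT y)" using y(1) by (simp add: AT_commute)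
    finally have orth: "x \<bullet> AT y = 0" using ne by simp
    have "AT (x - y) \<bullet> (x - y) = AT x \<bullet> x + AT y \<bullet> y - 2 * (x \<bullet> AT y)"
      by (simp add: A.diff inner_diff_left inner_diff_right AT_commute[of x y] inner_commute[of "AT y" x])
    also have "\<dots> < 0"
      using form_negative[OF x(1,2) \<open>x \<noteq> 0\<close>] form_negative[OF y(1,2) \<open>y \<noteq> 0\<close>] orth by simp
    finally show False using form_nonneg[of "x - y"] supp zero by force
  qed
  then have "DT (AT (x - y)) = - (\<nu> *\<^sub>R (x - y))"
    using x(1) y(1) by (simp add: A.diff D.diff algebra_simps)
  from no_eigenvector[OF this x(2)] supp zero show "x = y" by simp
qed

text \<open>Pair the equation for \<open>y\<close> with A x: as D is symmetric, the terms with
  \<open>\<nu>\<close> cancel and \<open>c * (AT x \<bullet> x) = 0\<close> remains, against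
  \<open>form_negative\<close>.\<close>

lemma no_jordan_chain:
  assumes x: "DT (AT x) = - (\<nu> *\<^sub>R x)" "\<nu> > 0"
    and y: "DT (AT y) = - (\<nu> *\<^sub>R y) - c *\<^sub>R x" and c: "c \<noteq> 0"
  shows "x = 0"
proof (rule ccontr)
  assume "x \<noteq> 0"
  have "DT (AT y) \<bullet> AT x = AT y \<bullet> DT (AT x)" by (rule DT_commute)
  then have "c * (AT x \<bullet> x) = 0"
    using x(1) y by (simp add: inner_diff_left AT_commute[of y x] inner_commute[of x "AT x"])
  then show False using form_negative[OF x \<open>x \<noteq> 0\<close>] c by simp
qed

end

subsection \<open>Existence of a negative eigenvalue\<close>

text \<open>The coefficients of exp (i j x); in particular \<open>delta 0\<close> is the constant
  function 1.\<close>

definition delta :: "int \<Rightarrow> ell2" where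
  "delta j = Abs_ell2 (\<lambda>m. if m = j then 1 else 0)"

lemma Rep_delta: "Rep_ell2 (delta j) m = (if m = j then 1 else 0)"
proof -
  have "(\<lambda>m. if m = j then 1 else 0) \<in> L2"
    unfolding L2_iff by (rule summable_on_cong_neutral[of _ "{j}", THEN iffD1]) auto
  then show ?thesis by (simp add: delta_def Abs_ell2_inverse)
qed

lemma inner_delta: "delta j \<bullet> x = Re (Rep_ell2 x j)"
proof -
  have "delta j \<bullet> x = (\<Sum>\<^sub>\<infinity>m\<in>{j}. Re (Rep_ell2 x m))"
    unfolding inner_ell2_def by (rule infsum_cong_neutral) (auto simp: Rep_delta inner_complex_def)
  then show ?thesis by simp
qed

definition cosv :: "int \<Rightarrow> ell2" where
  "cosv j = (1 / 2) *\<^sub>R (delta j + delta (- j))"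

lemma cosv_0: "cosv 0 = delta 0"
  by (rule ell2_eqI) (simp add: cosv_def Rep_simps Rep_delta)

lemma Rep_cosv: "Rep_ell2 (cosv j) m = ((if m = j then 1 else 0) + (if m = - j then 1 else 0)) / 2"
  by (simp add: cosv_def Rep_simps Rep_delta)

lemma cosv_orthogonal: "i > 0 \<Longrightarrow> j > 0 \<Longrightarrow> i \<noteq> j \<Longrightarrow> cosv i \<bullet> cosv j = 0"
  by (simp add: cosv_def[of i] inner_add_left inner_delta Rep_cosv)

lemma norm_cosv: "j > 0 \<Longrightarrow> (norm (cosv j))\<^sup>2 = 1 / 2"
  unfolding power2_norm_eq_inner by (simp add: cosv_def[of j] inner_add_left inner_delta)
    (simp add: Rep_simps Rep_delta)

text \<open>Real even coefficients are those of real cosine series. This real subspace is where a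
  rank-one term written with the real inner product is the correct one, since a coefficient is then
  equal to its real part.\<close>

definition sym_class :: "(int \<Rightarrow> bool) \<Rightarrow> ell2 set" where
  "sym_class P = {x. \<forall>m. Im (Rep_ell2 x m) = 0 \<and> Rep_ell2 x (- m) = Rep_ell2 x m \<and>
     (\<not> P m \<longrightarrow> Rep_ell2 x m = 0)}"

lemma subspace_sym_class: "subspace (sym_class P)"
  by (auto simp: subspace_def sym_class_def Rep_simps)

lemma closed_sym_class: "closed (sym_class P)"
  unfolding sym_class_def
  by (intro closed_Collect_all closed_Collect_conj closed_Collect_imp closed_Collect_eq open_Collect_const
      continuous_intros linear_continuous_on[OF bounded_linear_Rep]
      linear_continuous_on[OF bounded_linear_compose[OF bounded_linear_Im bounded_linear_Rep]])

lemma diag_sym_class: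
  assumes "\<And>m. \<bar>a m\<bar> \<le> c" "\<And>m. a (- m) = a m" "x \<in> sym_class P"
  shows "ell2_op (diag a) x \<in> sym_class P"
  using assms(2,3) by (simp add: sym_class_def Rep_diag[OF assms(1)])

lemma C1_sym_class:
  assumes "x \<in> sym_class P" "\<And>m. P m \<Longrightarrow> P' (m + k) \<and> P' (m - k)"
  shows "ell2_op (C1 k) x \<in> sym_class P'"
proof -
  have sym: "Rep_ell2 x (- m) = Rep_ell2 x m" and real: "Im (Rep_ell2 x m) = 0"
    and supp: "\<not> P m \<Longrightarrow> Rep_ell2 x m = 0" for m
    using assms(1) by (auto simp: sym_class_def)
  show ?thesis
    unfolding sym_class_def
  proof (intro CollectI allI conjI impI)
    fix m
    show "Im (Rep_ell2 (ell2_op (C1 k) x) m) = 0" by (simp add: Rep_C1 real)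
    show "Rep_ell2 (ell2_op (C1 k) x) (- m) = Rep_ell2 (ell2_op (C1 k) x) m"
    proof -
      have "- m - k = - (m + k)" "- m + k = - (m - k)" by simp_all
      then show ?thesis by (simp only: Rep_C1 sym add.commute)
    qed
    assume "\<not> P' m"
    then have "\<not> P (m - k)" "\<not> P (m + k)" using assms(2)[of "m - k"] assms(2)[of "m + k"] by auto
    then show "Rep_ell2 (ell2_op (C1 k) x) m = 0" by (simp add: Rep_C1 supp)
  qed
qed

context chain_problem
begin

abbreviation "even_freq m \<equiv> 2 * k dvd m"
abbreviation "odd_freq m \<equiv> 2 * k dvd m + k"

text \<open>The symbol of A with its value at 0 replaced by 0; among the multiples of
  \<open>k\<close> this is the only value that can be negative. What is taken away reappears as the
  rank-one term of \<open>AT_split\<close>.\<close>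

definition "a' m = (if m = 0 then 0 else a_coeff k n m)"

abbreviation "AT' \<equiv> ell2_op (diag a')"
abbreviation "BH \<equiv> ell2_op (diag (\<lambda>m. sqrt (b_coeff k n m)))"

lemma abs_a'_le: "\<bar>a' m\<bar> \<le> 1 + (of_int k)\<^sup>2"
  using abs_a_coeff_le[of k n m] by (simp add: a'_def)

lemmas bl_AT' = bounded_linear_bounded_op[OF bounded_op_diag[OF abs_a'_le]]
  and bl_BH = bounded_linear_bounded_op[OF bounded_op_diag[OF abs_sqrt_b_coeff_le[OF n, of k]]]

lemma Rep_AT': "Rep_ell2 (AT' x) m = of_real (a' m) * Rep_ell2 x m"
  by (rule Rep_diag[OF abs_a'_le])

lemma Rep_BH: "Rep_ell2 (BH x) m = of_real (sqrt (b_coeff k n m)) * Rep_ell2 x m"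
  by (rule Rep_diag[OF abs_sqrt_b_coeff_le[OF n, of k]])

lemma AT'_commute: "AT' x \<bullet> y = x \<bullet> AT' y"
  by (intro inner_ell2_op_commute bounded_op_diag[OF abs_a'_le] inner_diag_commute)

lemma BH_commute: "BH x \<bullet> y = x \<bullet> BH y"
  by (intro inner_ell2_op_commute bounded_op_diag[OF abs_sqrt_b_coeff_le[OF n]] inner_diag_commute)

lemma BH_BH: "BH (BH x) = BT x"
proof (rule ell2_eqI)
  fix m
  have "complex_of_real (sqrt (b_coeff k n m)) * of_real (sqrt (b_coeff k n m)) = of_real (b_coeff k n m)"
    using b_coeff_bounds(1)[OF n, of k m] by (simp only: of_real_mult[symmetric]) simp
  then show "Rep_ell2 (BH (BH x)) m = Rep_ell2 (BT x) m"
    by (simp add: Rep_BH B1_eq_diag Rep_diag[OF abs_b_coeff_le[OF n]] flip: mult.assoc)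
qed

lemma BH_sym_class: "x \<in> sym_class P \<Longrightarrow> BH x \<in> sym_class P"
  by (rule diag_sym_class[OF abs_sqrt_b_coeff_le[OF n]]) (simp_all add: b_coeff_minus)

lemma AT'_sym_class: "x \<in> sym_class P \<Longrightarrow> AT' x \<in> sym_class P"
  by (rule diag_sym_class[OF abs_a'_le]) (simp_all add: a_coeff_minus a'_def)

lemma CT_sym_class:
  "x \<in> sym_class odd_freq \<Longrightarrow> CT x \<in> sym_class even_freq"
  "x \<in> sym_class even_freq \<Longrightarrow> CT x \<in> sym_class odd_freq"
proof -
  show "x \<in> sym_class even_freq \<Longrightarrow> CT x \<in> sym_class odd_freq"
    by (erule C1_sym_class) (auto simp: add.assoc intro: dvd_add)
  show "CT x \<in> sym_class even_freq" if "x \<in> sym_class odd_freq"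
  proof (rule C1_sym_class[OF that])
    fix m assume "odd_freq m"
    moreover have "m - k = (m + k) - 2 * k" by simp
    ultimately show "even_freq (m + k) \<and> even_freq (m - k)"
      by (metis dvd_diff dvd_refl)
  qed
qed

lemma AT'_nonneg:
  assumes "x \<in> sym_class even_freq"
  shows "0 \<le> AT' x \<bullet> x"
proof -
  have "a' m * (cmod (Rep_ell2 x m))\<^sup>2 \<ge> 0" for m
  proof (cases "m = 0 \<or> Rep_ell2 x m = 0")
    case False
    then have "2 * k dvd m" using assms by (auto simp: sym_class_def)
    then have "\<bar>k\<bar> \<le> \<bar>m\<bar>" using False by (meson dvd_imp_le_int dvd_mult_right)
    then have "k\<^sup>2 \<le> m\<^sup>2" by (simp add: abs_le_square_iff)
    then show ?thesis using False by (simp add: a'_def a_coeff_nonneg add_increasing2)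
  qed (auto simp: a'_def)
  then show ?thesis unfolding inner_diag_self[OF abs_a'_le] by (intro infsum_nonneg)
qed

text \<open>Membership in \<open>sym_class\<close> is used through reality at frequency 0:
  \<open>delta 0 \<bullet> x\<close> sees only the real part of that coefficient.\<close>

lemma AT_split:
  assumes "x \<in> sym_class P"
  shows "AT x = AT' x + (a_coeff k n 0 * (delta 0 \<bullet> x)) *\<^sub>R delta 0"
proof (rule ell2_eqI)
  fix m
  have "Im (Rep_ell2 x 0) = 0" using assms by (simp add: sym_class_def)
  then have "Rep_ell2 x 0 = of_real (Re (Rep_ell2 x 0))" by (simp add: complex_eq_iff)
  then show "Rep_ell2 (AT x) m = Rep_ell2 (AT' x + (a_coeff k n 0 * (delta 0 \<bullet> x)) *\<^sub>R delta 0) m"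
    by (simp add: A1_eq_diag Rep_diag[OF abs_a_coeff_le] Rep_simps Rep_AT' a'_def Rep_delta inner_delta)
qed

text \<open>Telescoping: \<open>cos (k x) \<cdot> (\<Sum>j<i. 2 (-1)^j cos ((2j+1) k x)) = 1 - (-1)^i cos (2ik x)\<close>.
  Averaging over \<open>i\<close> makes the second term small in \<open>L\<^sup>2\<close>.\<close>

definition "tau j = (1 / sqrt (b_coeff k n j)) *\<^sub>R cosv j"
definition "tel i = (\<Sum>j<i. (2 * (-1) ^ j) *\<^sub>R tau ((2 * int j + 1) * k))"

lemma BH_tau: "BH (tau j) = cosv j"
  using b_coeff_bounds(1)[OF n, of k]
  by (intro ell2_eqI) (auto simp: Rep_BH tau_def Rep_simps Rep_cosv b_coeff_minus less_imp_neq[symmetric])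

lemma CT_cosv: "CT (cosv j) = (1 / 2) *\<^sub>R (cosv (j + k) + cosv (j - k))"
  by (rule ell2_eqI) (auto simp: Rep_CT C1_apply Rep_cosv Rep_simps)

lemma CT_BH_tel: "CT (BH (tel i)) = delta 0 - (-1) ^ i *\<^sub>R cosv (2 * int i * k)"
proof (induction i)
  case 0
  then show ?case
    using linear_0[OF bounded_linear.linear[OF bl_CT]] linear_0[OF bounded_linear.linear[OF bl_BH]]
    by (simp add: tel_def cosv_0)
next
  case (Suc i)
  interpret C: bounded_linear CT by (rule bl_CT)
  interpret B: bounded_linear BH by (rule bl_BH)
  have "CT (BH (tel (Suc i))) = CT (BH (tel i)) + (2 * (-1) ^ i) *\<^sub>R CT (cosv ((2 * int i + 1) * k))"
    by (simp add: tel_def C.add B.add C.scaleR B.scaleR BH_tau)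
  also have "\<dots> = delta 0 - (-1) ^ Suc i *\<^sub>R cosv (2 * int (Suc i) * k)"
    unfolding Suc.IH CT_cosv by (simp add: algebra_simps)
  finally show ?case .
qed

lemma cosv_sym_class: "P j \<Longrightarrow> P (- j) \<Longrightarrow> cosv j \<in> sym_class P"
  by (auto simp: sym_class_def Rep_cosv)

lemma tel_sym_class: "tel i \<in> sym_class odd_freq"
  unfolding tel_def tau_def
proof (intro subspace_sum[OF subspace_sym_class] subspace_scale[OF subspace_sym_class] cosv_sym_class)
  fix j
  have "(2 * int j + 1) * k + k = 2 * k * (int j + 1)" "- ((2 * int j + 1) * k) + k = 2 * k * - int j"
    by (simp_all add: algebra_simps)
  then show "odd_freq ((2 * int j + 1) * k)" "odd_freq (- ((2 * int j + 1) * k))" by (metis dvd_triv_left)+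
qed

theorem negative_eigenvector_exists:
  assumes "n < k"
  obtains \<nu> x where "\<nu> > 0" "x \<noteq> 0" "x \<in> sym_class even_freq" "DT (AT x) = - (\<nu> *\<^sub>R x)"
proof -
  interpret C: bounded_linear CT by (rule bl_CT)
  interpret B: bounded_linear BH by (rule bl_BH)
  interpret A': bounded_linear AT' by (rule bl_AT')
  have "n\<^sup>2 < k\<^sup>2" using assms n by (intro power_strict_mono) auto
  then have "real_of_int (n\<^sup>2 - k\<^sup>2) < 0" by (simp only: of_int_less_0_iff)
  moreover have "0 < real_of_int (n\<^sup>2 + 1)" by (simp only: of_int_0_less_iff) (simp add: add_nonneg_pos)
  ultimately have a0: "a_coeff k n 0 < 0"
    unfolding a_coeff_def by (simp add: divide_neg_pos)
  \<comment> \<open>With this factor, \<open>x \<mapsto> (v \<bullet> x) *\<^sub>R v\<close> carries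
    the weight \<open>- a_coeff k n 0\<close>; subtracting it from \<open>Q\<close> restores the
    value of A at 0 that \<open>AT'\<close> drops.\<close>
  define \<alpha> where "\<alpha> = sqrt (- a_coeff k n 0)"
  have \<alpha>: "\<alpha> * \<alpha> = - a_coeff k n 0" using a0 by (simp add: \<alpha>_def)
  define Q where "Q x = BH (CT (AT' (CT (BH x))))" for x
  define v where "v = \<alpha> *\<^sub>R BH (CT (delta 0))"
  let ?V = "sym_class odd_freq"
  have CB: "CT (BH x) \<in> sym_class even_freq" if "x \<in> ?V" for x
    using that by (intro CT_sym_class BH_sym_class)
  have QV: "Q x \<in> ?V" if "x \<in> ?V" for x
    unfolding Q_def using that by (intro CT_sym_class BH_sym_class AT'_sym_class)
  have Qxy: "Q x \<bullet> y = AT' (CT (BH x)) \<bullet> CT (BH y)" for x y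
    by (simp add: Q_def BH_commute CT_commute)
  have vx: "v \<bullet> x = \<alpha> * (delta 0 \<bullet> CT (BH x))" for x
    by (simp add: v_def BH_commute CT_commute)
  have blQ: "bounded_linear Q"
    unfolding Q_def
    by (intro bounded_linear_compose[OF bl_BH] bounded_linear_compose[OF bl_CT]
        bounded_linear_compose[OF bl_AT'] bl_BH)
  have sym: "Q x \<bullet> y = x \<bullet> Q y" for x y
    by (simp add: Q_def BH_commute CT_commute AT'_commute)
  have pos: "0 \<le> Q x \<bullet> x" if "x \<in> ?V" for x
    unfolding Qxy using AT'_nonneg[OF CB[OF that]] .
  have "delta 0 \<in> sym_class even_freq" using cosv_sym_class[of even_freq 0] by (simp add: cosv_0)
  then have vV: "v \<in> ?V"
    unfolding v_def by (intro subspace_scale[OF subspace_sym_class] BH_sym_class CT_sym_class)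
  \<comment> \<open>Every single remainder \<open>cosv (2 * int i * k)\<close> has squared norm 1/2,
    but the mean of N orthogonal ones has squared norm at most 1 / N. This has to fall below
    \<open>- a_coeff k n 0\<close>, the contribution of the rank-one term.\<close>
  obtain N where N: "N > 0" "1 / real N < - a_coeff k n 0"
    using a0 ex_inverse_of_nat_less[of "- a_coeff k n 0"] by (auto simp: inverse_eq_divide)
  define u where "u = (1 / real N) *\<^sub>R (\<Sum>i=1..N. tel i)"
  have uV: "u \<in> ?V"
    unfolding u_def by (intro subspace_scale[OF subspace_sym_class] subspace_sum[OF subspace_sym_class] tel_sym_class)
  define z where "z = (\<Sum>i=1..N. (-1) ^ i *\<^sub>R cosv (2 * int i * k))"
  have CBu: "CT (BH u) = delta 0 - (1 / real N) *\<^sub>R z"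
    using N by (simp add: u_def C.scaleR B.scaleR C.sum B.sum CT_BH_tel sum_subtractf z_def
        scaleR_diff_right sum_constant_scaleR)
  have z0: "Rep_ell2 z 0 = 0"
  proof -
    have "Rep_ell2 z 0 = (\<Sum>i=1..N. Rep_ell2 ((-1) ^ i *\<^sub>R cosv (2 * int i * k)) 0)"
      unfolding z_def by (rule linear_sum[OF bounded_linear.linear[OF bounded_linear_Rep]])
    also have "\<dots> = 0" using k by (intro sum.neutral) (auto simp: Rep_simps Rep_cosv)
    finally show ?thesis .
  qed
  have nz: "(norm z)\<^sup>2 \<le> real N"
  proof -
    have "(norm z)\<^sup>2 = (\<Sum>i=1..N. (norm ((-1) ^ i *\<^sub>R cosv (2 * int i * k)))\<^sup>2)"
      unfolding z_def
    proof (rule norm_sum_Pythagorean)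
      show "pairwise (\<lambda>i j. orthogonal ((-1) ^ i *\<^sub>R cosv (2 * int i * k)) ((-1) ^ j *\<^sub>R cosv (2 * int j * k))) {1..N}"
        using k by (auto simp: pairwise_def orthogonal_def cosv_orthogonal)
    qed simp
    also have "\<dots> = (\<Sum>i=1..N. 1 / 2)"
      using k by (intro sum.cong) (auto simp: power_mult_distrib norm_cosv)
    also have "\<dots> \<le> real N" by simp
    finally show ?thesis .
  qed
  have AT'_le: "AT' x \<bullet> x \<le> (norm x)\<^sup>2" for x
    unfolding inner_diag_self[OF abs_a'_le] norm_ell2_square
  proof (rule infsum_mono[OF diag_form_summable[OF abs_a'_le] ell2_square_summable])
    show "a' m * (cmod (Rep_ell2 x m))\<^sup>2 \<le> (cmod (Rep_ell2 x m))\<^sup>2" for m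
      using mult_right_mono[of "a' m" 1 "(cmod (Rep_ell2 x m))\<^sup>2"] a_coeff_le_1[of k n m]
      by (auto simp: a'_def)
  qed
  \<comment> \<open>\<open>AT'\<close> annihilates the constant 1, so the form of \<open>Q\<close>
    sees only the remainder \<open>z\<close>; as \<open>z\<close> has no coefficient at 0,
    \<open>v \<bullet> u\<close> sees only the constant 1.\<close>
  have neg: "Q u \<bullet> u < (v \<bullet> u)\<^sup>2"
  proof -
    have "AT' (delta 0) = 0" by (rule ell2_eqI) (simp add: Rep_AT' Rep_delta Rep_zero a'_def)
    then have "Q u \<bullet> u = (1 / real N)\<^sup>2 * (AT' z \<bullet> z)"
      unfolding Qxy CBu
      using AT'_commute[of z "delta 0"]
      by (simp add: A'.diff A'.scaleR inner_diff_left inner_diff_right power2_eq_square)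
    also have "\<dots> \<le> (1 / real N)\<^sup>2 * real N"
      using order_trans[OF AT'_le nz] by (simp add: mult_left_mono divide_right_mono)
    also have "\<dots> = 1 / real N" using N by (simp add: power2_eq_square)
    also have "\<dots> < - a_coeff k n 0" by (rule N)
    also have "\<dots> = (v \<bullet> u)\<^sup>2"
      unfolding vx CBu using z0 \<alpha> by (simp add: inner_delta Rep_simps Rep_delta power2_eq_square)
    finally show ?thesis .
  qed
  obtain \<nu> w where w: "\<nu> > 0" "w \<in> ?V" "w \<noteq> 0" "Q w - (v \<bullet> w) *\<^sub>R v = - (\<nu> *\<^sub>R w)"
    using rank_one_negative_eigenvector[OF blQ subspace_sym_class closed_sym_class QV pos sym vV uV neg]
    by blast
  \<comment> \<open>C B^(1/2) intertwines B^(1/2) C A C B^(1/2) with D A and so carries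
    \<open>w\<close> to an eigenvector of D A. It does not kill \<open>w\<close>, as
    \<open>y = 0\<close> in \<open>eig\<close> would give
    \<open>\<nu> *\<^sub>R w = 0\<close>.\<close>
  define y where "y = CT (BH w)"
  have y: "y \<in> sym_class even_freq" unfolding y_def by (rule CB[OF w(2)])
  have eig: "BH (CT (AT y)) = - (\<nu> *\<^sub>R w)"
  proof -
    have "BH (CT (AT y)) = Q w + (a_coeff k n 0 * (delta 0 \<bullet> y)) *\<^sub>R BH (CT (delta 0))"
      unfolding AT_split[OF y] by (simp add: C.add B.add C.scaleR B.scaleR Q_def y_def)
    also have "\<dots> = Q w - (v \<bullet> w) *\<^sub>R v"
    proof -
      have "(v \<bullet> w) *\<^sub>R v = (\<alpha> * \<alpha> * (delta 0 \<bullet> y)) *\<^sub>R BH (CT (delta 0))"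
        unfolding vx y_def by (simp add: v_def mult_ac)
      then show ?thesis unfolding \<alpha> by simp
    qed
    finally show ?thesis using w(4) by simp
  qed
  show thesis
  proof
    show "\<nu> > 0" by fact
    show "y \<in> sym_class even_freq" by fact
    show "DT (AT y) = - (\<nu> *\<^sub>R y)"
      by (simp add: DT_eq eig C.neg B.neg C.scaleR B.scaleR y_def[symmetric] flip: BH_BH)
    show "y \<noteq> 0"
    proof
      assume "y = 0"
      then have "\<nu> *\<^sub>R w = 0"
        using eig linear_0[OF bounded_linear.linear[OF bl_AT]] by (simp add: C.zero B.zero)
      then show False using w by simp
    qed
  qed
qed

end

lemma scaleC_apply: "(a *\<^sub>C u) m = a * (u m :: complex)"
  by (simp add: scaleC_fun_def scaleC_complex_def)

lemma diag_scaleC: "diag a (c *\<^sub>C u) = c *\<^sub>C diag a u"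
  and C1_scaleC: "C1 k (c *\<^sub>C u) = c *\<^sub>C C1 k u"
  and C1_add: "C1 k (u + v) = C1 k u + C1 k v"
  and diag_add: "diag a (u + v) = diag a u + diag a v"
  by (simp_all add: fun_eq_iff diag_def C1_apply scaleC_apply algebra_simps add_divide_distrib)

lemma A1_scaleC: "A1 k n (c *\<^sub>C u) = c *\<^sub>C A1 k n u"
  and B1_scaleC: "B1 k n (c *\<^sub>C u) = c *\<^sub>C B1 k n u"
  and B1_add: "B1 k n (u + v) = B1 k n u + B1 k n v"
  by (simp_all add: A1_eq_diag B1_eq_diag diag_scaleC diag_add)

lemma D1_scaleC: "D1 k n (c *\<^sub>C u) = c *\<^sub>C D1 k n u"
  by (simp add: D1_def C1_scaleC B1_scaleC)

lemma real_valued_scale: "real_valued u \<Longrightarrow> real_valued (of_real r *\<^sub>C u)"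
  by (simp add: real_valued_def scaleC_apply)

subsection \<open>Symmetries commuting with the square root\<close>

definition reflect :: "dist1 \<Rightarrow> dist1" where "reflect u = (\<lambda>m. u (- m))"
text \<open>The coefficients of the complex conjugate function: conjugating exp (i m x) reverses the
  frequency, hence the minus sign.\<close>

definition conj_op :: "dist1 \<Rightarrow> dist1" where "conj_op u = (\<lambda>m. cnj (u (- m)))"

lemma bij_minus_int: "bij_betw uminus UNIV (UNIV :: int set)"
  by (rule bij_betwI[of _ _ _ uminus]) auto

lemma square_sum_reflect:
  "(\<Sum>\<^sub>\<infinity>m. (cmod (u (- m :: int)))\<^sup>2) = (\<Sum>\<^sub>\<infinity>m. (cmod (u m))\<^sup>2)"
  "(\<lambda>m. (cmod (u (- m :: int)))\<^sup>2) summable_on UNIV \<longleftrightarrow> (\<lambda>m. (cmod (u m))\<^sup>2) summable_on UNIV"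
  using infsum_reindex_bij_betw[OF bij_minus_int, of "\<lambda>m. (cmod (u m))\<^sup>2"]
    summable_on_reindex_bij_betw[OF bij_minus_int, of "\<lambda>m. (cmod (u m))\<^sup>2"] by auto

lemma reflect_L2: "u \<in> L2 \<Longrightarrow> reflect u \<in> L2"
  and conj_L2: "u \<in> L2 \<Longrightarrow> conj_op u \<in> L2"
  using square_sum_reflect(2)[of u] by (simp_all add: L2_iff reflect_def conj_op_def)

lemma bounded_linear_reflect: "bounded_linear (ell2_op reflect)"
  by (rule bounded_linear_ell2_op[of _ 1], erule reflect_L2)
    (simp_all add: sobolev_norm1_0 reflect_def square_sum_reflect fun_eq_iff scaleC_apply)

lemma bounded_linear_conj: "bounded_linear (ell2_op conj_op)"
  by (rule bounded_linear_ell2_op[of _ 1], erule conj_L2)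
    (simp_all add: sobolev_norm1_0 conj_op_def square_sum_reflect fun_eq_iff scaleC_apply)

text \<open>It turns a condition on the support into being fixed by an operator that commutes with
  D, so that D^(1/2) preserves the condition.\<close>

definition freq_proj :: "int \<Rightarrow> dist1 \<Rightarrow> dist1" where
  "freq_proj d = diag (\<lambda>m. if d dvd m then 1 else 0)"

lemma bounded_op_freq_proj: "bounded_op_L2 (freq_proj d)"
  unfolding freq_proj_def by (rule bounded_op_diag[of _ 1]) auto

lemma freq_proj_eq_iff: "freq_proj d u = u \<longleftrightarrow> (\<forall>m. u m \<noteq> 0 \<longrightarrow> d dvd m)"
  by (auto simp: freq_proj_def diag_def fun_eq_iff)

lemma diag_commute: "diag a (diag b u) = diag b (diag a u)"
  by (simp add: diag_def fun_eq_iff)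

lemma C1_diag:
  assumes "\<And>m. a (m - k) = b m" "\<And>m. a (m + k) = b m"
  shows "C1 k (diag a u) = diag b (C1 k u)"
  by (simp add: fun_eq_iff C1_apply diag_def assms algebra_simps)

text \<open>For \<open>d dvd 2 * k\<close> the frequencies \<open>m - k\<close> and
  \<open>m + k\<close> agree modulo d. Hence C exchanges the families supported where
  \<open>d dvd m\<close> with those where \<open>d dvd m + k\<close>, and the two factors C of D
  undo each other.\<close>

lemma D1_freq_proj:
  assumes "d dvd 2 * k"
  shows "freq_proj d (D1 k n u) = D1 k n (freq_proj d u)"
proof -
  let ?a = "\<lambda>m. if d dvd m then 1 else 0 :: real" and ?b = "\<lambda>m. if d dvd m + k then 1 else 0 :: real"
  have dvd: "d dvd m - k \<longleftrightarrow> d dvd m + k" for m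
    using assms dvd_add_left_iff[of d "2 * k" "m - k"] by (simp add: algebra_simps)
  have dvd2: "d dvd 2 * k + m \<longleftrightarrow> d dvd m" for m
    using assms by (rule dvd_add_right_iff)
  have "C1 k (diag ?a v) = diag ?b (C1 k v)" "C1 k (diag ?b v) = diag ?a (C1 k v)" for v
    by (rule C1_diag; simp add: dvd dvd2)+
  then show ?thesis
    by (simp add: D1_def freq_proj_def B1_eq_diag diag_commute[of "b_coeff k n"])
qed

lemma C1_reflect: "C1 k (reflect u) = reflect (C1 k u)"
  by (simp add: fun_eq_iff C1_apply reflect_def add.commute)

lemma C1_conj: "C1 k (conj_op u) = conj_op (C1 k u)"
  by (simp add: fun_eq_iff C1_apply conj_op_def add.commute)

lemma D1_reflect: "reflect (D1 k n u) = D1 k n (reflect u)"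
proof -
  have "B1 k n (reflect v) = reflect (B1 k n v)" for v
    by (simp add: fun_eq_iff B1_def reflect_def)
  then show ?thesis by (simp add: D1_def C1_reflect)
qed

lemma D1_conj: "conj_op (D1 k n u) = D1 k n (conj_op u)"
proof -
  have "B1 k n (conj_op v) = conj_op (B1 k n v)" for v
    by (simp add: fun_eq_iff B1_def conj_op_def)
  then show ?thesis by (simp add: D1_def C1_conj)
qed

lemma A1_conj: "A1 k n (conj_op u) = conj_op (A1 k n u)"
  by (simp add: fun_eq_iff A1_def conj_op_def)

lemma A1_reflect: "A1 k n (reflect u) = reflect (A1 k n u)"
  by (simp add: fun_eq_iff A1_def reflect_def)

lemma real_valued_conj: "real_valued u \<longleftrightarrow> conj_op u = u"
proof
  assume "real_valued u"
  then show "conj_op u = u" by (simp add: real_valued_def conj_op_def)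
next
  assume u: "conj_op u = u"
  have "cnj (u m) = u (- m)" for m
    using fun_cong[OF u, of "- m"] by (simp add: conj_op_def)
  then show "real_valued u" by (simp add: real_valued_def)
qed

section \<open>Passing between eigenvectors of K and of D A\<close>

context chain_problem
begin

abbreviation "R1 \<equiv> sqrt_op_L2 (D1 k n)"

lemma R1_L2: "u \<in> L2 \<Longrightarrow> R1 u \<in> L2"
  using sqrt_op_L2_spec(1)[OF positive_D1] bounded_op_L2D(1) unfolding positive_op_L2_def by blast

lemma A1_L2: "u \<in> L2 \<Longrightarrow> A1 k n u \<in> L2"
  by (rule bounded_op_L2D(1)[OF bounded_op_A1])

lemma R1_R1: "u \<in> L2 \<Longrightarrow> R1 (R1 u) = D1 k n u"
  by (rule sqrt_op_L2_spec(2)[OF positive_D1])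

lemma R1_scaleC: "u \<in> L2 \<Longrightarrow> R1 (c *\<^sub>C u) = c *\<^sub>C R1 u"
  using sqrt_op_L2_spec(1)[OF positive_D1] bounded_op_L2D(3) unfolding positive_op_L2_def by blast

lemma R1_freq_proj: "u \<in> L2 \<Longrightarrow> d dvd 2 * k \<Longrightarrow> freq_proj d (R1 u) = R1 (freq_proj d u)"
  by (rule sqrt_op_L2_spec(3)[OF positive_D1])
    (auto intro: bounded_op_L2D(1)[OF bounded_op_freq_proj] bounded_linear_bounded_op bounded_op_freq_proj D1_freq_proj)

lemma R1_reflect: "u \<in> L2 \<Longrightarrow> reflect (R1 u) = R1 (reflect u)"
  by (rule sqrt_op_L2_spec(3)[OF positive_D1]) (auto intro: reflect_L2 bounded_linear_reflect D1_reflect)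

lemma R1_conj: "u \<in> L2 \<Longrightarrow> conj_op (R1 u) = R1 (conj_op u)"
  by (rule sqrt_op_L2_spec(3)[OF positive_D1]) (auto intro: conj_L2 bounded_linear_conj D1_conj)

lemma K1_eigenvectorD:
  assumes "g \<in> L2" "g \<noteq> 0" "K1 k n g = - of_real \<nu> *\<^sub>C g" "\<nu> > 0"
  shows "R1 g \<in> L2" "R1 g \<noteq> 0" "D1 k n (A1 k n (R1 g)) = - of_real \<nu> *\<^sub>C R1 g"
proof -
  show L2: "R1 g \<in> L2" by (rule R1_L2) fact
  have K: "R1 (A1 k n (R1 g)) = - of_real \<nu> *\<^sub>C g" using assms(3) by (simp add: K1_def)
  have "D1 k n (A1 k n (R1 g)) = R1 (R1 (A1 k n (R1 g)))"
    by (rule R1_R1[symmetric]) (intro A1_L2 L2)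
  then show "D1 k n (A1 k n (R1 g)) = - of_real \<nu> *\<^sub>C R1 g"
    by (simp only: K R1_scaleC[OF assms(1)])
  show "R1 g \<noteq> 0"
  proof
    assume "R1 g = 0"
    moreover have "A1 k n 0 = 0" by (simp add: A1_def fun_eq_iff)
    moreover have "R1 0 = 0" using R1_scaleC[OF L2_zero, of 0] by simp
    ultimately have "- of_real \<nu> *\<^sub>C g = 0" using K by simp
    then have "- of_real \<nu> * g m = 0" for m by (metis scaleC_apply zero_fun_apply)
    then show False using assms(2,4) by (auto simp: fun_eq_iff)
  qed
qed

text \<open>No inverse of D^(1/2) is taken: since f = - (1 / \<nu>) D A f, the equation itself
  exhibits f as D^(1/2) applied to this \<open>g\<close>.\<close>

lemma K1_eigenvectorI:
  assumes "f \<in> L2" "f \<noteq> 0" "D1 k n (A1 k n f) = - of_real \<nu> *\<^sub>C f" "\<nu> > 0"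
    and g: "g = - of_real (1 / \<nu>) *\<^sub>C R1 (A1 k n f)"
  shows "g \<in> L2" "g \<noteq> 0" "K1 k n g = - of_real \<nu> *\<^sub>C g" "R1 g = f"
proof -
  have L: "A1 k n f \<in> L2" "R1 (A1 k n f) \<in> L2" using assms(1) by (auto intro: A1_L2 R1_L2)
  show "g \<in> L2" unfolding g by (intro L2_scaleC L)
  have "R1 g = - of_real (1 / \<nu>) *\<^sub>C D1 k n (A1 k n f)"
    unfolding g by (simp only: R1_scaleC[OF L(2)] R1_R1[OF L(1)])
  also have "\<dots> = f"
    unfolding assms(3) using assms(4) by (simp add: fun_eq_iff scaleC_apply)
  finally show Rg: "R1 g = f" .
  show "K1 k n g = - of_real \<nu> *\<^sub>C g"
  proof -
    have "K1 k n g = R1 (A1 k n f)" by (simp only: K1_def o_apply Rg)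
    also have "\<dots> = - of_real \<nu> *\<^sub>C g"
      unfolding g using assms(4) by (simp add: fun_eq_iff scaleC_apply)
    finally show ?thesis .
  qed
  show "g \<noteq> 0"
  proof
    assume "g = 0"
    moreover have "R1 0 = 0" using R1_scaleC[OF L2_zero, of 0] by simp
    ultimately show False using Rg assms(2) by simp
  qed
qed

text \<open>By \<open>no_eigenvector\<close> neither family vanishes at frequency 0. A complex
  rescaling of \<open>u\<close> therefore makes the two coefficients there equal, as the real
  statement \<open>eigenvector_unique\<close> demands.\<close>

lemma D1_A1_unique:
  assumes u: "u \<in> L2" "u \<noteq> 0" "D1 k n (A1 k n u) = - of_real \<nu> *\<^sub>C u" "\<nu> > 0" "\<And>m. u m \<noteq> 0 \<Longrightarrow> k dvd m"
    and v: "v \<in> L2" "v \<noteq> 0" "D1 k n (A1 k n v) = - of_real \<mu> *\<^sub>C v" "\<mu> > 0" "\<And>m. v m \<noteq> 0 \<Longrightarrow> k dvd m"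
  shows "\<mu> = \<nu>" "\<exists>c. v = c *\<^sub>C u"
proof -
  have eig: "DT (AT (Abs_ell2 w)) = - (\<kappa> *\<^sub>R Abs_ell2 w)"
    if "w \<in> L2" "D1 k n (A1 k n w) = - of_real \<kappa> *\<^sub>C w" for w \<kappa>
    using that by (intro ell2_eqI) (simp add: Rep_DT Rep_AT Rep_simps Abs_ell2_inverse scaleC_apply)
  have Abs0: "Abs_ell2 w \<noteq> 0" if "w \<in> L2" "w \<noteq> 0" for w
    using that Abs_ell2_inverse[OF that(1)] zero_ell2.rep_eq by metis
  have u0: "u 0 \<noteq> 0"
    using no_eigenvector[OF eig[OF u(1,3)] u(4)] u(5) Abs0[OF u(1,2)] by (auto simp: Abs_ell2_inverse u(1))
  have v0: "v 0 \<noteq> 0"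
    using no_eigenvector[OF eig[OF v(1,3)] v(4)] v(5) Abs0[OF v(1,2)] by (auto simp: Abs_ell2_inverse v(1))
  define w where "w = (v 0 / u 0) *\<^sub>C u"
  have w: "w \<in> L2" unfolding w_def by (rule L2_scaleC[OF u(1)])
  have w0: "w 0 = v 0" using u0 by (simp add: w_def scaleC_apply)
  have wne: "w \<noteq> 0" using w0 v0 by auto
  have weig: "D1 k n (A1 k n w) = - of_real \<nu> *\<^sub>C w"
    unfolding w_def A1_scaleC D1_scaleC u(3) by (simp add: fun_eq_iff scaleC_apply)
  have wsupp: "k dvd m" if "w m \<noteq> 0" for m
    using that u(5)[of m] by (auto simp: w_def scaleC_apply)
  have R: "Rep_ell2 (Abs_ell2 w) = w" "Rep_ell2 (Abs_ell2 v) = v"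
    using w v(1) by (simp_all add: Abs_ell2_inverse)
  note uniq = eigenvector_unique[OF eig[OF w weig] u(4) _ eig[OF v(1,3)] v(4) _ _ Abs0[OF w wne] Abs0[OF v(1,2)],
      unfolded R, OF wsupp v(5) w0]
  show "\<mu> = \<nu>" using uniq(1) by simp
  have "w = v" using uniq(2) R by metis
  then show "\<exists>c. v = c *\<^sub>C u" unfolding w_def by metis
qed

lemma D1_A1_eigenvector_exists:
  assumes "n < k"
  obtains \<nu> u where "\<nu> > 0" "u \<in> L2" "u \<noteq> 0" "D1 k n (A1 k n u) = - of_real \<nu> *\<^sub>C u"
    "reflect u = u" "real_valued u" "\<And>m. u m \<noteq> 0 \<Longrightarrow> 2 * k dvd m"
proof -
  obtain \<nu> x where x: "\<nu> > 0" "x \<noteq> 0" "x \<in> sym_class even_freq" "DT (AT x) = - (\<nu> *\<^sub>R x)"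
    using negative_eigenvector_exists[OF assms] by blast
  have sym: "Rep_ell2 x (- m) = Rep_ell2 x m" "Im (Rep_ell2 x m) = 0"
    "Rep_ell2 x m \<noteq> 0 \<Longrightarrow> 2 * k dvd m" for m
    using x(3) by (auto simp: sym_class_def)
  show thesis
  proof
    show "\<nu> > 0" by fact
    show "Rep_ell2 x \<in> L2" by (rule Rep_ell2)
    show "Rep_ell2 x \<noteq> 0" using x(2) zero_ell2.rep_eq Rep_ell2_inject by metis
    have "Rep_ell2 (DT (AT x)) = Rep_ell2 (- (\<nu> *\<^sub>R x))" using x(4) by simp
    then show "D1 k n (A1 k n (Rep_ell2 x)) = - of_real \<nu> *\<^sub>C Rep_ell2 x"
      by (simp add: Rep_DT Rep_AT fun_eq_iff Rep_simps scaleC_apply)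
    show "reflect (Rep_ell2 x) = Rep_ell2 x" by (simp add: reflect_def sym)
    show "real_valued (Rep_ell2 x)" by (simp add: real_valued_def sym complex_eq_iff)
    show "2 * k dvd m" if "Rep_ell2 x m \<noteq> 0" for m using that by (rule sym(3))
  qed
qed

end

section \<open>Sobolev regularity\<close>

lemma sobolev1_mono:
  assumes "r \<le> r'" "u \<in> sobolev1 r'"
  shows "u \<in> sobolev1 r"
  unfolding sobolev1_def
proof (rule CollectI, rule summable_on_comparison_test)
  show "(\<lambda>m. (1 + (of_int m)\<^sup>2) powr r' * (cmod (u m))\<^sup>2) summable_on UNIV"
    using assms(2) by (simp add: sobolev1_def)
qed (use assms(1) in \<open>auto intro!: mult_right_mono powr_mono\<close>)

lemma sobolev1_comparison:
  assumes "u \<in> sobolev1 r" "\<And>m. (1 + (of_int m)\<^sup>2) powr r' * (cmod (v m))\<^sup>2 \<le>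
      c * ((1 + (of_int m)\<^sup>2) powr r * (cmod (u m))\<^sup>2)"
  shows "v \<in> sobolev1 r'"
  unfolding sobolev1_def
proof (rule CollectI, rule summable_on_comparison_test)
  show "(\<lambda>m. c * ((1 + (of_int m)\<^sup>2) powr r * (cmod (u m))\<^sup>2)) summable_on UNIV"
    using assms(1) by (intro summable_on_cmult_right) (simp add: sobolev1_def)
qed (use assms(2) in auto)

lemma sobolev1_scaleC: "u \<in> sobolev1 r \<Longrightarrow> c *\<^sub>C u \<in> sobolev1 r"
  by (erule sobolev1_comparison[where c = "(cmod c)\<^sup>2"]) (simp add: scaleC_apply norm_mult power_mult_distrib)

lemma sobolev1_A1:
  assumes "u \<in> sobolev1 r"
  shows "A1 k n u \<in> sobolev1 r"
proof (rule sobolev1_comparison[OF assms])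
  fix m
  have "cmod (A1 k n u m) \<le> (1 + (of_int k)\<^sup>2) * cmod (u m)"
    unfolding A1_eq_diag diag_def norm_mult using abs_a_coeff_le[of k n m]
    by (intro mult_right_mono) auto
  then have "(cmod (A1 k n u m))\<^sup>2 \<le> (1 + (of_int k)\<^sup>2)\<^sup>2 * (cmod (u m))\<^sup>2"
    unfolding power_mult_distrib[symmetric] by (intro power_mono) auto
  then have "(1 + (of_int m)\<^sup>2) powr r * (cmod (A1 k n u m))\<^sup>2 \<le>
      (1 + (of_int m)\<^sup>2) powr r * ((1 + (of_int k)\<^sup>2)\<^sup>2 * (cmod (u m))\<^sup>2)"
    by (intro mult_left_mono) auto
  then show "(1 + (of_int m)\<^sup>2) powr r * (cmod (A1 k n u m))\<^sup>2 \<le>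
      (1 + (of_int k)\<^sup>2)\<^sup>2 * ((1 + (of_int m)\<^sup>2) powr r * (cmod (u m))\<^sup>2)"
    by (simp only: mult_ac)
qed

lemma divide_add_le:
  fixes x y c :: real
  assumes "1 \<le> y" "0 \<le> x" "0 \<le> c"
  shows "c / (x + y) \<le> 2 * c / (1 + x + y)"
proof -
  have "c * (1 + x + y) \<le> c * (2 * (x + y))" using assms by (intro mult_left_mono) auto
  then show ?thesis using assms by (simp add: divide_simps mult_ac)
qed

text \<open>The first weight is that of the slice of \<open>sobolev2\<close> at transverse frequency
  \<open>n\<close>, the second that of \<open>sobolev1\<close>.\<close>

lemma b_coeff_decay:
  assumes "n \<ge> 1"
  shows "b_coeff k n m \<le> 2 * (1 + (of_int k)\<^sup>2) / (1 + (of_int m)\<^sup>2 + (of_int n)\<^sup>2)"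
    "b_coeff k n m \<le> 2 * (1 + (of_int k)\<^sup>2) / (1 + (of_int m)\<^sup>2)"
proof -
  have n: "1 \<le> (real_of_int n)\<^sup>2" using assms by (simp add: one_le_power)
  have "b_coeff k n m = (1 + (of_int k)\<^sup>2) / ((of_int m)\<^sup>2 + (of_int n)\<^sup>2)"
    by (simp add: b_coeff_def)
  also have "\<dots> \<le> 2 * (1 + (of_int k)\<^sup>2) / (1 + (of_int m)\<^sup>2 + (of_int n)\<^sup>2)"
    using n by (rule divide_add_le) simp_all
  finally show "b_coeff k n m \<le> 2 * (1 + (of_int k)\<^sup>2) / (1 + (of_int m)\<^sup>2 + (of_int n)\<^sup>2)" .
  also have "\<dots> \<le> 2 * (1 + (of_int k)\<^sup>2) / (1 + (of_int m)\<^sup>2)"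
    by (intro divide_left_mono mult_pos_pos) (auto simp: add_pos_nonneg)
  finally show "b_coeff k n m \<le> 2 * (1 + (of_int k)\<^sup>2) / (1 + (of_int m)\<^sup>2)" .
qed

lemma sobolev1_B1:
  assumes "n \<ge> 1" "u \<in> sobolev1 r"
  shows "B1 k n u \<in> sobolev1 (r + 2)"
proof (rule sobolev1_comparison[OF assms(2)])
  fix m
  let ?w = "1 + (real_of_int m)\<^sup>2" and ?c = "2 * (1 + (real_of_int k)\<^sup>2)"
  have w: "?w > 0" by (simp add: add_pos_nonneg)
  have "b_coeff k n m * cmod (u m) \<le> ?c / ?w * cmod (u m)"
    by (intro mult_right_mono b_coeff_decay(2)[OF assms(1)]) auto
  then have "cmod (B1 k n u m) \<le> ?c / ?w * cmod (u m)"
    unfolding B1_eq_diag diag_def norm_mult using b_coeff_bounds(1)[OF assms(1), of k m] by simp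
  then have "(cmod (B1 k n u m))\<^sup>2 \<le> (?c / ?w * cmod (u m))\<^sup>2" by (intro power_mono) auto
  then have "?w powr (r + 2) * (cmod (B1 k n u m))\<^sup>2 \<le> ?w powr (r + 2) * (?c / ?w * cmod (u m))\<^sup>2"
    by (intro mult_left_mono) auto
  also have "?w powr (r + 2) * (?c / ?w * cmod (u m))\<^sup>2 = ?c\<^sup>2 * (?w powr r * (cmod (u m))\<^sup>2)"
  proof -
    have "?w\<^sup>2 * (?c / ?w * cmod (u m))\<^sup>2 = (?w * (?c / ?w * cmod (u m)))\<^sup>2"
      by (simp only: power_mult_distrib)
    also have "?w * (?c / ?w * cmod (u m)) = ?c * cmod (u m)" using w by simp
    finally have e: "?w\<^sup>2 * (?c / ?w * cmod (u m))\<^sup>2 = (?c * cmod (u m))\<^sup>2" .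
    have "?w powr (r + 2) = ?w powr r * ?w\<^sup>2" using w by (simp add: powr_add)
    then have "?w powr (r + 2) * (?c / ?w * cmod (u m))\<^sup>2 = ?w powr r * (?c * cmod (u m))\<^sup>2"
      unfolding e[symmetric] by (simp only: mult.assoc)
    then show ?thesis by (simp only: power_mult_distrib mult_ac)
  qed
  finally show "?w powr (r + 2) * (cmod (B1 k n u m))\<^sup>2 \<le> ?c\<^sup>2 * (?w powr r * (cmod (u m))\<^sup>2)" .
qed

text \<open>Peetre's inequality; the difference of the two sides is the sum of squares in the
  proof.\<close>

lemma weight_shift_le: "1 + (real_of_int m)\<^sup>2 \<le> 2 * (1 + (of_int j)\<^sup>2) * (1 + (of_int (m + j))\<^sup>2)"
proof -
  have "0 \<le> (real_of_int m + 2 * of_int j)\<^sup>2 + 1 + 2 * (of_int j * (of_int m + of_int j))\<^sup>2" by simp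
  then show ?thesis by (simp add: power2_eq_square algebra_simps)
qed

lemma sobolev1_shift:
  assumes "r \<ge> 0" "u \<in> sobolev1 r"
  shows "(\<lambda>m. u (m + j)) \<in> sobolev1 r"
  unfolding sobolev1_def
proof (rule CollectI, rule summable_on_comparison_test)
  let ?c = "2 * (1 + (real_of_int j)\<^sup>2)"
  have s: "(\<lambda>m. (1 + (of_int m)\<^sup>2) powr r * (cmod (u m))\<^sup>2) summable_on UNIV"
    using assms(2) by (simp add: sobolev1_def)
  show "(\<lambda>m. ?c powr r * ((1 + (of_int (m + j))\<^sup>2) powr r * (cmod (u (m + j)))\<^sup>2)) summable_on UNIV"
    by (intro summable_on_cmult_right) (rule summable_shift[THEN iffD2, OF s])
  fix m
  have "(1 + (real_of_int m)\<^sup>2) powr r \<le> (?c * (1 + (of_int (m + j))\<^sup>2)) powr r"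
    by (rule powr_mono2[OF assms(1) _ weight_shift_le]) (simp add: add_nonneg_nonneg)
  also have "\<dots> = ?c powr r * (1 + (of_int (m + j))\<^sup>2) powr r"
    by (rule powr_mult; simp add: add_nonneg_nonneg)
  finally show "(1 + (real_of_int m)\<^sup>2) powr r * (cmod (u (m + j)))\<^sup>2 \<le>
      ?c powr r * ((1 + (of_int (m + j))\<^sup>2) powr r * (cmod (u (m + j)))\<^sup>2)"
    unfolding mult.assoc[symmetric] by (rule mult_right_mono) simp
qed simp

lemma sobolev1_C1:
  assumes "r \<ge> 0" "u \<in> sobolev1 r"
  shows "C1 k u \<in> sobolev1 r"
  unfolding sobolev1_def
proof (rule CollectI, rule summable_on_comparison_test)
  let ?g = "\<lambda>j m. (1 + (real_of_int m)\<^sup>2) powr r * (cmod (u (m + j)))\<^sup>2"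
  have "?g j summable_on UNIV" for j using sobolev1_shift[OF assms, of j] by (simp add: sobolev1_def)
  then show "(\<lambda>m. ?g (- k) m + ?g k m) summable_on UNIV" by (intro summable_on_add)
  fix m
  have "(cmod (C1 k u m))\<^sup>2 = (cmod (u (m + - k) + u (m + k)))\<^sup>2 / 4"
    by (simp add: C1_apply norm_divide power_divide)
  then have "(cmod (C1 k u m))\<^sup>2 \<le> (cmod (u (m + - k)))\<^sup>2 + (cmod (u (m + k)))\<^sup>2"
    using norm_add_square_le[of "u (m + - k)" "u (m + k)"]
      zero_le_power2[of "cmod (u (m + - k))"] zero_le_power2[of "cmod (u (m + k))"] by linarith
  then show "(1 + (real_of_int m)\<^sup>2) powr r * (cmod (C1 k u m))\<^sup>2 \<le> ?g (- k) m + ?g k m"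
    unfolding distrib_left[symmetric] by (intro mult_left_mono) auto
qed simp

text \<open>Bootstrapping in u = - (1 / \<nu>) D A u: B gains two orders of regularity, while A and
  C lose none.\<close>

lemma D1_A1_eigenvector_regular:
  assumes "n \<ge> 1" "u \<in> L2" "D1 k n (A1 k n u) = - of_real \<nu> *\<^sub>C u" "\<nu> > 0"
  shows "u \<in> sobolev1 r"
proof -
  have "u \<in> sobolev1 (2 * real p)" for p
  proof (induction p)
    case (Suc p)
    have "D1 k n (A1 k n u) \<in> sobolev1 (2 * real p + 2)"
      unfolding D1_def o_def
      by (intro sobolev1_C1 sobolev1_B1 sobolev1_A1 Suc.IH assms(1)) auto
    then have "(- of_real (1 / \<nu>)) *\<^sub>C D1 k n (A1 k n u) \<in> sobolev1 (2 * real p + 2)"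
      by (rule sobolev1_scaleC)
    moreover have "(- of_real (1 / \<nu>)) *\<^sub>C D1 k n (A1 k n u) = u"
      unfolding assms(3) using assms(4) by (simp add: fun_eq_iff scaleC_apply)
    ultimately show ?case by (simp add: algebra_simps)
  qed (use assms(2) in simp)
  moreover obtain p where "r \<le> real p" using real_arch_simple by blast
  then have "r \<le> 2 * real p" by simp
  ultimately show ?thesis using sobolev1_mono by blast
qed

subsection \<open>Closed spans of cosines\<close>

lemma sum_apply: "(\<Sum>i\<in>A. f i) x = (\<Sum>i\<in>A. f i x)"
  by (induction A rule: infinite_finite_induct) auto

text \<open>Truncating an even family to a symmetric window leaves a finite combination of cosines,
  and the error is a tail of the convergent weighted square sum.\<close>

lemma closed_span_fcosI:
  assumes J: "\<And>j. j \<in> J \<Longrightarrow> j \<ge> 0" and u: "u \<in> sobolev1 r" "reflect u = u"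
    and supp: "\<And>m. u m \<noteq> 0 \<Longrightarrow> \<bar>m\<bar> \<in> J"
  shows "u \<in> closed_span r (fcos ` J)"
  unfolding closed_span_def
proof (intro CollectI conjI allI impI u(1))
  fix e :: real assume e: "e > 0"
  let ?w = "\<lambda>m. (1 + (real_of_int m)\<^sup>2) powr r * (cmod (u m))\<^sup>2"
  have sym: "u (- m) = u m" for m using fun_cong[OF u(2), of m] by (simp add: reflect_def)
  have sw: "?w summable_on UNIV" using u(1) by (simp add: sobolev1_def)
  have "(sum ?w \<longlongrightarrow> infsum ?w UNIV) (finite_subsets_at_top UNIV)"
    using has_sum_infsum[OF sw] by (simp add: has_sum_def)
  then have "\<forall>\<^sub>F F in finite_subsets_at_top UNIV. dist (sum ?w F) (infsum ?w UNIV) < e\<^sup>2"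
    using e by (auto simp: tendsto_iff)
  then obtain F where F: "finite F"
    "\<And>G. finite G \<Longrightarrow> F \<subseteq> G \<Longrightarrow> dist (sum ?w G) (infsum ?w UNIV) < e\<^sup>2"
    unfolding eventually_finite_subsets_at_top by auto
  \<comment> \<open>The sum of absolute values is an upper bound for all of them that is defined for
    empty \<open>F\<close> as well.\<close>
  obtain N where N: "F \<subseteq> {- N..N}"
  proof
    show "F \<subseteq> {- (\<Sum>m\<in>F. \<bar>m\<bar>)..\<Sum>m\<in>F. \<bar>m\<bar>}"
    proof
      fix m assume "m \<in> F"
      then have "\<bar>m\<bar> \<le> (\<Sum>m\<in>F. \<bar>m\<bar>)" using F(1) by (intro member_le_sum) auto
      then show "m \<in> {- (\<Sum>m\<in>F. \<bar>m\<bar>)..\<Sum>m\<in>F. \<bar>m\<bar>}" by auto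
    qed
  qed
  \<comment> \<open>\<open>fcos j\<close> has the value 1/2 at j and at -j, but 1 at 0 when
    \<open>j = 0\<close>.\<close>
  define c where "c j = (if j = 0 then 1 else 2) * u j" for j :: int
  define v where "v = (\<Sum>j\<in>J \<inter> {0..N}. c j *\<^sub>C fcos j)"
  have vm: "v m = (if m \<in> {- N..N} then u m else 0)" for m
  proof -
    have "v m = (\<Sum>j\<in>J \<inter> {0..N}. c j * fcos j m)"
      unfolding v_def sum_apply scaleC_apply ..
    also have "\<dots> = (\<Sum>j\<in>J \<inter> {0..N}. if j = \<bar>m\<bar> then u m else 0)"
    proof (rule sum.cong)
      fix j assume "j \<in> J \<inter> {0..N}"
      then show "c j * fcos j m = (if j = \<bar>m\<bar> then u m else 0)"
        using sym[of m] by (auto simp: c_def fcos_eq abs_if)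
    qed simp
    also have "\<dots> = (if \<bar>m\<bar> \<in> J \<inter> {0..N} then u m else 0)"
      by (simp add: finite_Int)
    also have "\<dots> = (if m \<in> {- N..N} then u m else 0)"
      using supp[of m] by auto
    finally show ?thesis .
  qed
  have "v \<in> complex_span (fcos ` J)"
    unfolding v_def by (intro complex_vs.span_sum complex_vs.span_scale complex_vs.span_base) auto
  moreover have "sobolev_norm1 r (u - v) < e"
  proof -
    have "(\<Sum>\<^sub>\<infinity>m. (1 + (real_of_int m)\<^sup>2) powr r * (cmod ((u - v) m))\<^sup>2) =
        (\<Sum>\<^sub>\<infinity>m\<in>UNIV - {- N..N}. ?w m)"
      by (rule infsum_cong_neutral) (auto simp: vm)
    also have "\<dots> = infsum ?w UNIV - (\<Sum>m\<in>{- N..N}. ?w m)"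
      by (subst infsum_Diff[OF sw]) auto
    also have "\<dots> < e\<^sup>2"
      using F(2)[OF _ N] by (simp add: dist_real_def)
    finally show ?thesis
      unfolding sobolev_norm1_def using e real_sqrt_less_mono by fastforce
  qed
  ultimately show "\<exists>v\<in>complex_span (fcos ` J). sobolev_norm1 r (u - v) < e" by blast
qed

text \<open>Taking the coefficient at \<open>m\<close> is continuous on \<open>L2\<close> with norm
  at most 1, so its vanishing on S passes to the closed span.\<close>

lemma closed_span_0_supp:
  assumes u: "u \<in> closed_span 0 S"
    and S: "\<And>v. v \<in> S \<Longrightarrow> v \<in> L2 \<and> v m = 0"
  shows "u m = 0"
proof (rule ccontr)
  assume "u m \<noteq> 0"
  then have "cmod (u m) > 0" by simp
  then obtain v where v: "v \<in> complex_span S" "sobolev_norm1 0 (u - v) < cmod (u m)"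
    using u unfolding closed_span_def by blast
  have "v \<in> L2 \<and> v m = 0"
    using v(1)
  proof (induction rule: complex_vs.span_induct_alt)
    case base
    show ?case using L2_zero by (metis zero_fun_apply)
  next
    case (step c x y)
    then have "(c *\<^sub>C x + y) m = 0" using S[of x] by (simp add: scaleC_apply)
    moreover have "c *\<^sub>C x + y \<in> L2" using step S[of x] by (intro L2_add L2_scaleC) auto
    ultimately show ?case by blast
  qed
  moreover have "u \<in> L2" using u by (simp add: closed_span_def)
  ultimately have "u - v \<in> L2" "v m = 0"
    using L2_add[of u "(- 1) *\<^sub>C v"] L2_scaleC[of v "- 1"] by auto
  then show False
    using v(2) cmod_Rep_le_norm[of "Abs_ell2 (u - v)" m] by (simp add: norm_ell2_eq Abs_ell2_inverse)
qed

section \<open>Separated functions on the torus\<close>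

lemma fsin_eq: "fsin j m = ((if m = j then 1 else 0) - (if m = - j then 1 else 0)) / (2 * \<i>)"
proof -
  let ?e = "\<lambda>j x. exp (\<i> * of_int j * complex_of_real x)"
  have sin: "complex_of_real (sin (of_int j * x)) = (?e j x - ?e (- j) x) / (2 * \<i>)" for x
    by (simp only: sin_of_real[symmetric] of_real_mult of_real_of_int_eq sin_exp_eq) (simp add: mult.assoc)
  have eq: "complex_of_real (sin (of_int j * x)) * exp (- (\<i> * of_int m * of_real x)) =
      (?e j x * exp (- (\<i> * of_int m * of_real x)) - ?e (- j) x * exp (- (\<i> * of_int m * of_real x))) / (2 * \<i>)" for x
    unfolding sin by (simp add: algebra_simps diff_divide_distrib)
  have int: "(\<lambda>x. ?e l x * exp (- (\<i> * of_int m * of_real x))) integrable_on {0..2 * pi}" for l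
    by (intro integrable_continuous_interval continuous_intros)
  have "fsin j m = (fourier (?e j) m - fourier (?e (- j)) m) / (2 * \<i>)"
    unfolding fourier_def eq
    using int[of j] int[of "- j"] by (simp add: integral_diff diff_divide_distrib ring_distribs)
  then show ?thesis unfolding fourier_exp .
qed

lemma i_fcos: "n \<ge> 1 \<Longrightarrow> \<i> * of_int m * fcos n m = - of_int n * fsin n m"
  and i_fsin: "n \<ge> 1 \<Longrightarrow> \<i> * of_int m * fsin n m = of_int n * fcos n m"
  unfolding fcos_eq fsin_eq by (auto simp: field_simps)

lemma fcos_real: "real_valued (fcos n)"
  by (auto simp: real_valued_def fcos_eq)

lemma fsin_real: "real_valued (fsin n)"
  by (auto simp: real_valued_def fsin_eq)

lemma real_valued_tensor:
  "real_valued f \<Longrightarrow> real_valued g \<Longrightarrow> real_valued (tensor f g)"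
  by (auto simp: real_valued_def tensor_def)

lemma tensor_inject:
  assumes "tensor f g = tensor f' g" "g p \<noteq> 0"
  shows "f = f'"
proof
  fix m
  show "f m = f' m" using fun_cong[OF assms(1), of "(m, p)"] assms(2) by (simp add: tensor_def)
qed

lemma tensor_scaleC: "tensor (c *\<^sub>C f) g = c *\<^sub>C tensor f g"
  and tensor_diff: "tensor f g - tensor f' g = tensor (f - f') g"
  by (auto simp: fun_eq_iff tensor_def scaleC_apply algebra_simps)

lemma mult_tensor_fcos:
  "mult (tensor (fcos k) (fourier (\<lambda>x. 1))) u (m1, m2) = (u (m1 - k, m2) + u (m1 + k, m2)) / 2"
proof -
  have one: "fourier (\<lambda>x. 1) m = (if m = 0 then 1 else 0)" for m
    using fourier_exp[of 0 m] by simp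
  have "mult (tensor (fcos k) (fourier (\<lambda>x. 1))) u (m1, m2) =
      (\<Sum>\<^sub>\<infinity>i\<in>(\<lambda>j. (j, 0)) ` {k, - k}. tensor (fcos k) (fourier (\<lambda>x. 1)) i * u ((m1, m2) - i))"
    unfolding mult_def by (rule infsum_cong_neutral) (auto simp: fcos_eq tensor_def one split: if_splits)
  also have "\<dots> = (u (m1 - k, m2) + u (m1 + k, m2)) / 2"
    by (cases "k = 0") (auto simp: fcos_eq tensor_def one add_divide_distrib)
  finally show ?thesis .
qed

lemma mult_fcos_tensor:
  "mult (tensor (fcos k) (fourier (\<lambda>x. 1))) (tensor f g) = tensor (C1 k f) g"
proof
  fix m :: "int \<times> int"
  show "mult (tensor (fcos k) (fourier (\<lambda>x. 1))) (tensor f g) m = tensor (C1 k f) g m"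
  proof (cases m)
    case (Pair m1 m2)
    show ?thesis unfolding Pair mult_tensor_fcos by (simp add: tensor_def C1_apply algebra_simps add_divide_distrib)
  qed
qed

lemma fcos_nonzero: "fcos n m \<noteq> 0 \<Longrightarrow> m = n \<or> m = - n"
  and fsin_nonzero: "fsin n m \<noteq> 0 \<Longrightarrow> m = n \<or> m = - n"
  by (auto simp: fcos_eq fsin_eq split: if_splits)

lemma fcos_n: "n \<ge> 1 \<Longrightarrow> fcos n n \<noteq> 0"
  and fsin_n: "n \<ge> 1 \<Longrightarrow> fsin n n \<noteq> 0"
  by (auto simp: fcos_eq fsin_eq)

text \<open>On the support of \<open>fcos n\<close> the squared transverse frequency is n^2, so the
  two-dimensional multiplier becomes that of \<open>A1\<close>; the derivative turns cos (n x_2)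
  into - n sin (n x_2).\<close>

lemma dx2_A_op_tensor:
  assumes n: "n \<ge> 1"
  shows "dx2 (A_op k (tensor f (fcos n))) = - of_int n *\<^sub>C tensor (A1 k n f) (fsin n)"
proof
  fix m :: "int \<times> int"
  obtain m1 m2 where m: "m = (m1, m2)" by fastforce
  have "(\<i> * of_int m2 * fcos n m2) * (f m1 - of_int (1 + k\<^sup>2) * (f m1 / of_int (1 + m1\<^sup>2 + m2\<^sup>2))) =
      (- of_int n * fsin n m2) * A1 k n f m1"
  proof (cases "fcos n m2 = 0")
    case True
    then show ?thesis using i_fcos[OF n, of m2] n by auto
  next
    case False
    then have m2: "m2\<^sup>2 = n\<^sup>2" using fcos_nonzero by fastforce
    have "1 + m1\<^sup>2 + n\<^sup>2 > 0" by (simp add: add_pos_nonneg)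
    then have "(of_int (1 + m1\<^sup>2 + n\<^sup>2) :: complex) \<noteq> 0" by (simp only: of_int_eq_0_iff)
    moreover have "of_int (m1\<^sup>2 + n\<^sup>2 - k\<^sup>2) = (of_int (1 + m1\<^sup>2 + n\<^sup>2) - of_int (1 + k\<^sup>2) :: complex)"
      by simp
    ultimately have "A1 k n f m1 = f m1 - of_int (1 + k\<^sup>2) * (f m1 / of_int (1 + m1\<^sup>2 + m2\<^sup>2))"
      unfolding A1_def m2 add.commute[of _ 1] add.assoc[symmetric]
      by (simp only: diff_divide_distrib left_diff_distrib divide_self) simp
    then show ?thesis unfolding i_fcos[OF n] by simp
  qed
  moreover have "\<i> * q * (F * c - K * (F * c / D)) = \<i> * q * c * (F - K * (F / D))" for q F c K D :: complex
    by (simp add: algebra_simps)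
  ultimately show "dx2 (A_op k (tensor f (fcos n))) m = (- of_int n *\<^sub>C tensor (A1 k n f) (fsin n)) m"
    unfolding m
    by (simp only: dx2_def A_op_def resolvent_lap_def tensor_def prod.case minus_apply scaleC_apply) (simp only: mult_ac)
qed

lemma dx2_B_op_tensor:
  assumes n: "n \<ge> 1"
  shows "dx2 (B_op k (tensor h (fsin n))) = of_int n *\<^sub>C tensor (B1 k n h) (fcos n)"
proof
  fix m :: "int \<times> int"
  obtain m1 m2 where m: "m = (m1, m2)" by fastforce
  have "(\<i> * of_int m2 * fsin n m2) * (of_int (1 + k\<^sup>2) * (h m1 / of_int (m1\<^sup>2 + m2\<^sup>2))) =
      (of_int n * fcos n m2) * B1 k n h m1"
  proof (cases "fsin n m2 = 0")
    case True
    then show ?thesis using i_fsin[OF n, of m2] n by auto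
  next
    case False
    then have m2: "m2\<^sup>2 = n\<^sup>2" using fsin_nonzero by fastforce
    show ?thesis unfolding i_fsin[OF n] B1_def m2 by simp
  qed
  \<comment> \<open>The mean is the mode at which \<open>inverse_lap\<close> is set to 0 by
    convention; here the family vanishes there, so the general formula holds at every
    frequency.\<close>
  moreover have "fsin n 0 = 0" using fsin_nonzero n by force
  then have "B_op k (tensor h (fsin n)) (m1, m2) =
      of_int (1 + k\<^sup>2) * (h m1 * fsin n m2 / of_int (m1\<^sup>2 + m2\<^sup>2))"
    by (cases "m2 = 0") (simp_all add: B_op_def inverse_lap_def tensor_def scaleC_apply)
  moreover have "\<i> * q * (K * (H * c / D)) = \<i> * q * c * (K * (H / D))" for q H c K D :: complex
    by (simp add: algebra_simps)
  ultimately show "dx2 (B_op k (tensor h (fsin n))) m = (of_int n *\<^sub>C tensor (B1 k n h) (fcos n)) m"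
    unfolding m by (simp only: dx2_def tensor_def prod.case scaleC_apply) (simp only: mult_ac)
qed

lemma L_op_tensor:
  assumes n: "n \<ge> 1"
  shows "L_op k (tensor h (fsin n), tensor f (fcos n)) =
    (tensor (of_int (n * k) *\<^sub>C C1 k (A1 k n f)) (fsin n),
     tensor (- of_int (n * k) *\<^sub>C C1 k (B1 k n h)) (fcos n))"
proof -
  have "- of_int k * - of_int n = (of_int (n * k) :: complex)" "- of_int k * of_int n = (- of_int (n * k) :: complex)"
    by simp_all
  then show ?thesis
    unfolding L_op_def dx2_A_op_tensor[OF n] dx2_B_op_tensor[OF n] prod.case tensor_scaleC[symmetric]
      mult_fcos_tensor C1_scaleC scaleC_scaleC by (simp only:)
qed

text \<open>The candidate eigenvector for \<mu> with second component f: the first row of the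
  eigenvalue equation forces h = (n k / \<mu>) C A f.\<close>

definition mode :: "int \<Rightarrow> int \<Rightarrow> real \<Rightarrow> dist1 \<Rightarrow> dist2 \<times> dist2" where
  "mode k n \<mu> f = (tensor (of_real (of_int (n * k) / \<mu>) *\<^sub>C C1 k (A1 k n f)) (fsin n), tensor f (fcos n))"

lemma mode_scaleC: "mode k n \<mu> (c *\<^sub>C f) = c *\<^sub>C mode k n \<mu> f"
  by (simp add: mode_def A1_scaleC C1_scaleC scaleC_prod_def scaleC_scaleC mult_ac flip: tensor_scaleC)

subsection \<open>Function spaces on the torus\<close>

lemma slice_summable: "F summable_on range (\<lambda>m. (m, p)) \<longleftrightarrow> (\<lambda>m. F (m, p)) summable_on UNIV"
  using summable_on_reindex[of "\<lambda>m. (m, p)" UNIV F] by (simp add: inj_on_def o_def)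

lemma summable_two_slices:
  fixes F :: "int \<times> int \<Rightarrow> real"
  assumes "(\<lambda>m. F (m, p)) summable_on UNIV" "(\<lambda>m. F (m, q)) summable_on UNIV"
    and zero: "\<And>m l. l \<noteq> p \<Longrightarrow> l \<noteq> q \<Longrightarrow> F (m, l) = 0"
  shows "F summable_on UNIV"
proof -
  let ?S = "range (\<lambda>m :: int. (m, p)) \<union> range (\<lambda>m. (m, q))"
  have "F summable_on ?S"
    using assms(1,2) by (intro summable_on_union) (simp_all only: slice_summable)
  moreover have "F summable_on ?S \<longleftrightarrow> F summable_on UNIV"
  proof (rule summable_on_cong_neutral)
    fix z assume z: "z \<in> UNIV - ?S"
    obtain m l where "z = (m, l)" by fastforce
    with z show "F z = 0" using zero[of l m] by auto
  qed simp_all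
  ultimately show ?thesis by simp
qed

lemma tensor_sobolev2I:
  assumes "r \<ge> 0" "f \<in> sobolev1 r" "\<And>p. g p \<noteq> 0 \<Longrightarrow> p = n \<or> p = - n"
  shows "tensor f g \<in> sobolev2 r"
proof -
  let ?F = "\<lambda>(m1, m2). (1 + (real_of_int m1)\<^sup>2 + (of_int m2)\<^sup>2) powr r * (cmod (tensor f g (m1, m2)))\<^sup>2"
  have slice: "(\<lambda>m. ?F (m, p)) summable_on UNIV" for p
  proof -
    let ?c = "(1 + (real_of_int p)\<^sup>2) powr r * (cmod (g p))\<^sup>2"
    show ?thesis
    proof (rule summable_on_comparison_test)
      show "(\<lambda>m. ?c * ((1 + (of_int m)\<^sup>2) powr r * (cmod (f m))\<^sup>2)) summable_on UNIV"
        using assms(2) by (intro summable_on_cmult_right) (simp add: sobolev1_def)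
      fix m
      have "1 + (real_of_int m)\<^sup>2 + (of_int p)\<^sup>2 \<le> (1 + (of_int p)\<^sup>2) * (1 + (of_int m)\<^sup>2)"
        by (simp add: algebra_simps)
      then have "(1 + (real_of_int m)\<^sup>2 + (of_int p)\<^sup>2) powr r \<le> ((1 + (of_int p)\<^sup>2) * (1 + (of_int m)\<^sup>2)) powr r"
        using assms(1) by (intro powr_mono2) (auto simp: add_nonneg_nonneg)
      also have "\<dots> = (1 + (of_int p)\<^sup>2) powr r * (1 + (of_int m)\<^sup>2) powr r"
        by (rule powr_mult; simp add: add_nonneg_nonneg)
      finally have "(1 + (real_of_int m)\<^sup>2 + (of_int p)\<^sup>2) powr r * (cmod (f m * g p))\<^sup>2 \<le>
          (1 + (of_int p)\<^sup>2) powr r * (1 + (of_int m)\<^sup>2) powr r * (cmod (f m * g p))\<^sup>2"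
        by (rule mult_right_mono) simp
      also have "\<dots> = ?c * ((1 + (of_int m)\<^sup>2) powr r * (cmod (f m))\<^sup>2)"
        by (simp only: norm_mult power_mult_distrib mult_ac)
      finally show "?F (m, p) \<le> ?c * ((1 + (of_int m)\<^sup>2) powr r * (cmod (f m))\<^sup>2)"
        by (simp only: tensor_def prod.case)
    qed simp
  qed
  have "?F summable_on UNIV"
  proof (rule summable_two_slices[OF slice slice])
    fix m l assume "l \<noteq> n" "l \<noteq> - n"
    then have "g l = 0" using assms(3) by blast
    then show "?F (m, l) = 0" by (simp add: tensor_def)
  qed
  then show ?thesis by (simp add: sobolev2_def)
qed

lemma tensor_sobolev2D:
  assumes "tensor f g \<in> sobolev2 r" "g p \<noteq> 0"
  shows "(\<lambda>m. (1 + (of_int m)\<^sup>2 + (of_int p)\<^sup>2) powr r * (cmod (f m))\<^sup>2) summable_on UNIV"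
proof -
  define F where "F = (\<lambda>(m1, m2). (1 + (real_of_int m1)\<^sup>2 + (of_int m2)\<^sup>2) powr r * (cmod (tensor f g (m1, m2)))\<^sup>2)"
  have "F summable_on UNIV" using assms(1) by (simp add: sobolev2_def F_def)
  then have "F summable_on range (\<lambda>m. (m, p))" by (rule summable_on_subset_banach) simp
  then have "(\<lambda>m. F (m, p)) summable_on UNIV" by (simp only: slice_summable)
  then have "(\<lambda>m. (1 / (cmod (g p))\<^sup>2) * F (m, p)) summable_on UNIV"
    by (rule summable_on_cmult_right)
  moreover have "(\<lambda>m. (1 / (cmod (g p))\<^sup>2) * F (m, p)) =
      (\<lambda>m. (1 + (of_int m)\<^sup>2 + (of_int p)\<^sup>2) powr r * (cmod (f m))\<^sup>2)"
    using assms(2) by (simp add: F_def tensor_def norm_mult power_mult_distrib)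
  ultimately show ?thesis by (simp only:)
qed

lemma sobolev2_mono:
  assumes "r \<le> r'" "u \<in> sobolev2 r'"
  shows "u \<in> sobolev2 r"
proof -
  have "(\<lambda>m. (1 + (of_int (fst m))\<^sup>2 + (of_int (snd m))\<^sup>2) powr r * (cmod (u m))\<^sup>2) summable_on UNIV"
  proof (rule summable_on_comparison_test)
    show "(\<lambda>m. (1 + (of_int (fst m))\<^sup>2 + (of_int (snd m))\<^sup>2) powr r' * (cmod (u m))\<^sup>2) summable_on UNIV"
      using assms(2) by (simp add: sobolev2_def case_prod_unfold)
    fix m
    have "1 \<le> 1 + (real_of_int (fst m))\<^sup>2 + (of_int (snd m))\<^sup>2" by simp
    then show "(1 + (real_of_int (fst m))\<^sup>2 + (of_int (snd m))\<^sup>2) powr r * (cmod (u m))\<^sup>2 \<le>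
        (1 + (of_int (fst m))\<^sup>2 + (of_int (snd m))\<^sup>2) powr r' * (cmod (u m))\<^sup>2"
      using assms(1) by (intro mult_right_mono powr_mono) simp_all
  qed simp
  then show ?thesis by (simp add: sobolev2_def case_prod_unfold)
qed

lemma tensor_sobolev2_L2:
  assumes "tensor f g \<in> sobolev2 r" "g p \<noteq> 0" "r \<ge> 0"
  shows "f \<in> L2"
  unfolding L2_iff
proof (rule summable_on_comparison_test[OF tensor_sobolev2D[OF assms(1,2)]])
  fix m
  have "1 \<le> (1 + (real_of_int m)\<^sup>2 + (of_int p)\<^sup>2) powr r"
    using assms(3) by (intro ge_one_powr_ge_zero) auto
  then show "(cmod (f m))\<^sup>2 \<le> (1 + (of_int m)\<^sup>2 + (of_int p)\<^sup>2) powr r * (cmod (f m))\<^sup>2"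
    using mult_right_mono[of 1 _ "(cmod (f m))\<^sup>2"] by simp
qed simp

text \<open>For \<open>s = 0\<close> the first component lies only in H^(-1), so \<open>h\<close>
  need not be square summable. The two orders gained by B compensate for this.\<close>

lemma tensor_sobolev2_B1:
  assumes "tensor h g \<in> sobolev2 r" "g n \<noteq> 0" "r \<ge> - 1" "n \<ge> 1"
  shows "B1 k n h \<in> L2"
  unfolding L2_iff
proof (rule summable_on_comparison_test)
  let ?c = "2 * (1 + (real_of_int k)\<^sup>2)"
  show "(\<lambda>m. ?c\<^sup>2 * ((1 + (of_int m)\<^sup>2 + (of_int n)\<^sup>2) powr r * (cmod (h m))\<^sup>2)) summable_on UNIV"
    by (intro summable_on_cmult_right tensor_sobolev2D[OF assms(1,2)])
  fix m
  let ?w = "1 + (real_of_int m)\<^sup>2 + (of_int n)\<^sup>2"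
  have w: "?w \<ge> 1" by simp
  have b: "0 < b_coeff k n m" "b_coeff k n m \<le> ?c / ?w"
    using b_coeff_bounds(1)[OF assms(4)] b_coeff_decay(1)[OF assms(4)] by auto
  have "(b_coeff k n m)\<^sup>2 \<le> (?c / ?w)\<^sup>2" using b by (intro power_mono) auto
  also have "\<dots> = ?c\<^sup>2 * ?w powr - 2"
    using w by (simp add: power_mult_distrib power_inverse powr_minus divide_inverse)
  also have "\<dots> \<le> ?c\<^sup>2 * ?w powr r"
    using w assms(3) by (intro mult_left_mono powr_mono) auto
  finally have "(b_coeff k n m)\<^sup>2 * (cmod (h m))\<^sup>2 \<le> ?c\<^sup>2 * ?w powr r * (cmod (h m))\<^sup>2"
    by (rule mult_right_mono) simp
  then show "(cmod (B1 k n h m))\<^sup>2 \<le> ?c\<^sup>2 * (?w powr r * (cmod (h m))\<^sup>2)"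
    by (simp add: B1_eq_diag diag_def norm_mult power_mult_distrib mult.assoc)
qed simp

lemma cis_int_pi: "cis (of_int j * pi) = (if even j then 1 else - 1)"
  using cos_npi_int[of j] sin_npi_int[of j] by (simp add: complex_eq_iff mult.commute)

text \<open>Translation by 2 pi / k multiplies the coefficient at \<open>m\<close> by exp (2 pi i m
  / k), which equals 1 only for multiples of \<open>k\<close>.\<close>

lemma translate1_periodic:
  assumes "translate1 (2 * pi / of_int k) (tensor f g) = tensor f g" "g p \<noteq> 0" "k \<ge> 1" "f m \<noteq> 0"
  shows "k dvd m"
proof -
  have "cis (of_int m * (2 * pi / of_int k)) * (f m * g p) = f m * g p"
    using fun_cong[OF assms(1), of "(m, p)"] by (simp add: translate1_def tensor_def)
  then have "cis (of_int m * (2 * pi / of_int k)) = 1" using assms(2,4) by simp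
  then have "cos (of_int m * (2 * pi / of_int k)) = 1" by (simp add: complex_eq_iff)
  then obtain j :: int where "of_int m * (2 * pi / of_int k) = of_int j * 2 * pi"
    using cos_one_2pi_int by blast
  then have "real_of_int m = of_int j * of_int k" using assms(3) by (simp add: field_simps)
  then have "m = j * k" by (simp only: of_int_mult[symmetric] of_int_eq_iff)
  then show ?thesis by simp
qed

section \<open>Eigenvectors in the transverse block\<close>

text \<open>Uniqueness and simplicity rest on these facts alone, which hold in the whole block;
  hence simplicity is obtained there and not merely in the cosine chain.\<close>

lemma transverse_blockD:
  assumes "w \<in> transverse_block s k n" "s \<ge> 0" "k \<ge> 1" "n \<ge> 1"
  obtains h f where "w = (tensor h (fsin n), tensor f (fcos n))" "f \<in> L2" "B1 k n h \<in> L2"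
    "\<And>m. f m \<noteq> 0 \<Longrightarrow> k dvd m"
proof -
  obtain h f where w: "w = (tensor h (fsin n), tensor f (fcos n))" and X: "w \<in> X_sym s k"
    using assms(1) by (auto simp: transverse_block_def)
  have sob: "tensor h (fsin n) \<in> sobolev2 (s - 1)" "tensor f (fcos n) \<in> sobolev2 s"
    and per: "translate1 (2 * pi / of_int k) (tensor f (fcos n)) = tensor f (fcos n)"
    using X by (auto simp: w X_sym_def X_space_def)
  show thesis
  proof
    show "f \<in> L2" using tensor_sobolev2_L2[OF sob(2) fcos_n] assms by simp
    show "B1 k n h \<in> L2" using tensor_sobolev2_B1[OF sob(1) fsin_n] assms by simp
    show "k dvd m" if "f m \<noteq> 0" for m
      using translate1_periodic[OF per fcos_n] assms that by simp
  qed (rule w)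
qed

lemma cosine_chain_subset: "cosine_chain s k n \<subseteq> transverse_block s k n"
  by (auto simp: cosine_chain_def)

lemma scaleC_pair: "c *\<^sub>C (u, v) = (c *\<^sub>C u, c *\<^sub>C v)"
  by (simp add: scaleC_prod_def)

lemma scaleC_cancel:
  assumes "a *\<^sub>C u = b *\<^sub>C (v :: dist1)" "b \<noteq> 0"
  shows "v = (a / b) *\<^sub>C u"
proof
  fix m
  have "a * u m = b * v m" using fun_cong[OF assms(1), of m] by (simp add: scaleC_apply)
  then show "v m = ((a / b) *\<^sub>C u) m" using assms(2) by (simp add: scaleC_apply field_simps)
qed

context chain_problem
begin

lemma nk: "of_int (n * k) > (0::real)"
  using k n by simp

text \<open>Cancelling the transverse factors at frequency \<open>n\<close> works for arbitrary
  families, so the lemma also applies to the image vector \<open>T w\<close> in a Jordan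
  chain.\<close>

lemma L_op_eigenD:
  assumes "\<mu> > 0"
    and L: "L_op k (tensor h (fsin n), tensor f (fcos n)) = of_real \<mu> *\<^sub>C (tensor h (fsin n), tensor f (fcos n))"
  shows "h = of_real (of_int (n * k) / \<mu>) *\<^sub>C C1 k (A1 k n f)"
    and "D1 k n (A1 k n f) = - of_real ((\<mu> / of_int (n * k))\<^sup>2) *\<^sub>C f"
    and "C1 k (B1 k n h) = - of_real (\<mu> / of_int (n * k)) *\<^sub>C f"
proof -
  let ?N = "of_int (n * k) :: complex"
  have N: "?N \<noteq> 0" using nk by (metis of_int_0_eq_iff of_int_eq_0_iff less_irrefl)
  have L1: "tensor (?N *\<^sub>C C1 k (A1 k n f)) (fsin n) = tensor (of_real \<mu> *\<^sub>C h) (fsin n)"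
    and L2: "tensor ((- ?N) *\<^sub>C C1 k (B1 k n h)) (fcos n) = tensor (of_real \<mu> *\<^sub>C f) (fcos n)"
    using L unfolding L_op_tensor[OF n] scaleC_pair tensor_scaleC[symmetric] prod.inject by (rule conjunct1, rule conjunct2)
  have 1: "?N *\<^sub>C C1 k (A1 k n f) = of_real \<mu> *\<^sub>C h"
    by (rule tensor_inject[OF L1 fsin_n[OF n]])
  have 2: "(- ?N) *\<^sub>C C1 k (B1 k n h) = of_real \<mu> *\<^sub>C f"
    by (rule tensor_inject[OF L2 fcos_n[OF n]])
  show h: "h = of_real (of_int (n * k) / \<mu>) *\<^sub>C C1 k (A1 k n f)"
    using scaleC_cancel[OF 1] assms(1) by simp
  have CA: "C1 k (A1 k n f) = (of_real \<mu> / ?N) *\<^sub>C h"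
    using scaleC_cancel[OF 1[symmetric] N] .
  have "C1 k (B1 k n h) = (of_real \<mu> / - ?N) *\<^sub>C f"
    using scaleC_cancel[OF 2[symmetric]] N by simp
  then show CB: "C1 k (B1 k n h) = - of_real (\<mu> / of_int (n * k)) *\<^sub>C f" by simp
  have "D1 k n (A1 k n f) = (of_real \<mu> / ?N) *\<^sub>C C1 k (B1 k n h)"
    by (simp only: D1_def o_apply CA B1_scaleC C1_scaleC)
  also have "\<dots> = - of_real ((\<mu> / of_int (n * k))\<^sup>2) *\<^sub>C f"
    unfolding CB scaleC_scaleC by (simp add: power2_eq_square)
  finally show "D1 k n (A1 k n f) = - of_real ((\<mu> / of_int (n * k))\<^sup>2) *\<^sub>C f" .
qed

lemma block_eigenvectorD:
  assumes "s \<ge> 0" "\<mu> > 0" "eigenvector (L_op k) (transverse_block s k n) (of_real \<mu>) w"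
  obtains f where "w = mode k n \<mu> f" "f \<in> L2" "f \<noteq> 0" "\<And>m. f m \<noteq> 0 \<Longrightarrow> k dvd m"
    "D1 k n (A1 k n f) = - of_real ((\<mu> / of_int (n * k))\<^sup>2) *\<^sub>C f"
proof -
  have V: "w \<in> transverse_block s k n" and w0: "w \<noteq> 0" and L: "L_op k w = of_real \<mu> *\<^sub>C w"
    using assms(3) by (auto simp: eigenvector_def)
  obtain h f where w: "w = (tensor h (fsin n), tensor f (fcos n))" and f: "f \<in> L2"
    "\<And>m. f m \<noteq> 0 \<Longrightarrow> k dvd m"
    using transverse_blockD[OF V assms(1) k n] by metis
  note eig = L_op_eigenD[OF assms(2) L[unfolded w]]
  have mode: "w = mode k n \<mu> f" unfolding w mode_def using eig(1) by simp
  show thesis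
  proof
    show "f \<noteq> 0"
    proof
      assume "f = 0"
      then have "w = 0 *\<^sub>C mode k n \<mu> f" using mode mode_scaleC[of k n \<mu> 0 f] by simp
      then show False using w0 by simp
    qed
  qed (use mode f eig in auto)
qed

lemma L_op_mode:
  assumes "D1 k n (A1 k n f) = - of_real \<nu> *\<^sub>C f" "\<nu> > 0" "\<mu> = of_int (n * k) * sqrt \<nu>"
  shows "L_op k (mode k n \<mu> f) = of_real \<mu> *\<^sub>C mode k n \<mu> f"
proof -
  let ?N = "of_int (n * k) :: complex" and ?c = "complex_of_real (of_int (n * k) / \<mu>)"
  have \<mu>: "\<mu> > 0" using assms nk by simp
  have sq: "\<mu> * \<mu> = of_int (n * k) * of_int (n * k) * \<nu>" using assms(2,3) by (simp add: mult_ac)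
  have c1: "?N = of_real \<mu> * ?c" using \<mu> by simp
  have c2: "- ?N * ?c * - of_real \<nu> = of_real \<mu>"
  proof -
    have "of_int (n * k) * (of_int (n * k) / \<mu>) * \<nu> = \<mu>"
      using \<mu> sq by (simp add: field_simps)
    then have "complex_of_real (of_int (n * k) * (of_int (n * k) / \<mu>) * \<nu>) = of_real \<mu>" by (simp only:)
    then show ?thesis by simp
  qed
  have "C1 k (B1 k n (?c *\<^sub>C C1 k (A1 k n f))) = ?c *\<^sub>C D1 k n (A1 k n f)"
    by (simp only: B1_scaleC C1_scaleC D1_def o_apply)
  then have "(- ?N) *\<^sub>C C1 k (B1 k n (?c *\<^sub>C C1 k (A1 k n f))) = of_real \<mu> *\<^sub>C f"
    by (simp only: assms(1) scaleC_scaleC mult.assoc[symmetric] c2)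
  moreover have "?N *\<^sub>C C1 k (A1 k n f) = of_real \<mu> *\<^sub>C ?c *\<^sub>C C1 k (A1 k n f)"
    unfolding scaleC_scaleC by (subst c1) (rule refl)
  ultimately show ?thesis
    unfolding mode_def L_op_tensor[OF n] scaleC_pair tensor_scaleC[symmetric] by (simp only:)
qed

text \<open>The phases express that x -> pi / k - x fixes cos (2 j k x) and, in
  \<open>odd_supp_cis\<close>, changes the sign of cos ((2 j + 1) k x): the parities required of F
  and of the first component.\<close>

lemma even_supp_cis:
  assumes "2 * k dvd m"
  shows "cis (of_int m * (2 * pi / of_int k)) = 1" "cis (- (of_int m * (pi / of_int k))) = 1"
proof -
  obtain q where q: "m = 2 * k * q" using assms by blast
  have "of_int m * (2 * pi / of_int k) = of_int (4 * q) * pi" "- (of_int m * (pi / of_int k)) = of_int (- (2 * q)) * pi"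
    using k by (simp_all add: q algebra_simps)
  then show "cis (of_int m * (2 * pi / of_int k)) = 1" "cis (- (of_int m * (pi / of_int k))) = 1"
    by (simp_all only: cis_int_pi) simp_all
qed

lemma odd_supp_cis:
  assumes "2 * k dvd m + k"
  shows "cis (of_int m * (2 * pi / of_int k)) = 1" "cis (- (of_int m * (pi / of_int k))) = - 1"
proof -
  obtain q where "m + k = 2 * k * q" using assms by blast
  then have q: "m = (2 * q - 1) * k" by (simp add: algebra_simps)
  have "of_int m * (2 * pi / of_int k) = of_int (2 * (2 * q - 1)) * pi" "- (of_int m * (pi / of_int k)) = of_int (1 - 2 * q) * pi"
    using k by (simp_all add: q algebra_simps)
  then show "cis (of_int m * (2 * pi / of_int k)) = 1" "cis (- (of_int m * (pi / of_int k))) = - 1"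
    by (simp_all only: cis_int_pi) simp_all
qed

lemma cosine_chainI:
  assumes s: "s \<ge> 0" and f: "f \<in> sobolev1 s" "reflect f = f" "\<And>m. f m \<noteq> 0 \<Longrightarrow> 2 * k dvd m"
    and h: "h \<in> sobolev1 s" "reflect h = h" "\<And>m. h m \<noteq> 0 \<Longrightarrow> 2 * k dvd m + k"
  shows "(tensor h (fsin n), tensor f (fcos n)) \<in> cosine_chain s k n"
proof -
  have rf: "f (- m) = f m" and rh: "h (- m) = h m" for m
    using fun_cong[OF f(2), of m] fun_cong[OF h(2), of m] by (simp_all add: reflect_def)
  have fs: "fsin n (- m) = - fsin n m" and fc: "fcos n (- m) = fcos n m" for m
    by (auto simp: fsin_eq fcos_eq)
  \<comment> \<open>\<open>h\<close> is taken in H^s and lowered to H^(s-1), because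
    \<open>tensor_sobolev2I\<close> requires a nonnegative order and \<open>s - 1\<close> may be
    negative.\<close>
  have h1: "h \<in> sobolev1 (s - 1)" using h(1) by (rule sobolev1_mono[rotated]) simp
  have "tensor h (fsin n) \<in> sobolev2 s" "tensor f (fcos n) \<in> sobolev2 s"
    by (rule tensor_sobolev2I[OF s h(1), of _ n], erule fsin_nonzero,
        rule tensor_sobolev2I[OF s f(1), of _ n], erule fcos_nonzero)
  moreover from this(1) have "tensor h (fsin n) \<in> sobolev2 (s - 1)"
    by (rule sobolev2_mono[rotated]) simp
  moreover have "fsin n 0 = 0" using fsin_nonzero[of n 0] n by linarith
  ultimately have X: "(tensor h (fsin n), tensor f (fcos n)) \<in> X_space s"
    by (simp add: X_space_def tensor_def)
  have ch: "cis (of_int m * (2 * pi / of_int k)) * h m = h m" "cis (- (of_int m * (pi / of_int k))) * h m = - h m" for m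
  proof -
    have "h m = 0 \<or> cis (of_int m * (2 * pi / of_int k)) = 1 \<and> cis (- (of_int m * (pi / of_int k))) = - 1"
      using odd_supp_cis[OF h(3)[of m]] by blast
    then show "cis (of_int m * (2 * pi / of_int k)) * h m = h m"
      "cis (- (of_int m * (pi / of_int k))) * h m = - h m"
      by (elim disjE conjE; simp only: mult_zero_right minus_zero mult_1 mult_minus1)+
  qed
  have cf: "cis (of_int m * (2 * pi / of_int k)) * f m = f m" "cis (- (of_int m * (pi / of_int k))) * f m = f m" for m
  proof -
    have "f m = 0 \<or> cis (of_int m * (2 * pi / of_int k)) = 1 \<and> cis (- (of_int m * (pi / of_int k))) = 1"
      using even_supp_cis[OF f(3)[of m]] by blast
    then show "cis (of_int m * (2 * pi / of_int k)) * f m = f m"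
      "cis (- (of_int m * (pi / of_int k))) * f m = f m"
      by (elim disjE conjE; simp only: mult_zero_right mult_1)+
  qed
  have sym: "(tensor h (fsin n), tensor f (fcos n)) \<in> X_sym s k"
    unfolding X_sym_def
  proof (intro CollectI case_prodI conjI X)
    show "translate1 (2 * pi / of_int k) (tensor h (fsin n)) = tensor h (fsin n)"
      unfolding translate1_def tensor_def by (rule ext) (simp only: case_prod_unfold mult.assoc[symmetric] fst_conv snd_conv ch)
    show "translate1 (2 * pi / of_int k) (tensor f (fcos n)) = tensor f (fcos n)"
      unfolding translate1_def tensor_def by (rule ext) (simp only: case_prod_unfold mult.assoc[symmetric] fst_conv snd_conv cf)
    show "reflect1 (translate1 (pi / of_int k) (tensor h (fsin n))) = - tensor h (fsin n)"
      unfolding translate1_def tensor_def reflect1_def by (rule ext)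
        (simp only: case_prod_unfold fst_conv snd_conv rh of_int_minus mult_minus_left mult.assoc[symmetric] ch uminus_apply)
    show "reflect1 (translate1 (pi / of_int k) (tensor f (fcos n))) = tensor f (fcos n)"
      unfolding translate1_def tensor_def reflect1_def by (rule ext)
        (simp only: case_prod_unfold fst_conv snd_conv rf of_int_minus mult_minus_left mult.assoc[symmetric] cf)
    show "reflect2 (tensor h (fsin n)) = - tensor h (fsin n)"
      unfolding tensor_def reflect2_def by (rule ext) (simp only: case_prod_unfold fs fst_conv snd_conv uminus_apply mult_minus_right)
    show "reflect2 (tensor f (fcos n)) = tensor f (fcos n)"
      unfolding tensor_def reflect2_def by (rule ext) (simp only: case_prod_unfold fc fst_conv snd_conv)
  qed
  have Jf: "{fcos (2 * j * k) |j. j \<ge> 0} = fcos ` {2 * j * k |j. j \<ge> 0}"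
    and Jh: "{fcos ((2 * j + 1) * k) |j. j \<ge> 0} = fcos ` {(2 * j + 1) * k |j. j \<ge> 0}"
    by blast+
  have "f \<in> closed_span s (fcos ` {2 * j * k |j. j \<ge> 0})"
  proof (rule closed_span_fcosI[OF _ f(1,2)])
    fix m assume "f m \<noteq> 0"
    then obtain q where "m = 2 * k * q" using f(3) by blast
    then have "\<bar>m\<bar> = 2 * \<bar>q\<bar> * k" using k by (simp add: abs_mult)
    then show "\<bar>m\<bar> \<in> {2 * j * k |j. j \<ge> 0}" using abs_ge_zero by blast
  qed (use k in auto)
  moreover have "h \<in> closed_span (s - 1) (fcos ` {(2 * j + 1) * k |j. j \<ge> 0})"
  proof (rule closed_span_fcosI[OF _ h1 h(2)])
    fix m assume "h m \<noteq> 0"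
    then obtain q where "m + k = 2 * k * q" using h(3) by blast
    then have m: "m = (2 * q - 1) * k" by (simp add: algebra_simps)
    \<comment> \<open>As |2 q - 1| equals 2 (q - 1) + 1 for positive q and 2 (- q) + 1 otherwise,
      the index j is \<open>q - 1\<close> or \<open>- q\<close>.\<close>
    show "\<bar>m\<bar> \<in> {(2 * j + 1) * k |j. j \<ge> 0}"
    proof (cases "q \<ge> 1")
      case True
      then have "\<bar>m\<bar> = (2 * (q - 1) + 1) * k" "q - 1 \<ge> 0" using k by (simp_all add: m abs_mult)
      then show ?thesis by blast
    next
      case False
      then have "\<bar>m\<bar> = (2 * (- q) + 1) * k" "- q \<ge> 0" using k by (simp_all add: m abs_mult)
      then show ?thesis by blast
    qed
  qed (use k in auto)
  ultimately show ?thesis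
    unfolding cosine_chain_def transverse_block_def Jf Jh using sym by blast
qed

lemma mode_eigenvector:
  assumes s: "s \<ge> 0" and f: "f \<in> L2" "f \<noteq> 0" "D1 k n (A1 k n f) = - of_real \<nu> *\<^sub>C f" "\<nu> > 0"
    "reflect f = f" "\<And>m. f m \<noteq> 0 \<Longrightarrow> 2 * k dvd m"
    and \<mu>: "\<mu> = of_int (n * k) * sqrt \<nu>"
  shows "eigenvector (L_op k) (cosine_chain s k n) (of_real \<mu>) (mode k n \<mu> f)"
  unfolding eigenvector_def
proof (intro conjI)
  have reg: "f \<in> sobolev1 s" by (rule D1_A1_eigenvector_regular[OF n f(1,3,4)])
  let ?h = "of_real (of_int (n * k) / \<mu>) *\<^sub>C C1 k (A1 k n f)"
  have refl: "reflect (C1 k (A1 k n f)) = C1 k (A1 k n f)"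
    by (simp add: f(5) flip: A1_reflect C1_reflect)
  have supp: "2 * k dvd m + k" if "C1 k (A1 k n f) m \<noteq> 0" for m
  proof -
    have "f (m - k) \<noteq> 0 \<or> f (m + k) \<noteq> 0"
      using that by (auto simp: C1_apply A1_def)
    then have "2 * k dvd m - k \<or> 2 * k dvd m + k" using f(6) by blast
    moreover have "m + k = (m - k) + 2 * k" by simp
    ultimately show ?thesis by (metis dvd_add dvd_refl)
  qed
  show "mode k n \<mu> f \<in> cosine_chain s k n"
    unfolding mode_def
  proof (rule cosine_chainI[OF s reg f(5,6)])
    show "?h \<in> sobolev1 s" by (intro sobolev1_scaleC sobolev1_C1 sobolev1_A1 reg s)
    show "reflect ?h = ?h"
      using fun_cong[OF refl] by (simp add: fun_eq_iff reflect_def scaleC_apply)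
    show "2 * k dvd m + k" if "?h m \<noteq> 0" for m
      using that supp[of m] by (auto simp: scaleC_apply)
  qed auto
  show "L_op k (mode k n \<mu> f) = of_real \<mu> *\<^sub>C mode k n \<mu> f"
    by (rule L_op_mode[OF f(3,4) \<mu>])
  show "mode k n \<mu> f \<noteq> 0"
  proof
    assume "mode k n \<mu> f = 0"
    then have "tensor f (fcos n) = tensor 0 (fcos n)"
      by (auto simp: mode_def zero_prod_def tensor_def fun_eq_iff)
    then show False using tensor_inject[where g = "fcos n" and p = n] fcos_n[OF n] f(2) by blast
  qed
qed

text \<open>A chain \<open>(L - \<mu>) w\<^sub>2 = w\<^sub>1\<close>, \<open>(L - \<mu>) w\<^sub>1 = 0\<close> would give a Jordan chain of \<open>D A\<close>.\<close>

lemma L_op_no_jordan: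
  assumes \<mu>: "\<mu> > 0" and f: "f \<in> L2" and h: "B1 k n h \<in> L2"
    and w: "w = (tensor h (fsin n), tensor f (fcos n))"
    and T: "T = (\<lambda>w. L_op k w - of_real \<mu> *\<^sub>C w)" and TT: "T (T w) = 0"
  shows "T w = 0"
proof -
  let ?N = "of_int (n * k) :: complex"
  have N: "?N \<noteq> 0" using nk by (metis of_int_0_eq_iff of_int_eq_0_iff less_irrefl)
  define h1 where "h1 = ?N *\<^sub>C C1 k (A1 k n f) - of_real \<mu> *\<^sub>C h"
  define f1 where "f1 = (- ?N) *\<^sub>C C1 k (B1 k n h) - of_real \<mu> *\<^sub>C f"
  have Tw: "T w = (tensor h1 (fsin n), tensor f1 (fcos n))"
    unfolding T w L_op_tensor[OF n] scaleC_pair tensor_scaleC[symmetric] minus_prod_def fst_conv snd_conv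
      tensor_diff h1_def f1_def ..
  have "L_op k (T w) = of_real \<mu> *\<^sub>C T w" using TT unfolding T by simp
  note eig = L_op_eigenD[OF \<mu> this[unfolded Tw]]
  have CB: "C1 k (B1 k n h) \<in> L2" by (rule bounded_op_L2D(1)[OF bounded_op_C1 h])
  have f1: "f1 \<in> L2"
    using L2_add[OF L2_scaleC[OF CB, of "- ?N"] L2_scaleC[OF f, of "- of_real \<mu>"]] by (simp add: f1_def)
  define \<nu> where "\<nu> = (\<mu> / of_int (n * k))\<^sup>2"
  have \<nu>: "\<nu> > 0" unfolding \<nu>_def by (intro zero_less_power divide_pos_pos \<mu> nk)
  \<comment> \<open>Eliminating h from the two components of T w gives D A f = - \<nu> f - c f1.
    With N = n k, the term in f1 arises twice, each time with the coefficient \<mu> / N^2: once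
    through h1 and once through C B h.\<close>
  define c where "c = 2 * \<mu> / (of_int (n * k))\<^sup>2"
  have "c > 0" unfolding c_def by (intro divide_pos_pos mult_pos_pos zero_less_power nk \<mu>) simp
  then have c: "c \<noteq> 0" by simp
  have DA: "D1 k n (A1 k n f) m = - of_real \<nu> * f m - of_real c * f1 m" for m
  proof -
    have CA: "C1 k (A1 k n f) = (1 / ?N) *\<^sub>C h1 + (of_real \<mu> / ?N) *\<^sub>C h"
      using N by (simp add: h1_def fun_eq_iff scaleC_apply field_simps)
    have "D1 k n (A1 k n f) = (1 / ?N) *\<^sub>C C1 k (B1 k n h1) + (of_real \<mu> / ?N) *\<^sub>C C1 k (B1 k n h)"
      by (simp only: D1_def o_apply CA B1_add B1_scaleC C1_add C1_scaleC)
    then have 1: "D1 k n (A1 k n f) m = (1 / ?N) * C1 k (B1 k n h1) m + (of_real \<mu> / ?N) * C1 k (B1 k n h) m"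
      by (simp only: plus_fun_apply scaleC_apply)
    have 2: "f1 m = - ?N * C1 k (B1 k n h) m - of_real \<mu> * f m"
      by (simp only: f1_def minus_apply scaleC_apply)
    have 3: "C1 k (B1 k n h1) m = - (of_real \<mu> / ?N) * f1 m"
      using fun_cong[OF eig(3), of m] by (simp only: scaleC_apply of_real_divide of_real_of_int_eq)
    have \<nu>c: "complex_of_real \<nu> = (of_real \<mu> / ?N)\<^sup>2" "complex_of_real c = 2 * of_real \<mu> / ?N\<^sup>2"
      by (simp_all only: \<nu>_def c_def of_real_divide of_real_power of_real_mult of_real_of_int_eq of_real_numeral)
    have alg: "1 / N * (- (M / N) * F) + M / N * X = - (M / N)\<^sup>2 * G - 2 * M / N\<^sup>2 * F"
      if "N \<noteq> 0" "F = - N * X - M * G" for N M F X G :: complex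
    proof -
      have NX: "N * X = - F - M * G" using that(2) by simp
      have "1 / N * (- (M / N) * F) + M / N * X = (- M * F + M * (N * X)) / N\<^sup>2"
        using that(1) by (simp add: field_simps power2_eq_square)
      also have "\<dots> = - (M / N)\<^sup>2 * G - 2 * M / N\<^sup>2 * F"
        unfolding NX using that(1) by (simp add: field_simps power2_eq_square)
      finally show ?thesis .
    qed
    show ?thesis
      unfolding 1 3 \<nu>c by (rule alg[OF N 2])
  qed
  define x y where "x = Abs_ell2 f1" and "y = Abs_ell2 f"
  have R: "Rep_ell2 x = f1" "Rep_ell2 y = f" using f f1 by (simp_all add: x_def y_def Abs_ell2_inverse)
  have "DT (AT x) = - (\<nu> *\<^sub>R x)"
    using fun_cong[OF eig(2)] by (intro ell2_eqI) (simp add: Rep_DT Rep_AT Rep_simps R scaleC_apply \<nu>_def)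
  moreover have "DT (AT y) = - (\<nu> *\<^sub>R y) - c *\<^sub>R x"
    using DA by (intro ell2_eqI) (simp add: Rep_DT Rep_AT Rep_simps R)
  ultimately have "x = 0" using no_jordan_chain \<nu> c by blast
  then have f10: "f1 = 0" using R(1) by (metis zero_ell2.rep_eq)
  then have "h1 = 0" using eig(1) A1_scaleC[of k n 0 0] C1_scaleC[of k 0 0] by simp
  with f10 show ?thesis by (simp add: Tw zero_prod_def tensor_def fun_eq_iff)
qed

lemma gen_eigenspace_eq_eigenspace:
  assumes s: "s \<ge> 0" and \<mu>: "\<mu> > 0"
    and w: "w \<in> gen_eigenspace (L_op k) (transverse_block s k n) (of_real \<mu>)"
  shows "L_op k w = of_real \<mu> *\<^sub>C w"
proof -
  define T where "T = (\<lambda>w. L_op k w - of_real \<mu> *\<^sub>C w)"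
  \<comment> \<open>This space contains the block and is visibly invariant under T. Its condition on
    h is imposed on B h, in accordance with the low regularity of h.\<close>
  define Y where "Y = {(tensor h (fsin n), tensor f (fcos n)) |h f. f \<in> L2 \<and> B1 k n h \<in> L2}"
  have TY: "T v \<in> Y" if v: "v \<in> Y" for v
  proof -
    obtain h f where v: "v = (tensor h (fsin n), tensor f (fcos n))" and hf: "f \<in> L2" "B1 k n h \<in> L2"
      using v by (auto simp: Y_def)
    let ?h = "of_int (n * k) *\<^sub>C C1 k (A1 k n f) + (- of_real \<mu>) *\<^sub>C h"
    let ?f = "(- of_int (n * k)) *\<^sub>C C1 k (B1 k n h) + (- of_real \<mu>) *\<^sub>C f"
    have "T v = (tensor ?h (fsin n), tensor ?f (fcos n))"
      unfolding T_def v L_op_tensor[OF n] scaleC_pair tensor_scaleC[symmetric] minus_prod_def fst_conv snd_conv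
        tensor_diff by simp
    moreover have "?f \<in> L2"
      by (intro L2_add L2_scaleC hf bounded_op_L2D(1)[OF bounded_op_C1])
    moreover have "B1 k n ?h \<in> L2"
      unfolding B1_add B1_scaleC
      by (intro L2_add L2_scaleC hf bounded_op_L2D(1)[OF bounded_op_C1] A1_L2 bounded_op_L2D(1)[OF bounded_op_B1[OF n]])
    ultimately show ?thesis unfolding Y_def by blast
  qed
  have step: "T v = 0" if v: "v \<in> Y" and TT: "T (T v) = 0" for v
  proof -
    obtain h f where "v = (tensor h (fsin n), tensor f (fcos n))" "f \<in> L2" "B1 k n h \<in> L2"
      using v by (auto simp: Y_def)
    then show ?thesis using L_op_no_jordan[OF \<mu> _ _ _ T_def TT] by blast
  qed
  have T0: "T 0 = 0"
  proof -
    have "(0 :: dist2 \<times> dist2) = (tensor 0 (fsin n), tensor 0 (fcos n))"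
      by (simp add: zero_prod_def tensor_def fun_eq_iff)
    moreover have "C1 k (A1 k n 0) = 0" "C1 k (B1 k n 0) = 0"
      by (simp_all add: fun_eq_iff C1_apply A1_def B1_def)
    ultimately show ?thesis
      unfolding T_def using L_op_tensor[OF n, of k 0 0] by simp
  qed
  \<comment> \<open>The induction applies the hypothesis to \<open>T v\<close>, which gives
    \<open>T (T v) = 0\<close>; then \<open>step\<close> lowers the order of the chain to
    one.\<close>
  have chain: "(T ^^ p) v = 0 \<Longrightarrow> v \<in> Y \<Longrightarrow> T v = 0" for p v
  proof (induction p arbitrary: v)
    case 0
    then show ?case using T0 by simp
  next
    case (Suc p)
    have "(T ^^ p) (T v) = 0" using Suc.prems(1) by (simp add: funpow_swap1)
    then have "T (T v) = 0" using Suc.IH TY Suc.prems(2) by blast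
    then show ?case using step Suc.prems(2) by blast
  qed
  obtain p where "(T ^^ p) w = 0" and V: "w \<in> transverse_block s k n"
    using w by (auto simp: gen_eigenspace_def T_def)
  moreover have "w \<in> Y"
    using transverse_blockD[OF V s k n] unfolding Y_def by blast
  ultimately have "T w = 0" using chain by blast
  then show ?thesis by (simp add: T_def)
qed

end

section \<open>Eigenvectors on the even cosines\<close>

lemma fcos_L2: "fcos j \<in> L2"
proof -
  have "Rep_ell2 (cosv j) = fcos j" by (simp add: fun_eq_iff Rep_cosv fcos_eq)
  then show ?thesis using Rep_ell2[of "cosv j"] by simp
qed

lemma even_cosines_eq: "even_cosines k = closed_span 0 (fcos ` {2 * j * k |j. j \<ge> 0})"
  unfolding even_cosines_def by (rule arg_cong[of _ _ "closed_span 0"]) blast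

lemma even_cosinesD:
  assumes "g \<in> even_cosines k"
  shows "g \<in> L2" "g m \<noteq> 0 \<Longrightarrow> k dvd m"
proof -
  show "g \<in> L2" using assms by (simp add: even_cosines_def closed_span_def)
  show "k dvd m" if "g m \<noteq> 0"
  proof (rule ccontr)
    assume m: "\<not> k dvd m"
    have "g m = 0"
    proof (rule closed_span_0_supp[OF assms[unfolded even_cosines_eq]])
      fix v assume "v \<in> fcos ` {2 * j * k |j. j \<ge> 0}"
      then obtain j where v: "v = fcos (2 * j * k)" by blast
      have "m \<noteq> 2 * j * k" "m \<noteq> - (2 * j * k)" using m by auto
      then have "v m = 0" unfolding v fcos_eq by simp
      then show "v \<in> L2 \<and> v m = 0" unfolding v using fcos_L2 by blast
    qed
    then show False using that by simp
  qed
qed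

lemma even_cosinesI:
  assumes "k \<ge> 1" "g \<in> L2" "reflect g = g" "\<And>m. g m \<noteq> 0 \<Longrightarrow> 2 * k dvd m"
  shows "g \<in> even_cosines k"
  unfolding even_cosines_eq
proof (rule closed_span_fcosI[OF _ assms(2,3)])
  fix m assume "g m \<noteq> 0"
  then obtain q where "m = 2 * k * q" using assms(4) by blast
  then have "\<bar>m\<bar> = 2 * \<bar>q\<bar> * k" using assms(1) by (simp add: abs_mult)
  then show "\<bar>m\<bar> \<in> {2 * j * k |j. j \<ge> 0}" using abs_ge_zero by blast
qed (use assms(1) in auto)

lemma complex_dim_span_singleton:
  assumes "V \<subseteq> complex_span {w}" "w \<in> V" "w \<noteq> 0"
  shows "complex_dim V = 1"
  using assms by (intro complex_vs.dim_unique[of "{w}"]) (auto simp: complex_vs.dependent_single)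

lemma real_valued_C1_A1:
  assumes "real_valued f"
  shows "real_valued (C1 k (A1 k n f))"
  using assms by (simp add: real_valued_conj flip: A1_conj C1_conj)

context chain_problem
begin

lemma K1_even_cosinesD:
  assumes "eigenvector (K1 k n) (even_cosines k) (- of_real \<nu>) g" "\<nu> > 0"
  shows "R1 g \<in> L2" "R1 g \<noteq> 0" "D1 k n (A1 k n (R1 g)) = - of_real \<nu> *\<^sub>C R1 g"
    "R1 g m \<noteq> 0 \<Longrightarrow> k dvd m"
proof -
  have g: "g \<in> even_cosines k" "g \<noteq> 0" "K1 k n g = - of_real \<nu> *\<^sub>C g"
    using assms(1) by (auto simp: eigenvector_def)
  note L2 = even_cosinesD(1)[OF g(1)]
  show "R1 g \<in> L2" "R1 g \<noteq> 0" "D1 k n (A1 k n (R1 g)) = - of_real \<nu> *\<^sub>C R1 g"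
    by (fact K1_eigenvectorD[OF L2 g(2,3) assms(2)])+
  have "freq_proj k g = g" using even_cosinesD(2)[OF g(1)] by (simp add: freq_proj_eq_iff)
  then have "freq_proj k (R1 g) = R1 g" using R1_freq_proj[OF L2, of k] by simp
  then show "R1 g m \<noteq> 0 \<Longrightarrow> k dvd m" by (simp add: freq_proj_eq_iff)
qed

text \<open>The vector \<open>g\<close> is a real multiple of D^(1/2) A f. Both operators commute
  with reflection, conjugation and \<open>freq_proj (2 * k)\<close>, so \<open>g\<close> inherits
  evenness, reality and frequencies from f.\<close>

lemma K1_even_cosines_eigenvectorI:
  assumes f: "f \<in> L2" "f \<noteq> 0" "D1 k n (A1 k n f) = - of_real \<nu> *\<^sub>C f" "\<nu> > 0"
    "reflect f = f" "real_valued f" "\<And>m. f m \<noteq> 0 \<Longrightarrow> 2 * k dvd m"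
  obtains g where "eigenvector (K1 k n) (even_cosines k) (- of_real \<nu>) g" "real_valued g"
proof
  define u where "u = R1 (A1 k n f)"
  define g where "g = - of_real (1 / \<nu>) *\<^sub>C u"
  note g = K1_eigenvectorI[OF f(1-4) g_def[unfolded u_def]]
  note A = A1_L2[OF f(1)]
  have "reflect u = u"
    unfolding u_def by (simp add: R1_reflect[OF A] f(5) flip: A1_reflect)
  then have refl: "reflect g = g" using fun_cong[of "reflect u" u]
    by (simp add: g_def reflect_def fun_eq_iff scaleC_apply)
  have "freq_proj (2 * k) f = f" using f(7) by (simp add: freq_proj_eq_iff)
  then have "freq_proj (2 * k) (A1 k n f) = A1 k n f"
    unfolding freq_proj_def A1_eq_diag by (subst diag_commute) simp
  then have "freq_proj (2 * k) u = u"
    unfolding u_def using R1_freq_proj[OF A, of "2 * k"] by simp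
  then have supp: "2 * k dvd m" if "g m \<noteq> 0" for m
    using that by (auto simp: g_def scaleC_apply freq_proj_eq_iff)
  show "eigenvector (K1 k n) (even_cosines k) (- of_real \<nu>) g"
    unfolding eigenvector_def using even_cosinesI[OF k g(1) refl supp] g(2,3) by blast
  have "conj_op u = u"
    unfolding u_def using f(6) by (simp add: R1_conj[OF A] real_valued_conj flip: A1_conj)
  then have "real_valued (of_real (- (1 / \<nu>)) *\<^sub>C u)"
    by (intro real_valued_scale) (simp add: real_valued_conj)
  then show "real_valued g" by (simp add: g_def)
qed

lemma no_positive_eigenvalue:
  assumes "s \<ge> 0" "n \<ge> k" "\<mu> > 0"
  shows "\<not> eigenvalue (L_op k) (cosine_chain s k n) (of_real \<mu>)"
proof
  assume "eigenvalue (L_op k) (cosine_chain s k n) (of_real \<mu>)"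
  then obtain w where "eigenvector (L_op k) (transverse_block s k n) (of_real \<mu>) w"
    using cosine_chain_subset unfolding eigenvalue_def eigenvector_def by blast
  then obtain f where f: "f \<in> L2" "f \<noteq> 0" "\<And>m. f m \<noteq> 0 \<Longrightarrow> k dvd m"
    "D1 k n (A1 k n f) = - of_real ((\<mu> / of_int (n * k))\<^sup>2) *\<^sub>C f"
    using block_eigenvectorD[OF assms(1,3)] by metis
  define x where "x = Abs_ell2 f"
  have R: "Rep_ell2 x = f" using f(1) by (simp add: x_def Abs_ell2_inverse)
  have "DT (AT x) = - ((\<mu> / of_int (n * k))\<^sup>2 *\<^sub>R x)"
    using fun_cong[OF f(4)] by (intro ell2_eqI) (simp add: Rep_DT Rep_AT Rep_simps R scaleC_apply)
  moreover have "(\<mu> / of_int (n * k))\<^sup>2 > 0"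
    by (intro zero_less_power divide_pos_pos assms nk)
  ultimately have "x = 0"
    using assms(2) f(3) by (intro no_eigenvector[where x = x and \<nu> = "(\<mu> / of_int (n * k))\<^sup>2"]) (auto simp: R)
  then show False using R f(2) by (metis zero_ell2.rep_eq)
qed

end

theorem proposition3p7:
  fixes s :: real and k n :: int
  assumes "s \<ge> 0" and "k \<ge> 1" and "n \<ge> 1"
  shows
    "(n \<ge> k \<longrightarrow> \<not> (\<exists>\<mu>::real. \<mu> > 0 \<and> eigenvalue (L_op k) (cosine_chain s k n) (of_real \<mu>))) \<and>
     (n < k \<longrightarrow> (\<exists>lam::real.
        lam > 0 \<and> eigenvalue (L_op k) (cosine_chain s k n) (of_real lam) \<and>
        (\<forall>\<mu>::real. \<mu> > 0 \<and> eigenvalue (L_op k) (cosine_chain s k n) (of_real \<mu>) \<longrightarrow> \<mu> = lam) \<and>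
        algebraically_simple (L_op k) (transverse_block s k n) (of_real lam) \<and>
        (\<exists>!\<nu>::real. \<nu> > 0 \<and> eigenvalue (K1 k n) (even_cosines k) (- of_real \<nu>)) \<and>
        (\<exists>(\<nu>::real) g. \<nu> > 0 \<and> eigenvector (K1 k n) (even_cosines k) (- of_real \<nu>) g \<and> real_valued g) \<and>
        (\<forall>(\<nu>::real) g f F \<omega>.
           \<nu> > 0 \<and> eigenvector (K1 k n) (even_cosines k) (- of_real \<nu>) g \<and> real_valued g \<and>
           f = sqrt_op_L2 (D1 k n) g \<and>
           F = tensor f (fcos n) \<and>
           \<omega> = tensor (of_real (of_int (n * k) / lam) *\<^sub>C C1 k (A1 k n f)) (fsin n) \<longrightarrow>
           lam = of_int (n * k) * sqrt \<nu> \<and>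
           eigenvector (L_op k) (cosine_chain s k n) (of_real lam) (\<omega>, F) \<and>
           real_valued \<omega> \<and> real_valued F)))"
proof -
  interpret chain_problem k n by unfold_locales (fact assms(2), fact assms(3))
  let ?E = "\<lambda>\<mu>::real. eigenvalue (L_op k) (cosine_chain s k n) (of_real \<mu>)"
  show ?thesis
  proof (intro conjI impI)
    assume "n \<ge> k"
    then show "\<not> (\<exists>\<mu>::real. \<mu> > 0 \<and> ?E \<mu>)"
      using no_positive_eigenvalue[OF assms(1)] by blast
  next
    assume "n < k"
    then obtain \<nu>0 f0 where f0: "\<nu>0 > 0" "f0 \<in> L2" "f0 \<noteq> 0" "D1 k n (A1 k n f0) = - of_real \<nu>0 *\<^sub>C f0"
      "reflect f0 = f0" "real_valued f0" "\<And>m. f0 m \<noteq> 0 \<Longrightarrow> 2 * k dvd m"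
      using D1_A1_eigenvector_exists by metis
    have f0_k: "k dvd m" if "f0 m \<noteq> 0" for m using f0(7)[OF that] by (rule dvd_mult_right)
    have uniq: "\<mu> = \<nu>0" "\<exists>c. v = c *\<^sub>C f0"
      if "v \<in> L2" "v \<noteq> 0" "D1 k n (A1 k n v) = - of_real \<mu> *\<^sub>C v" "\<mu> > 0" "\<And>m. v m \<noteq> 0 \<Longrightarrow> k dvd m" for v \<mu>
      using D1_A1_unique[OF f0(2,3,4,1) f0_k that] by simp_all
    define lam where "lam = of_int (n * k) * sqrt \<nu>0"
    have lam: "lam > 0" unfolding lam_def using f0(1) by (intro mult_pos_pos nk) simp
    define w0 where "w0 = mode k n lam f0"
    have w0: "eigenvector (L_op k) (cosine_chain s k n) (of_real lam) w0"
      unfolding w0_def by (rule mode_eigenvector[OF assms(1) f0(2,3,4,1,5,7) lam_def])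
    then have w0_block: "eigenvector (L_op k) (transverse_block s k n) (of_real lam) w0"
      using cosine_chain_subset by (auto simp: eigenvector_def)
    have "?E lam" unfolding eigenvalue_def using w0 by blast
    have only: "\<mu> = lam" if "\<mu> > 0" "?E \<mu>" for \<mu>
    proof -
      obtain w where "eigenvector (L_op k) (transverse_block s k n) (of_real \<mu>) w"
        using \<open>?E \<mu>\<close> cosine_chain_subset unfolding eigenvalue_def eigenvector_def by blast
      then obtain f where f: "f \<in> L2" "f \<noteq> 0" "\<And>m. f m \<noteq> 0 \<Longrightarrow> k dvd m"
        "D1 k n (A1 k n f) = - of_real ((\<mu> / of_int (n * k))\<^sup>2) *\<^sub>C f"
        using block_eigenvectorD[OF assms(1) \<open>\<mu> > 0\<close>] by metis
      have "(\<mu> / of_int (n * k))\<^sup>2 > 0" by (intro zero_less_power divide_pos_pos \<open>\<mu> > 0\<close> nk)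
      from uniq(1)[OF f(1,2,4) this f(3)] have "sqrt \<nu>0 = \<mu> / of_int (n * k)"
        using \<open>\<mu> > 0\<close> nk by (metis divide_pos_pos less_imp_le real_sqrt_abs abs_of_nonneg)
      then show ?thesis using k n by (simp add: lam_def)
    qed
    let ?G = "gen_eigenspace (L_op k) (transverse_block s k n) (of_real lam)"
    have "w0 \<in> ?G"
      using w0_block unfolding gen_eigenspace_def eigenvector_def
      by (auto intro!: exI[of _ "Suc 0"])
    have span: "?G \<subseteq> complex_span {w0}"
    proof
      fix w assume w: "w \<in> ?G"
      show "w \<in> complex_span {w0}"
      proof (cases "w = 0")
        case False
        then have "eigenvector (L_op k) (transverse_block s k n) (of_real lam) w"
          using gen_eigenspace_eq_eigenspace[OF assms(1) lam w] w
          by (simp add: eigenvector_def gen_eigenspace_def)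
        then obtain f where f: "w = mode k n lam f" "f \<in> L2" "f \<noteq> 0" "\<And>m. f m \<noteq> 0 \<Longrightarrow> k dvd m"
          "D1 k n (A1 k n f) = - of_real ((lam / of_int (n * k))\<^sup>2) *\<^sub>C f"
          using block_eigenvectorD[OF assms(1) lam] by metis
        have "(lam / of_int (n * k))\<^sup>2 > 0" by (intro zero_less_power divide_pos_pos lam nk)
        from uniq(2)[OF f(2,3,5) this f(4)] obtain c where "f = c *\<^sub>C f0" by blast
        then have "w = c *\<^sub>C w0" unfolding f(1) w0_def by (simp only: mode_scaleC)
        then show ?thesis by (simp add: complex_vs.span_scale complex_vs.span_base)
      qed (simp add: complex_vs.span_zero)
    qed
    have simple: "algebraically_simple (L_op k) (transverse_block s k n) (of_real lam)"
      unfolding algebraically_simple_def eigenvalue_def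
      using w0_block complex_dim_span_singleton[OF span \<open>w0 \<in> ?G\<close>] unfolding eigenvector_def by blast
    obtain g0 where g0: "eigenvector (K1 k n) (even_cosines k) (- of_real \<nu>0) g0" "real_valued g0"
      using K1_even_cosines_eigenvectorI[OF f0(2,3,4,1,5,6,7)] by blast
    have K_only: "\<nu> = \<nu>0" "\<exists>c. R1 g = c *\<^sub>C f0"
      if "eigenvector (K1 k n) (even_cosines k) (- of_real \<nu>) g" "\<nu> > 0" for \<nu> g
      using uniq[OF K1_even_cosinesD(1-3)[OF that] that(2) K1_even_cosinesD(4)[OF that]] by blast+
    have modes: "lam = of_int (n * k) * sqrt \<nu> \<and>
        eigenvector (L_op k) (cosine_chain s k n) (of_real lam) (mode k n lam (R1 g)) \<and>
        real_valued (fst (mode k n lam (R1 g))) \<and> real_valued (snd (mode k n lam (R1 g)))"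
      if \<nu>: "\<nu> > 0" and g: "eigenvector (K1 k n) (even_cosines k) (- of_real \<nu>) g" "real_valued g" for \<nu> g
    proof (intro conjI)
      show l: "lam = of_int (n * k) * sqrt \<nu>" unfolding lam_def K_only(1)[OF g(1) \<nu>] ..
      \<comment> \<open>Uniqueness makes \<open>R1 g\<close> a multiple of \<open>f0\<close>, from
        which it inherits evenness and frequencies divisible by \<open>2 * k\<close>. Since
        \<open>c\<close> may be complex, reality is instead drawn from \<open>g\<close>, through
        conjugation commuting with \<open>R1\<close>.\<close>
      obtain c where c: "R1 g = c *\<^sub>C f0" using K_only(2)[OF g(1) \<nu>] by blast
      have "reflect (R1 g) = R1 g"
        unfolding c using fun_cong[OF f0(5)] by (simp add: reflect_def fun_eq_iff scaleC_apply)
      moreover have "2 * k dvd m" if "R1 g m \<noteq> 0" for m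
        using that f0(7)[of m] unfolding c by (auto simp: scaleC_apply)
      ultimately show "eigenvector (L_op k) (cosine_chain s k n) (of_real lam) (mode k n lam (R1 g))"
        using mode_eigenvector[OF assms(1) K1_even_cosinesD(1-3)[OF g(1) \<nu>] \<nu> _ _ l] by blast
      have "g \<in> L2" using g(1) even_cosinesD(1) by (auto simp: eigenvector_def)
      then have real: "real_valued (R1 g)"
        using R1_conj g(2) by (metis real_valued_conj)
      then show "real_valued (snd (mode k n lam (R1 g)))"
        by (simp add: mode_def real_valued_tensor fcos_real)
      show "real_valued (fst (mode k n lam (R1 g)))"
        unfolding mode_def fst_conv
        by (intro real_valued_tensor real_valued_scale real_valued_C1_A1 real fsin_real)
    qed
    show "\<exists>lam::real.
        lam > 0 \<and> eigenvalue (L_op k) (cosine_chain s k n) (of_real lam) \<and>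
        (\<forall>\<mu>::real. \<mu> > 0 \<and> eigenvalue (L_op k) (cosine_chain s k n) (of_real \<mu>) \<longrightarrow> \<mu> = lam) \<and>
        algebraically_simple (L_op k) (transverse_block s k n) (of_real lam) \<and>
        (\<exists>!\<nu>::real. \<nu> > 0 \<and> eigenvalue (K1 k n) (even_cosines k) (- of_real \<nu>)) \<and>
        (\<exists>(\<nu>::real) g. \<nu> > 0 \<and> eigenvector (K1 k n) (even_cosines k) (- of_real \<nu>) g \<and> real_valued g) \<and>
        (\<forall>(\<nu>::real) g f F \<omega>.
           \<nu> > 0 \<and> eigenvector (K1 k n) (even_cosines k) (- of_real \<nu>) g \<and> real_valued g \<and>
           f = sqrt_op_L2 (D1 k n) g \<and>
           F = tensor f (fcos n) \<and>
           \<omega> = tensor (of_real (of_int (n * k) / lam) *\<^sub>C C1 k (A1 k n f)) (fsin n) \<longrightarrow>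
           lam = of_int (n * k) * sqrt \<nu> \<and>
           eigenvector (L_op k) (cosine_chain s k n) (of_real lam) (\<omega>, F) \<and>
           real_valued \<omega> \<and> real_valued F)"
    proof (rule exI[of _ lam], intro conjI)
      show "\<exists>!\<nu>::real. \<nu> > 0 \<and> eigenvalue (K1 k n) (even_cosines k) (- of_real \<nu>)"
      proof (rule ex1I[of _ \<nu>0])
        show "\<nu>0 > 0 \<and> eigenvalue (K1 k n) (even_cosines k) (- of_real \<nu>0)"
          using f0(1) g0(1) unfolding eigenvalue_def by blast
        show "\<nu> = \<nu>0" if "\<nu> > 0 \<and> eigenvalue (K1 k n) (even_cosines k) (- of_real \<nu>)" for \<nu>
          using that K_only(1) unfolding eigenvalue_def by blast
      qed
      show "\<exists>(\<nu>::real) g. \<nu> > 0 \<and> eigenvector (K1 k n) (even_cosines k) (- of_real \<nu>) g \<and> real_valued g"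
        using f0(1) g0 by blast
      show "\<forall>\<mu>::real. \<mu> > 0 \<and> ?E \<mu> \<longrightarrow> \<mu> = lam" using only by blast
      show "\<forall>(\<nu>::real) g f F \<omega>.
          \<nu> > 0 \<and> eigenvector (K1 k n) (even_cosines k) (- of_real \<nu>) g \<and> real_valued g \<and>
          f = R1 g \<and> F = tensor f (fcos n) \<and>
          \<omega> = tensor (of_real (of_int (n * k) / lam) *\<^sub>C C1 k (A1 k n f)) (fsin n) \<longrightarrow>
          lam = of_int (n * k) * sqrt \<nu> \<and>
          eigenvector (L_op k) (cosine_chain s k n) (of_real lam) (\<omega>, F) \<and>
          real_valued \<omega> \<and> real_valued F"
      proof (intro allI impI, elim conjE)
        fix \<nu> :: real and g f F \<omega>
        assume g: "\<nu> > 0" "eigenvector (K1 k n) (even_cosines k) (- of_real \<nu>) g" "real_valued g"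
          and f: "f = R1 g" and F: "F = tensor f (fcos n)"
          and \<omega>: "\<omega> = tensor (of_real (of_int (n * k) / lam) *\<^sub>C C1 k (A1 k n f)) (fsin n)"
        have m: "mode k n lam (R1 g) = (\<omega>, F)" unfolding mode_def \<omega> F f ..
        show "lam = of_int (n * k) * sqrt \<nu> \<and>
            eigenvector (L_op k) (cosine_chain s k n) (of_real lam) (\<omega>, F) \<and>
            real_valued \<omega> \<and> real_valued F"
          using modes[OF g] unfolding m fst_conv snd_conv .
      qed
    qed (fact lam \<open>?E lam\<close> simple)+
  qed
qed

end
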